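(* The prop $\mathsf{spAffcb}_2$ (defined by generators and relations in the context) is a presentation for the prop $(\mathsf{Span}(\mathsf{AffFdVect}(\mathbb F_2))^*,+)$, the full subcategory of the category of spans of (possibly empty) finite-dimensional affine $\mathbb F_2$-vector spaces whose objects are the nonempty affine spaces. That is, the interpretation of generators given in the context extends to an isomorphism of props from $\mathsf{spAffcb}_2$ to this prop, whose object $n$ is $\mathbb F_2^n$.
   Context: A prop is a strict symmetric monoidal category whose objects are the natural numbers, generated under tensor by one object $1$. $f;g$ denotes "first $f$, then $g$"; $1_n$ is the identity on $n$; $\sigma:2\to 2$ is the symmetry. The prop given by generators and relations is the free prop on the generators modulo the relations (and the prop axioms). For a generator $c:2\to2$ and distinct $i,j$, $c^{ij}$ denotes $c$ applied (using symmetries) with its first wire on wire $i$ and its second wire on wire $j$, identity elsewhere. $\mathsf{Iso}(\mathsf{cb}_2)$: the prop generated by $c:2\to 2$ (controlled-not) modulo: $c;c=1_2$; $c^{21};c^{12};c^{21}=\sigma$; on three wires $c^{23};c^{12};c^{23}=c^{12};c^{13}$, $c^{12};c^{32}=c^{32};c^{12}$, $c^{21};c^{23}=c^{23};c^{21}$. $\mathsf{Iso}(\mathsf{Affcb}_2)$: add a generator $N:1\to1$ (not gate) with $N;N=1_1$, $(N\otimes 1_1);c=c;(N\otimes N)$, $(1_1\otimes N);c=c;(1_1\otimes N)$. $\mathsf{piAffcb}_2$ (partial isomorphisms): add to $\mathsf{Iso}(\mathsf{Affcb}_2)$ generators $u:0\to1$, $u^\dagger:1\to 0$, $z:0\to0$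 with $(u\otimes 1_1);c=u\otimes 1_1$, $c;(u^\dagger\otimes 1_1)=u^\dagger\otimes 1_1$, $z\otimes z=z$, $z\otimes c=z\otimes 1_2$, $z\otimes\sigma=z\otimes 1_2$, $z\otimes N=z\otimes 1_1$, $u;u^\dagger=1_0$, $u;N;u^\dagger=z$. It has an identity-on-objects involution $\dagger$, $\mathsf{piAffcb}_2\cong\mathsf{piAffcb}_2^{\mathsf{op}}$, fixing $c,N,z$ and exchanging $u,u^\dagger$. $\mathsf{pAffcb}_2$: let $\delta=(1_1\otimes u);c:1\to2$. Add to $\mathsf{piAffcb}_2$ a generator $\varepsilon:1\to0$ with $\delta;(\varepsilon\otimes1_1)=1_1=\delta;(1_1\otimes\varepsilon)$. (Equivalently, the pushout of props of $\mathsf{piAffcb}_2\leftarrow \mathsf{Epi}^{\mathsf{op}}\to\mathsf{cm}^{\mathsf{op}}$, where $\mathsf{Epi}$ is the prop of a commutative associative binary operation, $\mathsf{cm}$ the prop of a commutative monoid, and the comultiplication of $\mathsf{Epi}^{\mathsf{op}}$ is sent to $\delta$.) $\mathsf{spAffcb}_2$: the pushout of props of $\mathsf{pAffcb}_2^{\mathsf{op}}\leftarrow\mathsf{piAffcb}_2\to\mathsf{pAffcb}_2$, the left map being $\dagger$ followed by the opposite of the inclusion. Concretely, add to $\mathsf{pAffcb}_2$ a generator $\varepsilon^\dagger:0\to1$ with $(\varepsilon^\dagger\otimes1_1);\delta^\dagger=1_1=(1_1\otimes\varepsilon^\dagger);\delta^\dagger$, where $\delta^\dagger=c;(1_1\otimes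 u^\dagger)$. Semantics: $\mathsf{AffFdVect}(\mathbb F_2)$ is the category of finite-dimensional affine $\mathbb F_2$-vector spaces, including the empty one, and affine maps; it has pullbacks. Morphisms of $\mathsf{Span}$ are isomorphism classes of spans, composed by pullback. The tensor $+$ is $\mathbb F_2^n+\mathbb F_2^m=\mathbb F_2^{n+m}$, given on spans by the cartesian product of apexes and legs. Interpretation: an affine map $f$ is regarded as the span with left leg the identity and right leg $f$, and $f^\dagger$ as the reversed span; $c:(x,y)\mapsto(x,x+y)$; $N:x\mapsto x+1$; $u:\mathbb F_2^0\to\mathbb F_2$ picks $0$; $\varepsilon:\mathbb F_2\to\mathbb F_2^0$ is the unique map; $u^\dagger,\varepsilon^\dagger$ are the reversed spans of $u,\varepsilon$; $z$ is the span $\mathbb F_2^0\leftarrow\emptyset\to\mathbb F_2^0$. *)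

theory Defs
  imports "HOL-Library.Z2" "Jordan_Normal_Form.Matrix"
begin

section \<open>Props\<close>

text \<open>
  Composition is diagrammatic: \<open>Comp P f g\<close> is ``first \<open>f\<close>, then \<open>g\<close>''.  The operations are
  only meaningful on elements of the hom-sets; \<open>Symm P n m\<close> is the symmetry
  \<open>n + m \<rightarrow> m + n\<close>.
\<close>

record 'm prop_data =
  Hom :: "nat \<Rightarrow> nat \<Rightarrow> 'm set"
  Ident :: "nat \<Rightarrow> 'm"
  Comp :: "'m \<Rightarrow> 'm \<Rightarrow> 'm"
  Tens :: "'m \<Rightarrow> 'm \<Rightarrow> 'm"
  Symm :: "nat \<Rightarrow> nat \<Rightarrow> 'm"

definition is_category :: "('m, 'e) prop_data_scheme \<Rightarrow> bool" where
  "is_category P \<longleftrightarrow>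
     (\<forall>n. Ident P n \<in> Hom P n n) \<and>
     (\<forall>n m k. \<forall>f\<in>Hom P n m. \<forall>g\<in>Hom P m k. Comp P f g \<in> Hom P n k) \<and>
     (\<forall>n m. \<forall>f\<in>Hom P n m. Comp P (Ident P n) f = f \<and> Comp P f (Ident P m) = f) \<and>
     (\<forall>n m k l. \<forall>f\<in>Hom P n m. \<forall>g\<in>Hom P m k. \<forall>h\<in>Hom P k l.
        Comp P (Comp P f g) h = Comp P f (Comp P g h))"

definition is_strict_monoidal :: "('m, 'e) prop_data_scheme \<Rightarrow> bool" where
  "is_strict_monoidal P \<longleftrightarrow>
     (\<forall>n m n' m'. \<forall>f\<in>Hom P n m. \<forall>g\<in>Hom P n' m'. Tens P f g \<in> Hom P (n + n') (m + m')) \<and>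
     (\<forall>n m. Tens P (Ident P n) (Ident P m) = Ident P (n + m)) \<and>
     (\<forall>n m k n' m' k'. \<forall>f\<in>Hom P n m. \<forall>g\<in>Hom P m k. \<forall>f'\<in>Hom P n' m'. \<forall>g'\<in>Hom P m' k'.
        Tens P (Comp P f g) (Comp P f' g') = Comp P (Tens P f f') (Tens P g g')) \<and>
     (\<forall>n m. \<forall>f\<in>Hom P n m. Tens P (Ident P 0) f = f \<and> Tens P f (Ident P 0) = f) \<and>
     (\<forall>n m n' m' n'' m''. \<forall>f\<in>Hom P n m. \<forall>g\<in>Hom P n' m'. \<forall>h\<in>Hom P n'' m''.
        Tens P (Tens P f g) h = Tens P f (Tens P g h))"

definition is_symmetric :: "('m, 'e) prop_data_scheme \<Rightarrow> bool" where
  "is_symmetric P \<longleftrightarrow>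
     (\<forall>n m. Symm P n m \<in> Hom P (n + m) (m + n)) \<and>
     (\<forall>n m n' m'. \<forall>f\<in>Hom P n m. \<forall>g\<in>Hom P n' m'.
        Comp P (Tens P f g) (Symm P m m') = Comp P (Symm P n n') (Tens P g f)) \<and>
     (\<forall>n m. Comp P (Symm P n m) (Symm P m n) = Ident P (n + m)) \<and>
     (\<forall>n m k. Symm P n (m + k) =
        Comp P (Tens P (Symm P n m) (Ident P k)) (Tens P (Ident P m) (Symm P n k)))"

definition is_prop :: "('m, 'e) prop_data_scheme \<Rightarrow> bool" where
  "is_prop P \<longleftrightarrow> is_category P \<and> is_strict_monoidal P \<and> is_symmetric P"

definition prop_iso :: "('m, 'e) prop_data_scheme \<Rightarrow> ('l, 'd) prop_data_scheme \<Rightarrow> ('m \<Rightarrow> 'l) \<Rightarrow> bool" where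
  "prop_iso P Q F \<longleftrightarrow>
     is_prop P \<and> is_prop Q \<and>
     (\<forall>n m. bij_betw F (Hom P n m) (Hom Q n m)) \<and>
     (\<forall>n. F (Ident P n) = Ident Q n) \<and>
     (\<forall>n m k. \<forall>f\<in>Hom P n m. \<forall>g\<in>Hom P m k. F (Comp P f g) = Comp Q (F f) (F g)) \<and>
     (\<forall>n m n' m'. \<forall>f\<in>Hom P n m. \<forall>g\<in>Hom P n' m'. F (Tens P f g) = Tens Q (F f) (F g)) \<and>
     (\<forall>n m. F (Symm P n m) = Symm Q n m)"


section \<open>Props given by generators and relations\<close>

datatype 'g pterm =
    Gen 'g
  | Idn nat
  | Swap nat nat
  | Seq "'g pterm" "'g pterm" (infixl \<open>;;\<close> 60)
  | Ten "'g pterm" "'g pterm" (infixr \<open>\<oslash>\<close> 65)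

text \<open>\<open>arity g = (n, m)\<close> declares a generator \<open>g : n \<rightarrow> m\<close>.\<close>

inductive typed :: "('g \<Rightarrow> nat \<times> nat) \<Rightarrow> 'g pterm \<Rightarrow> nat \<Rightarrow> nat \<Rightarrow> bool" for arity where
  "arity g = (n, m) \<Longrightarrow> typed arity (Gen g) n m"
| "typed arity (Idn n) n n"
| "typed arity (Swap n m) (n + m) (m + n)"
| "typed arity s n m \<Longrightarrow> typed arity t m k \<Longrightarrow> typed arity (s ;; t) n k"
| "typed arity s n m \<Longrightarrow> typed arity t n' m' \<Longrightarrow> typed arity (s \<oslash> t) (n + n') (m + m')"

text \<open>
  \<open>peq arity R n m s t\<close>: the terms \<open>s, t : n \<rightarrow> m\<close> are identified by the least congruence
  containing the prop axioms and the relations \<open>R\<close>.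
\<close>

inductive peq :: "('g \<Rightarrow> nat \<times> nat) \<Rightarrow> ('g pterm \<times> 'g pterm) set \<Rightarrow>
    nat \<Rightarrow> nat \<Rightarrow> 'g pterm \<Rightarrow> 'g pterm \<Rightarrow> bool" for arity R where
  peq_refl: "typed arity s n m \<Longrightarrow> peq arity R n m s s"
| peq_sym: "peq arity R n m s t \<Longrightarrow> peq arity R n m t s"
| peq_trans: "peq arity R n m s t \<Longrightarrow> peq arity R n m t r \<Longrightarrow> peq arity R n m s r"
| peq_seq: "peq arity R n m s s' \<Longrightarrow> peq arity R m k t t' \<Longrightarrow> peq arity R n k (s ;; t) (s' ;; t')"
| peq_ten: "peq arity R n m s s' \<Longrightarrow> peq arity R n' m' t t' \<Longrightarrow>
    peq arity R (n + n') (m + m') (s \<oslash> t) (s' \<oslash> t')"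
| peq_rel: "(s, t) \<in> R \<Longrightarrow> typed arity s n m \<Longrightarrow> typed arity t n m \<Longrightarrow> peq arity R n m s t"
| seq_id_left: "typed arity s n m \<Longrightarrow> peq arity R n m (Idn n ;; s) s"
| seq_id_right: "typed arity s n m \<Longrightarrow> peq arity R n m (s ;; Idn m) s"
| seq_assoc: "typed arity s n m \<Longrightarrow> typed arity t m k \<Longrightarrow> typed arity r k l \<Longrightarrow>
    peq arity R n l ((s ;; t) ;; r) (s ;; (t ;; r))"
| ten_id: "peq arity R (n + m) (n + m) (Idn n \<oslash> Idn m) (Idn (n + m))"
| ten_seq: "typed arity s n m \<Longrightarrow> typed arity t m k \<Longrightarrow> typed arity s' n' m' \<Longrightarrow> typed arity t' m' k' \<Longrightarrow>
    peq arity R (n + n') (k + k') ((s ;; t) \<oslash> (s' ;; t')) ((s \<oslash> s') ;; (t \<oslash> t'))"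
| ten_unit_left: "typed arity s n m \<Longrightarrow> peq arity R n m (Idn 0 \<oslash> s) s"
| ten_unit_right: "typed arity s n m \<Longrightarrow> peq arity R n m (s \<oslash> Idn 0) s"
| ten_assoc: "typed arity s n m \<Longrightarrow> typed arity t n' m' \<Longrightarrow> typed arity r n'' m'' \<Longrightarrow>
    peq arity R (n + n' + n'') (m + m' + m'') ((s \<oslash> t) \<oslash> r) (s \<oslash> (t \<oslash> r))"
| swap_natural: "typed arity s n m \<Longrightarrow> typed arity t n' m' \<Longrightarrow>
    peq arity R (n + n') (m' + m) ((s \<oslash> t) ;; Swap m m') (Swap n n' ;; (t \<oslash> s))"
| swap_swap: "peq arity R (n + m) (n + m) (Swap n m ;; Swap m n) (Idn (n + m))"
| swap_hexagon: "peq arity R (n + m + k) (m + k + n)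
    (Swap n (m + k)) ((Swap n m \<oslash> Idn k) ;; (Idn m \<oslash> Swap n k))"

definition peq_rel :: "('g \<Rightarrow> nat \<times> nat) \<Rightarrow> ('g pterm \<times> 'g pterm) set \<Rightarrow> ('g pterm \<times> 'g pterm) set" where
  "peq_rel arity R = {(s, t). \<exists>n m. peq arity R n m s t}"

definition presented_prop ::
    "('g \<Rightarrow> nat \<times> nat) \<Rightarrow> ('g pterm \<times> 'g pterm) set \<Rightarrow> 'g pterm set prop_data" where
  "presented_prop arity R = \<lparr>
     Hom = (\<lambda>n m. {s. typed arity s n m} // peq_rel arity R),
     Ident = (\<lambda>n. peq_rel arity R `` {Idn n}),
     Comp = (\<lambda>S T. \<Union>s\<in>S. \<Union>t\<in>T. peq_rel arity R `` {s ;; t}),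
     Tens = (\<lambda>S T. \<Union>s\<in>S. \<Union>t\<in>T. peq_rel arity R `` {s \<oslash> t}),
     Symm = (\<lambda>n m. peq_rel arity R `` {Swap n m}) \<rparr>"


section \<open>The prop spAffcb2\<close>

text \<open>\<open>Ud\<close> and \<open>Ed\<close> stand for \<open>u\<^sup>\<dagger>\<close> and \<open>\<epsilon>\<^sup>\<dagger>\<close>.\<close>

datatype gen = CNOT | NOT | U | Ud | Z | E | Ed

fun gen_arity :: "gen \<Rightarrow> nat \<times> nat" where
  "gen_arity CNOT = (2, 2)"
| "gen_arity NOT = (1, 1)"
| "gen_arity U = (0, 1)"
| "gen_arity Ud = (1, 0)"
| "gen_arity Z = (0, 0)"
| "gen_arity E = (1, 0)"
| "gen_arity Ed = (0, 1)"

abbreviation cc :: "gen pterm" where "cc \<equiv> Gen CNOT"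
abbreviation nn :: "gen pterm" where "nn \<equiv> Gen NOT"
abbreviation uu :: "gen pterm" where "uu \<equiv> Gen U"
abbreviation ud :: "gen pterm" where "ud \<equiv> Gen Ud"
abbreviation zz :: "gen pterm" where "zz \<equiv> Gen Z"
abbreviation eps :: "gen pterm" where "eps \<equiv> Gen E"
abbreviation epsd :: "gen pterm" where "epsd \<equiv> Gen Ed"
abbreviation sg :: "gen pterm" where "sg \<equiv> Swap 1 1"

text \<open>The controlled-not with control and target exchanged, on two wires.\<close>

definition cc_op :: "gen pterm" where
  "cc_op = sg ;; cc ;; sg"

text \<open>\<open>c3_ij\<close> is the controlled-not on three wires with control \<open>i\<close> and target \<open>j\<close>.\<close>

definition c3_12 :: "gen pterm" where "c3_12 = cc \<oslash> Idn 1"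
definition c3_21 :: "gen pterm" where "c3_21 = cc_op \<oslash> Idn 1"
definition c3_23 :: "gen pterm" where "c3_23 = Idn 1 \<oslash> cc"
definition c3_32 :: "gen pterm" where "c3_32 = Idn 1 \<oslash> cc_op"
definition c3_13 :: "gen pterm" where
  "c3_13 = (Idn 1 \<oslash> sg) ;; (cc \<oslash> Idn 1) ;; (Idn 1 \<oslash> sg)"

definition rels_Iso_cb2 :: "(gen pterm \<times> gen pterm) set" where
  "rels_Iso_cb2 = {
     (cc ;; cc, Idn 2),
     (cc_op ;; cc ;; cc_op, sg),
     (c3_23 ;; c3_12 ;; c3_23, c3_12 ;; c3_13),
     (c3_12 ;; c3_32, c3_32 ;; c3_12),
     (c3_21 ;; c3_23, c3_23 ;; c3_21)}"

definition rels_Iso_Affcb2 :: "(gen pterm \<times> gen pterm) set" where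
  "rels_Iso_Affcb2 = rels_Iso_cb2 \<union> {
     (nn ;; nn, Idn 1),
     ((nn \<oslash> Idn 1) ;; cc, cc ;; (nn \<oslash> nn)),
     ((Idn 1 \<oslash> nn) ;; cc, cc ;; (Idn 1 \<oslash> nn))}"

definition rels_piAffcb2 :: "(gen pterm \<times> gen pterm) set" where
  "rels_piAffcb2 = rels_Iso_Affcb2 \<union> {
     ((uu \<oslash> Idn 1) ;; cc, uu \<oslash> Idn 1),
     (cc ;; (ud \<oslash> Idn 1), ud \<oslash> Idn 1),
     (zz \<oslash> zz, zz),
     (zz \<oslash> cc, zz \<oslash> Idn 2),
     (zz \<oslash> sg, zz \<oslash> Idn 2),
     (zz \<oslash> nn, zz \<oslash> Idn 1),
     (uu ;; ud, Idn 0),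
     (uu ;; nn ;; ud, zz)}"

definition delta :: "gen pterm" where
  "delta = (Idn 1 \<oslash> uu) ;; cc"

definition deltad :: "gen pterm" where
  "deltad = cc ;; (Idn 1 \<oslash> ud)"

definition rels_pAffcb2 :: "(gen pterm \<times> gen pterm) set" where
  "rels_pAffcb2 = rels_piAffcb2 \<union> {
     (delta ;; (eps \<oslash> Idn 1), Idn 1),
     (delta ;; (Idn 1 \<oslash> eps), Idn 1)}"

definition rels_spAffcb2 :: "(gen pterm \<times> gen pterm) set" where
  "rels_spAffcb2 = rels_pAffcb2 \<union> {
     ((epsd \<oslash> Idn 1) ;; deltad, Idn 1),
     ((Idn 1 \<oslash> epsd) ;; deltad, Idn 1)}"

definition spAffcb2 :: "gen pterm set prop_data" where
  "spAffcb2 = presented_prop gen_arity rels_spAffcb2"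

definition spAffcb2_gen :: "gen \<Rightarrow> gen pterm set" where
  "spAffcb2_gen g = peq_rel gen_arity rels_spAffcb2 `` {Gen g}"

text \<open>The typing guard in the rule \<open>peq_rel\<close> does not discard any of the relations.\<close>

fun tdom :: "('g \<Rightarrow> nat \<times> nat) \<Rightarrow> 'g pterm \<Rightarrow> nat" where
  "tdom arity (Gen g) = fst (arity g)"
| "tdom arity (Idn n) = n"
| "tdom arity (Swap n m) = n + m"
| "tdom arity (s ;; t) = tdom arity s"
| "tdom arity (s \<oslash> t) = tdom arity s + tdom arity t"

fun tcod :: "('g \<Rightarrow> nat \<times> nat) \<Rightarrow> 'g pterm \<Rightarrow> nat" where
  "tcod arity (Gen g) = snd (arity g)"
| "tcod arity (Idn n) = n"
| "tcod arity (Swap n m) = m + n"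
| "tcod arity (s ;; t) = tcod arity t"
| "tcod arity (s \<oslash> t) = tcod arity s + tcod arity t"

fun wf_term :: "('g \<Rightarrow> nat \<times> nat) \<Rightarrow> 'g pterm \<Rightarrow> bool" where
  "wf_term arity (s ;; t) \<longleftrightarrow> wf_term arity s \<and> wf_term arity t \<and> tcod arity s = tdom arity t"
| "wf_term arity (s \<oslash> t) \<longleftrightarrow> wf_term arity s \<and> wf_term arity t"
| "wf_term arity _ \<longleftrightarrow> True"

lemma typed_iff:
  "typed arity t n m \<longleftrightarrow> wf_term arity t \<and> tdom arity t = n \<and> tcod arity t = m"
proof
  show "typed arity t n m \<Longrightarrow> wf_term arity t \<and> tdom arity t = n \<and> tcod arity t = m"
    by (induction rule: typed.induct) auto
  have "wf_term arity t \<Longrightarrow> typed arity t (tdom arity t) (tcod arity t)"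
    by (induction t) (auto intro: typed.intros)
  then show "wf_term arity t \<and> tdom arity t = n \<and> tcod arity t = m \<Longrightarrow> typed arity t n m"
    by auto
qed

lemma rels_spAffcb2_typed:
  "(s, t) \<in> rels_spAffcb2 \<Longrightarrow> \<exists>n m. typed gen_arity s n m \<and> typed gen_arity t n m"
  by (auto simp: typed_iff rels_spAffcb2_def rels_pAffcb2_def rels_piAffcb2_def
      rels_Iso_Affcb2_def rels_Iso_cb2_def delta_def deltad_def cc_op_def
      c3_12_def c3_21_def c3_23_def c3_32_def c3_13_def)


section \<open>Finite-dimensional affine spaces over the field with two elements\<close>

text \<open>
  An affine space is an affine subspace (possibly empty) of some coordinate space
  \<open>carrier_vec k\<close>.  Affine combinations are taken with arbitrarily many points: over
  this field every set is closed under the affine combinations of two points.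
\<close>

fun lin_comb :: "nat \<Rightarrow> (bit \<times> bit vec) list \<Rightarrow> bit vec" where
  "lin_comb k [] = 0\<^sub>v k"
| "lin_comb k ((r, x) # ps) = r \<cdot>\<^sub>v x + lin_comb k ps"

definition affine_weights :: "(bit \<times> bit vec) list \<Rightarrow> bool" where
  "affine_weights ps \<longleftrightarrow> sum_list (map fst ps) = 1"

record aff_space =
  amb :: nat
  pts :: "bit vec set"

definition is_aff_space :: "aff_space \<Rightarrow> bool" where
  "is_aff_space X \<longleftrightarrow> pts X \<subseteq> carrier_vec (amb X) \<and>
     (\<forall>ps. snd ` set ps \<subseteq> pts X \<and> affine_weights ps \<longrightarrow> lin_comb (amb X) ps \<in> pts X)"

definition affine_map :: "aff_space \<Rightarrow> aff_space \<Rightarrow> (bit vec \<Rightarrow> bit vec) \<Rightarrow> bool" where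
  "affine_map X Y f \<longleftrightarrow> (\<forall>x\<in>pts X. f x \<in> pts Y) \<and>
     (\<forall>ps. snd ` set ps \<subseteq> pts X \<and> affine_weights ps \<longrightarrow>
        f (lin_comb (amb X) ps) = lin_comb (amb Y) (map (\<lambda>(r, x). (r, f x)) ps))"

definition affine_iso :: "aff_space \<Rightarrow> aff_space \<Rightarrow> (bit vec \<Rightarrow> bit vec) \<Rightarrow> bool" where
  "affine_iso X Y f \<longleftrightarrow> affine_map X Y f \<and>
     (\<exists>g. affine_map Y X g \<and> (\<forall>x\<in>pts X. g (f x) = x) \<and> (\<forall>y\<in>pts Y. f (g y) = y))"

definition F2 :: "nat \<Rightarrow> aff_space" where
  "F2 n = \<lparr>amb = n, pts = carrier_vec n\<rparr>"

definition aff_prod :: "aff_space \<Rightarrow> aff_space \<Rightarrow> aff_space" where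
  "aff_prod X Y = \<lparr>amb = amb X + amb Y, pts = {x @\<^sub>v y | x y. x \<in> pts X \<and> y \<in> pts Y}\<rparr>"

text \<open>The two projections from (subspaces of) \<open>aff_prod X Y\<close>.\<close>

definition pr1 :: "aff_space \<Rightarrow> aff_space \<Rightarrow> bit vec \<Rightarrow> bit vec" where
  "pr1 X Y v = vec_first v (amb X)"

definition pr2 :: "aff_space \<Rightarrow> aff_space \<Rightarrow> bit vec \<Rightarrow> bit vec" where
  "pr2 X Y v = vec_last v (amb Y)"

definition pullback :: "aff_space \<Rightarrow> aff_space \<Rightarrow> (bit vec \<Rightarrow> bit vec) \<Rightarrow> (bit vec \<Rightarrow> bit vec) \<Rightarrow> aff_space" where
  "pullback X Y f g =
     \<lparr>amb = amb X + amb Y, pts = {x @\<^sub>v y | x y. x \<in> pts X \<and> y \<in> pts Y \<and> f x = g y}\<rparr>"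


lemma lin_comb_carrier [simp]:
  "snd ` set ps \<subseteq> carrier_vec k \<Longrightarrow> lin_comb k ps \<in> carrier_vec k"
  by (induction k ps rule: lin_comb.induct) auto

lemma bit_vec_add_self [simp]:
  fixes v :: "bit vec"
  assumes "v \<in> carrier_vec k"
  shows "v + v = 0\<^sub>v k"
proof -
  have "b + b = 0" for b :: bit by (cases b) auto
  then show ?thesis using assms by (intro eq_vecI) auto
qed

lemma bit_cases: "(r::bit) = 0 \<or> r = 1" by (cases r) auto

lemma lin_comb_three:
  fixes f :: "bit vec \<Rightarrow> bit vec"
  assumes cX: "A \<subseteq> carrier_vec k" and fA: "f ` A \<subseteq> carrier_vec l"
    and cl: "\<And>x y z. x \<in> A \<Longrightarrow> y \<in> A \<Longrightarrow> z \<in> A \<Longrightarrow>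
      x + y + z \<in> A \<and> f (x + y + z) = f x + f y + f z"
    and ps: "snd ` set ps \<subseteq> A"
  shows "(sum_list (map fst ps) = 1 \<longrightarrow> lin_comb k ps \<in> A \<and>
            f (lin_comb k ps) = lin_comb l (map (\<lambda>(r, x). (r, f x)) ps)) \<and>
         (sum_list (map fst ps) = 0 \<longrightarrow> (\<forall>a\<in>A. lin_comb k ps + a \<in> A \<and>
            f (lin_comb k ps + a) = lin_comb l (map (\<lambda>(r, x). (r, f x)) ps) + f a))"
  using ps
proof (induction ps)
  case Nil
  have "a \<in> carrier_vec k \<and> f a \<in> carrier_vec l" if "a \<in> A" for a using that cX fA by auto
  then show ?case by auto
next
  case (Cons p ps)
  obtain r x where p: "p = (r, x)" by (cases p)
  define g where "g = lin_comb l (map (\<lambda>(r, x). (r, f x)) ps)"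
  define w where "w = lin_comb k ps"
  have x: "x \<in> A" "x \<in> carrier_vec k" "f x \<in> carrier_vec l" using Cons.prems p cX fA by auto
  have psA: "snd ` set ps \<subseteq> A" using Cons.prems by auto
  have w: "w \<in> carrier_vec k" unfolding w_def using psA cX by (intro lin_comb_carrier) auto
  have g: "g \<in> carrier_vec l" unfolding g_def using psA fA by (intro lin_comb_carrier) force
  note IH = Cons.IH[OF psA, folded w_def g_def]
  have eq: "lin_comb k (p # ps) = r \<cdot>\<^sub>v x + w"
    "lin_comb l (map (\<lambda>(r, x). (r, f x)) (p # ps)) = r \<cdot>\<^sub>v f x + g"
    by (simp_all add: p w_def g_def)
  consider "r = 0" | "r = 1" using bit_cases by blast
  then show ?case
  proof cases
    case 1
    have "0 \<cdot>\<^sub>v x = 0\<^sub>v k" "0 \<cdot>\<^sub>v f x = 0\<^sub>v l" using x by (auto intro!: eq_vecI)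
    then show ?thesis using IH w g 1 unfolding eq by (simp add: p)
  next
    case 2
    have one: "1 \<cdot>\<^sub>v x = x" "1 \<cdot>\<^sub>v f x = f x" by auto
    show ?thesis unfolding eq 2 one
    proof (intro conjI impI ballI)
      assume "sum_list (map fst (p # ps)) = 1"
      then have "sum_list (map fst ps) = 0" using p 2 by simp
      then have "w + x \<in> A" "f (w + x) = g + f x" using IH x(1) by blast+
      then show "x + w \<in> A" "f (x + w) = f x + g"
        unfolding comm_add_vec[OF x(2) w] comm_add_vec[OF x(3) g] .
    next
      fix a assume a: "a \<in> A"
      assume "sum_list (map fst (p # ps)) = 0"
      then have "sum_list (map fst ps) = 1" using p 2 bit_cases[of "sum_list (map fst ps)"] by auto
      then have w': "w \<in> A" "f w = g" using IH by blast+
      show "x + w + a \<in> A" "f (x + w + a) = f x + g + f a"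
        using cl[OF x(1) w'(1) a] unfolding w'(2) by blast+
    qed
  qed
qed

lemma affine_weights_three: "affine_weights [(1, x), (1, y), (1, z)]"
  by (simp add: affine_weights_def)

lemma lin_comb_three_eq:
  "x \<in> carrier_vec k \<Longrightarrow> y \<in> carrier_vec k \<Longrightarrow> z \<in> carrier_vec k \<Longrightarrow>
    lin_comb k [(1, x), (1, y), (1, z)] = x + y + z"
  by simp

text \<open>Over the field with two elements, the affine combinations \<open>x + y + z\<close> of three points suffice.\<close>

lemma is_aff_space_iff:
  "is_aff_space X \<longleftrightarrow> pts X \<subseteq> carrier_vec (amb X) \<and>
     (\<forall>x\<in>pts X. \<forall>y\<in>pts X. \<forall>z\<in>pts X. x + y + z \<in> pts X)"
proof (intro iffI conjI ballI)
  assume X: "is_aff_space X"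
  then show sub: "pts X \<subseteq> carrier_vec (amb X)" by (simp add: is_aff_space_def)
  fix x y z assume xyz: "x \<in> pts X" "y \<in> pts X" "z \<in> pts X"
  have "lin_comb (amb X) [(1, x), (1, y), (1, z)] \<in> pts X"
    using X[unfolded is_aff_space_def, THEN conjunct2, rule_format, of "[(1, x), (1, y), (1, z)]"]
      xyz affine_weights_three by simp
  then show "x + y + z \<in> pts X"
    using lin_comb_three_eq sub xyz by (metis subsetD)
next
  assume *: "pts X \<subseteq> carrier_vec (amb X) \<and>
     (\<forall>x\<in>pts X. \<forall>y\<in>pts X. \<forall>z\<in>pts X. x + y + z \<in> pts X)"
  have "lin_comb (amb X) ps \<in> pts X" if "snd ` set ps \<subseteq> pts X" "affine_weights ps" for ps
    by (rule lin_comb_three[of "pts X" "amb X" "\<lambda>x. x" "amb X" ps,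
          THEN conjunct1, THEN mp, THEN conjunct1])
      (use * that in \<open>simp_all only: affine_weights_def image_ident\<close>)
  then show "is_aff_space X" using * unfolding is_aff_space_def by blast
qed

lemma affine_map_iff:
  assumes X: "is_aff_space X" and Y: "is_aff_space Y"
  shows "affine_map X Y f \<longleftrightarrow> (\<forall>x\<in>pts X. f x \<in> pts Y) \<and>
     (\<forall>x\<in>pts X. \<forall>y\<in>pts X. \<forall>z\<in>pts X. f (x + y + z) = f x + f y + f z)"
proof (intro iffI conjI ballI)
  assume f: "affine_map X Y f"
  fix x assume x: "x \<in> pts X"
  show fx: "f x \<in> pts Y" using f x by (simp add: affine_map_def)
  fix y z assume y: "y \<in> pts X" and z: "z \<in> pts X"
  have "f (lin_comb (amb X) [(1, x), (1, y), (1, z)]) = lin_comb (amb Y) [(1, f x), (1, f y), (1, f z)]"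
    using f[unfolded affine_map_def, THEN conjunct2, rule_format, of "[(1, x), (1, y), (1, z)]"]
      x y z affine_weights_three by simp
  moreover have "f y \<in> pts Y" "f z \<in> pts Y" using f y z by (auto simp: affine_map_def)
  ultimately show "f (x + y + z) = f x + f y + f z"
    using X Y x y z fx lin_comb_three_eq unfolding is_aff_space_def by (metis subsetD)
next
  assume f: "(\<forall>x\<in>pts X. f x \<in> pts Y) \<and>
     (\<forall>x\<in>pts X. \<forall>y\<in>pts X. \<forall>z\<in>pts X. f (x + y + z) = f x + f y + f z)"
  have fY: "f ` pts X \<subseteq> carrier_vec (amb Y)" using f Y unfolding is_aff_space_def by blast
  have "f (lin_comb (amb X) ps) = lin_comb (amb Y) (map (\<lambda>(r, x). (r, f x)) ps)"
    if "snd ` set ps \<subseteq> pts X" "affine_weights ps" for ps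
    by (rule lin_comb_three[of "pts X" "amb X" f "amb Y" ps,
          THEN conjunct1, THEN mp, THEN conjunct2])
      (use f X that fY in \<open>simp_all only: affine_weights_def is_aff_space_iff\<close>)
  then show "affine_map X Y f" using f unfolding affine_map_def by blast
qed

lemma is_aff_space_F2 [simp]: "is_aff_space (F2 n)"
  by (auto simp: is_aff_space_iff F2_def)

lemma is_aff_space_empty: "is_aff_space \<lparr>amb = n, pts = {}\<rparr>"
  by (auto simp: is_aff_space_iff)

lemma finite_pts:
  assumes "is_aff_space X"
  shows "finite (pts X)"
proof -
  have "(UNIV :: bit set) \<subseteq> {0, 1}" using bit_cases by blast
  then have "finite (UNIV :: bit set)" by (rule finite_subset) simp
  then have "finite {xs :: bit list. length xs = amb X}"
    using finite_lists_length_eq[of UNIV] by simp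
  then have "finite (vec_of_list ` {xs :: bit list. length xs = amb X})" by simp
  moreover have "pts X \<subseteq> vec_of_list ` {xs. length xs = amb X}"
  proof
    fix x assume "x \<in> pts X"
    then have "dim_vec x = amb X" using assms unfolding is_aff_space_def by auto
    then show "x \<in> vec_of_list ` {xs. length xs = amb X}"
      by (intro image_eqI[of _ _ "list_of_vec x"]) (auto simp: vec_list)
  qed
  ultimately show ?thesis by (rule finite_subset[rotated])
qed

lemma affine_iso_inj:
  assumes X: "is_aff_space X" and Y: "is_aff_space Y" and f: "affine_map X Y f"
    and inj: "inj_on f (pts X)" and surj: "f ` pts X = pts Y"
  shows "affine_iso X Y f"
proof -
  define g where "g = inv_into (pts X) f"
  have gf: "g (f x) = x" if "x \<in> pts X" for x using that inj by (simp add: g_def)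
  have fg: "f (g y) = y" "g y \<in> pts X" if "y \<in> pts Y" for y
    using that surj by (auto simp: g_def f_inv_into_f inv_into_into)
  have "affine_map Y X g"
    unfolding affine_map_iff[OF Y X]
  proof (intro conjI ballI)
    fix x assume x: "x \<in> pts Y"
    show "g x \<in> pts X" using fg x by simp
    fix y z assume y: "y \<in> pts Y" and z: "z \<in> pts Y"
    have "g x + g y + g z \<in> pts X"
      using X fg x y z by (simp add: is_aff_space_iff)
    moreover have "f (g x + g y + g z) = x + y + z"
      using f fg x y z unfolding affine_map_iff[OF X Y] by simp
    ultimately show "g (x + y + z) = g x + g y + g z" using gf by metis
  qed
  then show ?thesis using f gf fg unfolding affine_iso_def by blast
qed

lemma inj_affine_map_extend:
  assumes X: "is_aff_space X" and f: "affine_map (F2 m) X f" and inj: "inj_on f (carrier_vec m)"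
    and x: "x \<in> pts X" "x \<notin> f ` carrier_vec m"
  obtains f' where "affine_map (F2 (Suc m)) X f'" "inj_on f' (carrier_vec (Suc m))"
    "insert x (f ` carrier_vec m) \<subseteq> f' ` carrier_vec (Suc m)"
proof -
  define k where "k = amb X"
  define d where "d = x + f (0\<^sub>v m)"
  define f' where "f' = (\<lambda>v. f (vec_first v m) + v $ m \<cdot>\<^sub>v d)"
  have F2[simp]: "pts (F2 n) = carrier_vec n" for n by (simp add: F2_def)
  have fX: "f v \<in> pts X" if "v \<in> carrier_vec m" for v
    using f that unfolding affine_map_iff[OF is_aff_space_F2 X] by simp
  have ftri: "f (u + v + w) = f u + f v + f w"
    if "u \<in> carrier_vec m" "v \<in> carrier_vec m" "w \<in> carrier_vec m" for u v w
    using f that unfolding affine_map_iff[OF is_aff_space_F2 X] by simp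
  have Xk: "v \<in> carrier_vec k" if "v \<in> pts X" for v
    using X that unfolding is_aff_space_def k_def by auto
  have Xtri: "u + v + w \<in> pts X" if "u \<in> pts X" "v \<in> pts X" "w \<in> pts X" for u v w
    using X that unfolding is_aff_space_iff by auto
  have fk: "f v \<in> carrier_vec k" if "v \<in> carrier_vec m" for v using fX Xk that by auto
  have d: "d \<in> carrier_vec k" unfolding d_def using Xk[OF x(1)] fk by simp
  have f'0: "f' v = f (vec_first v m)" if "v $ m = 0" for v
    using that d carrier_vecD[OF fk[OF vec_first_carrier]] unfolding f'_def
    by (intro eq_vecI) auto
  have f'1: "f' v = f (vec_first v m) + x + f (0\<^sub>v m)" if "v $ m = 1" for v
    using that assoc_add_vec[OF fk[OF vec_first_carrier] Xk[OF x(1)] fk[OF zero_carrier_vec]]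
    unfolding f'_def d_def by simp
  have f'X: "f' v \<in> pts X" for v
    using bit_cases[of "v $ m"] f'0[of v] f'1[of v] Xtri x(1) fX by auto
  have first: "vec_first (u + v + w) m = vec_first u m + vec_first v m + vec_first w m"
    if "u \<in> carrier_vec (Suc m)" "v \<in> carrier_vec (Suc m)" "w \<in> carrier_vec (Suc m)" for u v w :: "bit vec"
    using that by (intro eq_vecI) (auto simp: vec_first_def)
  have aff: "affine_map (F2 (Suc m)) X f'"
    unfolding affine_map_iff[OF is_aff_space_F2 X]
  proof (intro conjI ballI)
    fix u show "f' u \<in> pts X" by (rule f'X)
  next
    fix u v w assume uvw: "u \<in> pts (F2 (Suc m))" "v \<in> pts (F2 (Suc m))" "w \<in> pts (F2 (Suc m))"
    have fs: "f (vec_first u m) \<in> carrier_vec k" for u by (rule fk[OF vec_first_carrier])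
    note fs' = carrier_vecD[OF fs]
    have [simp]: "dim_vec d = k" using d by auto
    have "f' (u + v + w) = f (vec_first u m) + f (vec_first v m) + f (vec_first w m) + (u + v + w) $ m \<cdot>\<^sub>v d"
      unfolding f'_def first[OF uvw[unfolded F2]]
        ftri[OF vec_first_carrier vec_first_carrier vec_first_carrier] ..
    also have "\<dots> = f' u + f' v + f' w"
    proof (rule eq_vecI)
      have dim: "dim_vec (f' u) = k" for u unfolding f'_def by simp
      show "dim_vec (f (vec_first u m) + f (vec_first v m) + f (vec_first w m) + (u + v + w) $ m \<cdot>\<^sub>v d)
          = dim_vec (f' u + f' v + f' w)" by (simp add: dim)
      fix i assume "i < dim_vec (f' u + f' v + f' w)"
      then have i: "i < k" by (simp add: dim)
      have bits: "(a + b + c) + (p + q + r) * t = (a + p * t) + (b + q * t) + (c + r * t)"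
        for a b c p q r t :: bit by (simp only: algebra_simps)
      have "(u + v + w) $ m = u $ m + v $ m + w $ m"
        using uvw by (simp only: F2 index_add_vec carrier_vecD lessI)
      then show "(f (vec_first u m) + f (vec_first v m) + f (vec_first w m) + (u + v + w) $ m \<cdot>\<^sub>v d) $ i
          = (f' u + f' v + f' w) $ i"
        using i by (simp only: f'_def index_add_vec index_smult_vec fs' \<open>dim_vec d = k\<close> bits)
    qed
    finally show "f' (u + v + w) = f' u + f' v + f' w" .
  qed
  have split: "v = vec_first v m @\<^sub>v vec 1 (\<lambda>_. v $ m)" if "v \<in> carrier_vec (Suc m)" for v :: "bit vec"
    using that by (intro eq_vecI) (auto simp: vec_first_def less_Suc_eq)
  have key: "u $ m = v $ m" if "f' u = f' v" "u $ m = 0 \<or> v $ m = 1" for u v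
  proof (rule ccontr)
    assume "u $ m \<noteq> v $ m"
    then have uv: "u $ m = 0" "v $ m = 1" using that bit_cases by metis+
    define a b c where "a = f (vec_first u m)" and "b = f (vec_first v m)" and "c = f (0\<^sub>v m)"
    have abc: "a \<in> carrier_vec k" "b \<in> carrier_vec k" "c \<in> carrier_vec k"
      unfolding a_def b_def c_def using fk by auto
    have "a = b + x + c" using that f'0[OF uv(1)] f'1[OF uv(2)] unfolding a_def b_def c_def by simp
    then have "a + b + c = b + x + c + b + c" by simp
    also have "\<dots> = x"
    proof (rule eq_vecI)
      show "dim_vec (b + x + c + b + c) = dim_vec x" using abc Xk[OF x(1)] by auto
      fix i assume "i < dim_vec x"
      then have "(b + x + c + b + c) $ i = b $ i + x $ i + c $ i + b $ i + c $ i"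
        using abc Xk[OF x(1)] by auto
      also have "\<dots> = x $ i" using bit_cases[of "b $ i"] bit_cases[of "c $ i"] by auto
      finally show "(b + x + c + b + c) $ i = x $ i" .
    qed
    finally have "x = f (vec_first u m + vec_first v m + 0\<^sub>v m)"
      unfolding a_def b_def c_def
        ftri[OF vec_first_carrier vec_first_carrier zero_carrier_vec] by (rule sym)
    moreover have "vec_first u m + vec_first v m + 0\<^sub>v m \<in> carrier_vec m" by simp
    ultimately show False using x(2) by blast
  qed
  have inj': "inj_on f' (carrier_vec (Suc m))"
  proof (rule inj_onI)
    fix u v assume u: "u \<in> carrier_vec (Suc m)" and v: "v \<in> carrier_vec (Suc m)" and eq: "f' u = f' v"
    have m: "u $ m = v $ m" using key[OF eq] key[OF eq[symmetric]] bit_cases by metis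
    have "f (vec_first u m) = f (vec_first v m)"
    proof (rule eq_vecI)
      show "dim_vec (f (vec_first u m)) = dim_vec (f (vec_first v m))"
        using carrier_vecD[OF fk[OF vec_first_carrier]] by simp
      fix i assume "i < dim_vec (f (vec_first v m))"
      then have i: "i < k" using carrier_vecD[OF fk[OF vec_first_carrier]] by simp
      have "f' u $ i = f' v $ i" using eq by simp
      then show "f (vec_first u m) $ i = f (vec_first v m) $ i"
        using i carrier_vecD[OF d] unfolding f'_def m
        by (simp only: index_add_vec index_smult_vec add_right_cancel)
    qed
    then have "vec_first u m = vec_first v m" using inj by (simp add: inj_on_eq_iff)
    then show "u = v" using split[OF u] split[OF v] m by metis
  qed
  have "f v \<in> f' ` carrier_vec (Suc m)" if v: "v \<in> carrier_vec m" for v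
  proof -
    have c: "v @\<^sub>v 0\<^sub>v 1 \<in> carrier_vec (Suc m)" 
      using append_carrier_vec[OF v zero_carrier_vec[of 1]] by simp
    have "vec_first (v @\<^sub>v 0\<^sub>v 1) m = v" "(v @\<^sub>v 0\<^sub>v 1) $ m = 0"
      using v by (auto simp: vec_first_def)
    then have "f' (v @\<^sub>v 0\<^sub>v 1) = f v" using f'0[of "v @\<^sub>v 0\<^sub>v 1"] by simp
    then show ?thesis using c by (intro image_eqI[of _ f' "v @\<^sub>v 0\<^sub>v 1"]) simp_all
  qed
  moreover have "x \<in> f' ` carrier_vec (Suc m)"
  proof -
    define v :: "bit vec" where "v = unit_vec (Suc m) m"
    have v: "vec_first v m = 0\<^sub>v m" "v $ m = 1" "v \<in> carrier_vec (Suc m)"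
      by (auto simp: v_def vec_first_def)
    have "f (0\<^sub>v m) + x + f (0\<^sub>v m) = x"
    proof (rule eq_vecI)
      have c: "dim_vec (f (0\<^sub>v m)) = k" "dim_vec x = k" using fk Xk x(1) by auto
      then show "dim_vec (f (0\<^sub>v m) + x + f (0\<^sub>v m)) = dim_vec x" by simp
      fix i assume "i < dim_vec x"
      then show "(f (0\<^sub>v m) + x + f (0\<^sub>v m)) $ i = x $ i"
        using c bit_cases[of "f (0\<^sub>v m) $ i"] by auto
    qed
    then have "f' v = x" using f'1[OF v(2)] v(1) by simp
    then show ?thesis using v(3) by (intro image_eqI[of _ f' v]) simp_all
  qed
  ultimately have "insert x (f ` carrier_vec m) \<subseteq> f' ` carrier_vec (Suc m)" by blast
  then show ?thesis by (rule that[OF aff inj'])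
qed

lemma nonempty_aff_space_iso_F2:
  assumes X: "is_aff_space X" and ne: "pts X \<noteq> {}"
  shows "\<exists>n f. affine_iso (F2 n) X f"
proof -
  have F2[simp]: "pts (F2 n) = carrier_vec n" for n by (simp add: F2_def)
  have *: "\<exists>n f. affine_iso (F2 n) X f" if "affine_map (F2 m) X f" "inj_on f (carrier_vec m)" for m f
    using that
  proof (induction "card (pts X - f ` carrier_vec m)" arbitrary: m f rule: less_induct)
    case less
    have sub: "f ` carrier_vec m \<subseteq> pts X" using less.prems(1) by (auto simp: affine_map_def)
    show ?case
    proof (cases "f ` carrier_vec m = pts X")
      case True
      then show ?thesis using affine_iso_inj[OF is_aff_space_F2 X less.prems(1)] less.prems(2) F2 by metis
    next
      case False
      then obtain x where x: "x \<in> pts X" "x \<notin> f ` carrier_vec m" using sub by auto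
      obtain f' where f': "affine_map (F2 (Suc m)) X f'" "inj_on f' (carrier_vec (Suc m))"
        "insert x (f ` carrier_vec m) \<subseteq> f' ` carrier_vec (Suc m)"
        using inj_affine_map_extend[OF X less.prems x] .
      have "pts X - f' ` carrier_vec (Suc m) \<subset> pts X - f ` carrier_vec m" using f'(3) x by auto
      then have "card (pts X - f' ` carrier_vec (Suc m)) < card (pts X - f ` carrier_vec m)"
        using finite_pts[OF X] by (intro psubset_card_mono) auto
      then show ?thesis using less.hyps f'(1,2) by blast
    qed
  qed
  obtain a where a: "a \<in> pts X" using ne by auto
  then have "a \<in> carrier_vec (amb X)" using X by (auto simp: is_aff_space_def)
  then have "a + a + a = a" by simp
  then have "affine_map (F2 0) X (\<lambda>_. a)" using a by (simp add: affine_map_iff[OF is_aff_space_F2 X])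
  moreover have "inj_on (\<lambda>_. a) (carrier_vec 0 :: bit vec set)" by (auto simp: inj_on_def)
  ultimately show ?thesis by (rule *)
qed


section \<open>Spans of affine spaces\<close>

record span =
  src :: aff_space
  tgt :: aff_space
  apex :: aff_space
  lleg :: "bit vec \<Rightarrow> bit vec"
  rleg :: "bit vec \<Rightarrow> bit vec"

definition is_span :: "span \<Rightarrow> bool" where
  "is_span s \<longleftrightarrow> is_aff_space (src s) \<and> is_aff_space (tgt s) \<and> is_aff_space (apex s) \<and>
     affine_map (apex s) (src s) (lleg s) \<and> affine_map (apex s) (tgt s) (rleg s)"

text \<open>Legs are total HOL functions; only their values on the apex matter for isomorphism.\<close>

definition span_rel :: "(span \<times> span) set" where
  "span_rel = {(s, t). is_span s \<and> is_span t \<and> src s = src t \<and> tgt s = tgt t \<and>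
     (\<exists>h. affine_iso (apex s) (apex t) h \<and>
        (\<forall>x\<in>pts (apex s). lleg t (h x) = lleg s x \<and> rleg t (h x) = rleg s x))}"

definition span_comp :: "span \<Rightarrow> span \<Rightarrow> span" where
  "span_comp s t = \<lparr>
     src = src s,
     tgt = tgt t,
     apex = pullback (apex s) (apex t) (rleg s) (lleg t),
     lleg = lleg s \<circ> pr1 (apex s) (apex t),
     rleg = rleg t \<circ> pr2 (apex s) (apex t) \<rparr>"

definition span_tens :: "span \<Rightarrow> span \<Rightarrow> span" where
  "span_tens s t = \<lparr>
     src = aff_prod (src s) (src t),
     tgt = aff_prod (tgt s) (tgt t),
     apex = aff_prod (apex s) (apex t),
     lleg = (\<lambda>v. lleg s (pr1 (apex s) (apex t) v) @\<^sub>v lleg t (pr2 (apex s) (apex t) v)),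
     rleg = (\<lambda>v. rleg s (pr1 (apex s) (apex t) v) @\<^sub>v rleg t (pr2 (apex s) (apex t) v)) \<rparr>"

definition graph_span :: "aff_space \<Rightarrow> aff_space \<Rightarrow> (bit vec \<Rightarrow> bit vec) \<Rightarrow> span" where
  "graph_span X Y f = \<lparr>src = X, tgt = Y, apex = X, lleg = (\<lambda>x. x), rleg = f\<rparr>"

definition span_dagger :: "span \<Rightarrow> span" where
  "span_dagger s = \<lparr>src = tgt s, tgt = src s, apex = apex s, lleg = rleg s, rleg = lleg s\<rparr>"

definition span_hom :: "aff_space \<Rightarrow> aff_space \<Rightarrow> span set set" where
  "span_hom X Y = {s. is_span s \<and> src s = X \<and> tgt s = Y} // span_rel"

definition span_id :: "aff_space \<Rightarrow> span set" where
  "span_id X = span_rel `` {graph_span X X (\<lambda>x. x)}"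

definition span_symm :: "aff_space \<Rightarrow> aff_space \<Rightarrow> span set" where
  "span_symm X Y = span_rel ``
     {graph_span (aff_prod X Y) (aff_prod Y X) (\<lambda>v. pr2 X Y v @\<^sub>v pr1 X Y v)}"

text \<open>
  The full subcategory of spans on the nonempty affine spaces, as a prop: the object \<open>n\<close> is
  \<open>F2 n\<close>, and these represent all nonempty affine spaces up to isomorphism
  (\<open>nonempty_aff_space_iso_F2\<close>).  Apexes may be empty.
\<close>

definition SpanAff :: "span set prop_data" where
  "SpanAff = \<lparr>
     Hom = (\<lambda>n m. span_hom (F2 n) (F2 m)),
     Ident = (\<lambda>n. span_id (F2 n)),
     Comp = (\<lambda>S T. \<Union>s\<in>S. \<Union>t\<in>T. span_rel `` {span_comp s t}),
     Tens = (\<lambda>S T. \<Union>s\<in>S. \<Union>t\<in>T. span_rel `` {span_tens s t}),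
     Symm = (\<lambda>n m. span_symm (F2 n) (F2 m)) \<rparr>"

fun gen_span :: "gen \<Rightarrow> span" where
  "gen_span CNOT = graph_span (F2 2) (F2 2) (\<lambda>v. vec_of_list [v $ 0, v $ 0 + v $ 1])"
| "gen_span NOT = graph_span (F2 1) (F2 1) (\<lambda>v. vec_of_list [v $ 0 + 1])"
| "gen_span U = graph_span (F2 0) (F2 1) (\<lambda>v. vec_of_list [0])"
| "gen_span Ud = span_dagger (graph_span (F2 0) (F2 1) (\<lambda>v. vec_of_list [0]))"
| "gen_span Z = \<lparr>src = F2 0, tgt = F2 0, apex = \<lparr>amb = 0, pts = {}\<rparr>, lleg = (\<lambda>v. v), rleg = (\<lambda>v. v)\<rparr>"
| "gen_span E = graph_span (F2 1) (F2 0) (\<lambda>v. vec_of_list [])"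
| "gen_span Ed = span_dagger (graph_span (F2 1) (F2 0) (\<lambda>v. vec_of_list []))"

definition interp :: "gen \<Rightarrow> span set" where
  "interp g = span_rel `` {gen_span g}"

end

theory Submission
  imports Defs
begin

text \<open>
  A span between coordinate spaces is determined up to isomorphism by the function counting the
  points of its apex over each pair of points of its feet, and these functions compose like
  matrices over the natural numbers; this makes soundness a finite computation.  For completeness,
  the Frobenius structure on one wire bends every term into a state \<open>0 \<rightarrow> n\<close>.  Every state is
  a power of the scalar \<open>\<epsilon>\<^sup>\<dagger>; \<epsilon>\<close> times \<open>n\<close> copies of \<open>\<epsilon>\<^sup>\<dagger>\<close> followed by parity checks, each computing
  an affine function of the wires into an ancilla \<open>u\<close> that is then postselected by \<open>u\<^sup>\<dagger>\<close>: this
  class of states is closed under all generators, and discarding a wire by \<open>\<epsilon>\<close> is Gaussian elimination.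
  Parity checks commute and \<open>\<chi>\<close> followed by \<open>\<psi>\<close> equals \<open>\<chi>\<close> followed by \<open>\<chi> + \<psi>\<close>, so the product
  of the checks depends only on their common zero set, which the counting function determines.
\<close>

section \<open>The algebra of string diagrams\<close>

text \<open>The powers of two and the zero scalar shape the normal form. The fibres of a nonempty
  affine apex over pairs of points of the feet are empty or of one common size 2^k, so its counting
  function is 2^k on an affine subspace and 0 elsewhere; k is the number of loops
  \<open>ce >>> de\<close>. An empty apex has no k, and indeed \<open>ez\<close> absorbs every loop,
  so contradictory systems of checks get a form of their own. The relations state directly how
  \<open>cx\<close> meets \<open>iu\<close> and \<open>pu\<close> on its control, but not how it
  meets \<open>ce\<close>. That \<open>ce\<close> absorbs \<open>nx\<close> and \<open>cx\<close>
  has to be derived, from the uniqueness of the unit of the multiplication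
  \<open>cx >>> (idm 1 *** pu)\<close>; the treatment of free wires rests on it. Equal counting
  functions give a bijection of apexes over the feet, but an isomorphism of spans needs an affine
  one; it is built by extending partial isomorphisms one dimension at a time. The prop axioms for
  spans are not verified on pullbacks: they are transported along the interpretation, which is
  surjective on hom-sets.\<close>

lemma peq_typed: "peq arity R n m s t \<Longrightarrow> typed arity s n m \<and> typed arity t n m"
  by (induction rule: peq.induct)
    (auto simp: typed_iff)

text \<open>
  Identifying ill-typed terms with equal source and target makes associativity of both
  compositions unconditional.
\<close>

definition eqv :: "gen pterm \<Rightarrow> gen pterm \<Rightarrow> bool" where
  "eqv s t \<longleftrightarrow> tdom gen_arity s = tdom gen_arity t \<and> tcod gen_arity s = tcod gen_arity t \<and>
     wf_term gen_arity s = wf_term gen_arity t \<and>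
     (wf_term gen_arity s \<longrightarrow>
        peq gen_arity rels_spAffcb2 (tdom gen_arity s) (tcod gen_arity s) s t)"

lemma eqv_if_peq: "peq gen_arity rels_spAffcb2 n m s t \<Longrightarrow> eqv s t"
  using peq_typed[of gen_arity rels_spAffcb2 n m s t] by (auto simp: eqv_def typed_iff)

lemma equivp_eqv: "equivp eqv"
proof (rule equivpI)
  show "reflp eqv" by (auto simp: reflp_def eqv_def typed_iff intro: peq_refl)
  show "symp eqv" by (auto simp: symp_def eqv_def intro: peq_sym)
  show "transp eqv" unfolding transp_def eqv_def by (metis peq_trans)
qed

quotient_type mor = "gen pterm" / eqv
  by (rule equivp_eqv)

lift_definition gn :: "gen \<Rightarrow> mor" is Gen .
lift_definition idm :: "nat \<Rightarrow> mor" is Idn .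
lift_definition sw :: "nat \<Rightarrow> nat \<Rightarrow> mor" is Swap .
lift_definition seq :: "mor \<Rightarrow> mor \<Rightarrow> mor" (infixr \<open>>>>\<close> 60) is Seq
  by (auto simp: eqv_def intro: peq_seq)
lift_definition ten :: "mor \<Rightarrow> mor \<Rightarrow> mor" (infixr \<open>***\<close> 65) is Ten
  by (auto simp: eqv_def intro: peq_ten)
lift_definition dom :: "mor \<Rightarrow> nat" is "tdom gen_arity" by (simp add: eqv_def)
lift_definition cod :: "mor \<Rightarrow> nat" is "tcod gen_arity" by (simp add: eqv_def)
lift_definition wf :: "mor \<Rightarrow> bool" is "wf_term gen_arity" by (simp add: eqv_def)

lemma dom_simps [simp]:
  "dom (gn x) = fst (gen_arity x)" "dom (idm n) = n" "dom (sw n m) = n + m"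
  "dom (f >>> g) = dom f" "dom (f *** g) = dom f + dom g"
  by (transfer, simp)+

lemma cod_simps [simp]:
  "cod (gn x) = snd (gen_arity x)" "cod (idm n) = n" "cod (sw n m) = m + n"
  "cod (f >>> g) = cod g" "cod (f *** g) = cod f + cod g"
  by (transfer, simp)+

lemma wf_simps [simp]:
  "wf (gn x)" "wf (idm n)" "wf (sw n m)"
  "wf (f >>> g) \<longleftrightarrow> wf f \<and> wf g \<and> cod f = dom g" "wf (f *** g) \<longleftrightarrow> wf f \<and> wf g"
  by (transfer, simp)+

lemma seq_asc: "(f >>> g) >>> h = f >>> g >>> h"
  by transfer (auto simp: eqv_def typed_iff intro!: peq.seq_assoc)

lemma ten_asc: "(f *** g) *** h = f *** g *** h"
  by transfer (auto simp: eqv_def typed_iff add.assoc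
      intro: peq.ten_assoc[of _ _ "tdom gen_arity _" _ _ "tdom gen_arity _" _ _ "tdom gen_arity _", simplified add.assoc])

lemma ten_unit [simp]: "idm 0 *** f = f" "f *** idm 0 = f"
  by (transfer, auto simp: eqv_def typed_iff intro!: ten_unit_left ten_unit_right)+

lemma seq_id [simp]: "n = dom f \<Longrightarrow> idm n >>> f = f" "n = cod f \<Longrightarrow> f >>> idm n = f"
  by (transfer, auto simp: eqv_def typed_iff intro!: seq_id_left seq_id_right)+

lemma ten_idm: "idm n *** idm m = idm (n + m)"
  by transfer (auto simp: eqv_def intro: peq.ten_id)

text \<open>The left side is well-typed as soon as the total widths agree, the right side only if
  both pairs match; hence the two hypotheses.\<close>

lemma interchange:
  "cod f = dom g \<Longrightarrow> cod f' = dom g' \<Longrightarrow> (f *** f') >>> (g *** g') = (f >>> g) *** (f' >>> g')"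
  by transfer (auto simp: eqv_def typed_iff intro!: peq_sym[OF peq.ten_seq])

lemma sw_natural: "n = cod f \<Longrightarrow> m = cod g \<Longrightarrow> (f *** g) >>> sw n m = sw (dom f) (dom g) >>> (g *** f)"
  by transfer (auto simp: eqv_def typed_iff intro!: peq.swap_natural)

lemma sw_sw [simp]: "sw n m >>> sw m n = idm (n + m)"
  by transfer (auto simp: eqv_def intro: peq.swap_swap)

lemma sw_hexagon: "sw n (m + k) = (sw n m *** idm k) >>> (idm m *** sw n k)"
  by transfer (rule eqv_if_peq, rule peq.swap_hexagon)

lemma mor_eq_if_rel: "(s, t) \<in> rels_spAffcb2 \<Longrightarrow> abs_mor s = abs_mor t"
  using rels_spAffcb2_typed by (metis eqv_if_peq mor.abs_eq_iff peq_rel)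

lemma abs_mor_simps:
  "abs_mor (Gen g) = gn g" "abs_mor (Idn n) = idm n" "abs_mor (Swap n m) = sw n m"
  "abs_mor (s ;; t) = abs_mor s >>> abs_mor t" "abs_mor (s \<oslash> t) = abs_mor s *** abs_mor t"
  by (simp_all add: gn.abs_eq idm.abs_eq sw.abs_eq seq.abs_eq ten.abs_eq)


declare One_nat_def [simp del]

abbreviation "cx \<equiv> gn CNOT"
abbreviation "nx \<equiv> gn NOT"
abbreviation "iu \<equiv> gn U"
abbreviation "pu \<equiv> gn Ud"
abbreviation "ez \<equiv> gn Z"
abbreviation "de \<equiv> gn E"
abbreviation "ce \<equiv> gn Ed"
abbreviation "sx \<equiv> sw 1 1"

text \<open>Compositions are nested to the right, so a prefix \<open>f >>> g\<close> of a longer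
  composite is not a subterm; an equation about it rewrites the composite only in this form.\<close>

lemma seq_cut: "f >>> g = k \<Longrightarrow> f >>> g >>> h = k >>> h"
  by (simp add: seq_asc[symmetric])

lemma seq_cut2: "f >>> g = k >>> l \<Longrightarrow> f >>> g >>> h = k >>> l >>> h"
  by (simp add: seq_asc[symmetric])

lemma seq_ten_idm: "cod f = dom g \<Longrightarrow> (f >>> g) *** idm n = (f *** idm n) >>> (g *** idm n)"
  by (simp add: interchange)

lemma idm_ten_seq: "cod f = dom g \<Longrightarrow> idm n *** (f >>> g) = (idm n *** f) >>> (idm n *** g)"
  by (simp add: interchange)

lemma slide_left: "n = dom g \<Longrightarrow> m = cod f \<Longrightarrow> (f *** idm n) >>> (idm m *** g) = f *** g"
  by (simp add: interchange)

lemma slide_right: "n = dom f \<Longrightarrow> m = cod g \<Longrightarrow> (idm n *** g) >>> (f *** idm m) = f *** g"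
  by (simp add: interchange)

lemma slide: "n = dom f \<Longrightarrow> m = cod g \<Longrightarrow> n' = dom g \<Longrightarrow> m' = cod f \<Longrightarrow>
    (idm n *** g) >>> (f *** idm m) = (f *** idm n') >>> (idm m' *** g)"
  by (simp add: interchange)

lemmas rels_defs = rels_spAffcb2_def rels_pAffcb2_def rels_piAffcb2_def
  rels_Iso_Affcb2_def rels_Iso_cb2_def

lemma cx_cx: "cx >>> cx = idm 2"
  using mor_eq_if_rel[of "cc ;; cc" "Idn 2"] by (simp add: rels_defs abs_mor_simps)

lemma nx_nx: "nx >>> nx = idm 1"
  using mor_eq_if_rel[of "nn ;; nn" "Idn 1"] by (simp add: rels_defs abs_mor_simps)

lemma nx_control: "(nx *** idm 1) >>> cx = cx >>> (nx *** nx)"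
  using mor_eq_if_rel[of "(nn \<oslash> Idn 1) ;; cc" "cc ;; (nn \<oslash> nn)"]
  by (simp add: rels_defs abs_mor_simps)

lemma nx_target: "(idm 1 *** nx) >>> cx = cx >>> (idm 1 *** nx)"
  using mor_eq_if_rel[of "(Idn 1 \<oslash> nn) ;; cc" "cc ;; (Idn 1 \<oslash> nn)"]
  by (simp add: rels_defs abs_mor_simps)

lemma iu_control: "(iu *** idm 1) >>> cx = iu *** idm 1"
  using mor_eq_if_rel[of "(uu \<oslash> Idn 1) ;; cc" "uu \<oslash> Idn 1"]
  by (simp add: rels_defs abs_mor_simps)

lemma pu_control: "cx >>> (pu *** idm 1) = pu *** idm 1"
  using mor_eq_if_rel[of "cc ;; (ud \<oslash> Idn 1)" "ud \<oslash> Idn 1"]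
  by (simp add: rels_defs abs_mor_simps)

lemma ez_ez: "ez *** ez = ez"
  using mor_eq_if_rel[of "zz \<oslash> zz" "zz"] by (simp add: rels_defs abs_mor_simps)

lemma ez_cx: "ez *** cx = ez *** idm 2"
  using mor_eq_if_rel[of "zz \<oslash> cc" "zz \<oslash> Idn 2"] by (simp add: rels_defs abs_mor_simps)

lemma ez_nx: "ez *** nx = ez *** idm 1"
  using mor_eq_if_rel[of "zz \<oslash> nn" "zz \<oslash> Idn 1"] by (simp add: rels_defs abs_mor_simps)

lemma iu_pu: "iu >>> pu = idm 0"
  using mor_eq_if_rel[of "uu ;; ud" "Idn 0"] by (simp add: rels_defs abs_mor_simps)

lemma iu_nx_pu: "iu >>> nx >>> pu = ez"
  using mor_eq_if_rel[of "uu ;; nn ;; ud" "zz"] by (simp add: rels_defs abs_mor_simps seq_asc)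

lemma de_counit:
  "(idm 1 *** iu) >>> cx >>> (de *** idm 1) = idm 1"
  "(idm 1 *** iu) >>> cx >>> (idm 1 *** de) = idm 1"
  using mor_eq_if_rel[of "delta ;; (eps \<oslash> Idn 1)" "Idn 1"]
    mor_eq_if_rel[of "delta ;; (Idn 1 \<oslash> eps)" "Idn 1"]
  by (simp_all add: rels_defs abs_mor_simps seq_asc delta_def)

lemma ce_unit:
  "(ce *** idm 1) >>> cx >>> (idm 1 *** pu) = idm 1"
  "(idm 1 *** ce) >>> cx >>> (idm 1 *** pu) = idm 1"
  using mor_eq_if_rel[of "(epsd \<oslash> Idn 1) ;; deltad" "Idn 1"]
    mor_eq_if_rel[of "(Idn 1 \<oslash> epsd) ;; deltad" "Idn 1"]
  by (simp_all add: rels_defs abs_mor_simps seq_asc deltad_def)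


subsection \<open>Circuits on three wires\<close>

text \<open>\<open>wp\<close> and \<open>wq\<close> exchange the first two and the last two of three
  wires; \<open>wa\<close>, \<open>wb\<close> and \<open>wd\<close> are the controlled-nots from
  wire 1 to 2, from 2 to 3 and from 1 to 3.\<close>

definition wp where "wp = sx *** idm 1"
definition wq where "wq = idm 1 *** sx"
definition wa where "wa = cx *** idm 1"
definition wb where "wb = idm 1 *** cx"
definition wd where "wd = wq >>> wa >>> wq"

lemmas w_defs = wp_def wq_def wa_def wb_def

lemma w_dom [simp]:
  "dom wp = 3" "dom wq = 3" "dom wa = 3" "dom wb = 3" "dom wd = 3"
  "cod wp = 3" "cod wq = 3" "cod wa = 3" "cod wb = 3" "cod wd = 3"
  by (simp_all add: w_defs wd_def)

lemma w_inv: "wp >>> wp = idm 3" "wq >>> wq = idm 3" "wa >>> wa = idm 3" "wb >>> wb = idm 3"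
  by (simp_all add: w_defs interchange cx_cx ten_idm)

lemma w_cancel [simp]:
  "dom x = 3 \<Longrightarrow> wp >>> wp >>> x = x" "dom x = 3 \<Longrightarrow> wq >>> wq >>> x = x"
  "dom x = 3 \<Longrightarrow> wa >>> wa >>> x = x" "dom x = 3 \<Longrightarrow> wb >>> wb >>> x = x"
  by (simp_all add: w_inv[THEN seq_cut])

lemma sw_1_2: "sw 1 2 = wp >>> wq"
  using sw_hexagon[of 1 1 1] by (simp add: w_defs)

lemma w_braid: "wp >>> wq >>> wp = wq >>> wp >>> wq"
  using sw_natural[of 1 "idm 1" 2 "sx"] by (simp add: w_defs[symmetric] sw_1_2 seq_asc)

lemma w_bpq: "wb >>> wp >>> wq = wp >>> wq >>> wa"
  using sw_natural[of 1 "idm 1" 2 cx] by (simp add: w_defs[symmetric] sw_1_2 seq_asc)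

lemma w_aq: "wa >>> wq = wq >>> wd" by (simp add: wd_def)

lemma w_dq: "wd >>> wq = wq >>> wa" by (simp add: wd_def w_inv seq_asc)

lemma w_pd: "wp >>> wd = wb >>> wp"
proof -
  have "wb >>> wp >>> wq >>> wq = wp >>> wq >>> wa >>> wq"
    using w_bpq by (metis seq_asc)
  then show ?thesis by (simp add: wd_def w_inv)
qed

lemma w_dp: "wd >>> wp = wp >>> wb"
proof -
  have "wp >>> (wp >>> wd) >>> wp = wp >>> (wb >>> wp) >>> wp" by (simp add: w_pd)
  then show ?thesis by (simp add: seq_asc w_inv)
qed

lemma w_bab: "wb >>> wa >>> wb = wa >>> wd"
  using mor_eq_if_rel[of "c3_23 ;; c3_12 ;; c3_23" "c3_12 ;; c3_13"]
  by (simp add: rels_defs abs_mor_simps seq_asc c3_23_def c3_12_def c3_13_def w_defs wd_def)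

text \<open>Controlled-nots with a common target commute. The relation has target 2; conjugation by
  \<open>wq\<close> turns it into target 3.\<close>

lemma w_db: "wd >>> wb = wb >>> wd"
proof -
  have "wa >>> wq >>> wb >>> wq = wq >>> wb >>> wq >>> wa"
    using mor_eq_if_rel[of "c3_12 ;; c3_32" "c3_32 ;; c3_12"]
    by (simp add: rels_defs abs_mor_simps c3_32_def c3_12_def w_defs cc_op_def idm_ten_seq seq_ten_idm seq_asc)
  then have "wq >>> (wa >>> wq >>> wb >>> wq) >>> wq = wq >>> (wq >>> wb >>> wq >>> wa) >>> wq" by simp
  then show ?thesis by (simp add: wd_def w_inv seq_asc)
qed

text \<open>Controlled-nots with a common control commute. The relation has control 2; conjugation
  by \<open>wp\<close> turns it into control 1.\<close>

lemma w_da: "wd >>> wa = wa >>> wd"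
proof -
  have "wp >>> wa >>> wp >>> wb = wb >>> wp >>> wa >>> wp"
    using mor_eq_if_rel[of "c3_21 ;; c3_23" "c3_23 ;; c3_21"]
    by (simp add: rels_defs abs_mor_simps c3_21_def c3_23_def w_defs cc_op_def idm_ten_seq seq_ten_idm seq_asc)
  then have "wp >>> (wp >>> wa >>> wp >>> wb) >>> wp = wp >>> (wb >>> wp >>> wa >>> wp) >>> wp" by simp
  then have "wa >>> wp >>> wb >>> wp = (wp >>> wb) >>> wp >>> wa" by (simp add: w_inv seq_asc)
  then show ?thesis by (simp add: w_dp[symmetric] seq_asc w_pd[symmetric])
qed


subsection \<open>Passing a wire across others\<close>

text \<open>\<open>step r\<close> sends \<open>(y, x)\<close> to \<open>(x, y + r x)\<close>.\<close>

definition step :: "bit \<Rightarrow> mor" where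
  "step r = (if r = 0 then sx else sx >>> cx)"

text \<open>Two ancillas cross the same wire: \<open>(y, y', x)\<close> goes to
  \<open>(x, y + r x, y' + s x)\<close>.\<close>

definition dstep :: "bit \<Rightarrow> bit \<Rightarrow> mor" where
  "dstep r s = (idm 1 *** step s) >>> (step r *** idm 1)"

lemma step_dom [simp]: "dom (step r) = 2" "cod (step r) = 2" "wf (step r)"
  by (simp_all add: step_def)

lemma dstep_dom [simp]: "dom (dstep r s) = 3" "cod (dstep r s) = 3" "wf (dstep r s)"
  by (simp_all add: dstep_def)

lemma step_0 [simp]: "step 0 = sx" by (simp add: step_def)

lemma step_words:
  "step r *** idm 1 = (if r = 0 then wp else wp >>> wa)"
  "idm 1 *** step r = (if r = 0 then wq else wq >>> wb)"
  by (simp_all add: step_def w_defs interchange)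

lemma bit_add_self [simp]: "(r::bit) + r = 0"
  by (cases r) auto

lemma w_ba: "wb >>> wa = wd >>> wa >>> wb"
  using arg_cong[OF w_bab, of "\<lambda>x. x >>> wb"] by (simp add: w_inv seq_asc w_da[THEN seq_cut2])

lemma w_dd: "wd >>> wd = idm 3"
  by (simp add: wd_def seq_asc w_inv)

text \<open>
  Oriented so that swaps move to the left and the controlled-nots, which generate a dihedral
  group of order eight, take the form \<open>wd\<^sup>i wa\<^sup>j wb\<^sup>k\<close>.
\<close>

lemmas w_rules = w_aq w_dq w_pd[symmetric] w_dp w_da[symmetric] w_db[symmetric] w_ba w_braid

lemmas w_norm = w_rules w_rules[THEN seq_cut2, simplified seq_asc] seq_asc w_inv w_dd w_dd[THEN seq_cut]

text \<open>Adding the first ancilla to the second before they cross with coefficients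
  \<open>r\<close> and \<open>s\<close> amounts to crossing with \<open>r\<close> and
  \<open>r + s\<close> and adding afterwards, because the two multiples \<open>r x\<close> cancel.
  Each choice of bits is an equality of words in the gates on three wires.\<close>

lemma cx_dstep: "wa >>> dstep r s = dstep r (r + s) >>> wb"
  by (cases r; cases s) (simp_all add: dstep_def step_words w_norm del: step_0)

lemma sx_dstep: "wp >>> dstep r s = dstep s r >>> wq"
  by (cases r; cases s) (simp_all add: dstep_def step_words w_norm del: step_0)

text \<open>Here one ancilla crosses two wires, and the identity is r x + s (x + y) = (r + s) x + s
  y.\<close>

lemma cx_steps:
  "wb >>> (step r *** idm 1) >>> (idm 1 *** step s) = (step (r + s) *** idm 1) >>> (idm 1 *** step s) >>> wa"
  by (cases r; cases s) (simp_all add: step_words w_norm del: step_0)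

lemma sx_steps:
  "wq >>> (step r *** idm 1) >>> (idm 1 *** step s) = (step s *** idm 1) >>> (idm 1 *** step r) >>> wp"
  by (cases r; cases s) (simp_all add: step_words w_norm del: step_0)


section \<open>Parity checks and their commutation rules\<close>

lemma ten_idm_asc: "idm n *** idm m *** f = idm (n + m) *** f"
  by (simp add: ten_asc[symmetric] ten_idm)

declare add_bit_eq_xor [simp del] mult_bit_eq_and [simp del]

lemma idm_Suc: "idm (Suc n) = idm (1 + n)" by (simp only: Suc_eq_plus1_left)

lemmas lay = seq_asc ten_asc seq_ten_idm idm_ten_seq ten_idm ten_idm_asc add_ac idm_Suc

text \<open>The ancilla enters as the first wire and leaves as the last one, having collected the
  sum of the crossed wires weighted by the coefficients.\<close>

primrec pass :: "bit list \<Rightarrow> mor" where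
  "pass [] = idm 1"
| "pass (r # rs) = (step r *** idm (length rs)) >>> (idm 1 *** pass rs)"

lemma pass_dom [simp]:
  "dom (pass rs) = length rs + 1" "cod (pass rs) = length rs + 1" "wf (pass rs)"
  by (induction rs) auto

definition ub :: "bit \<Rightarrow> mor" where
  "ub b = (if b = 0 then iu else iu >>> nx)"

lemma ub_dom [simp]: "dom (ub b) = 0" "cod (ub b) = 1" "wf (ub b)"
  by (simp_all add: ub_def)

lemma ub_nx: "ub b >>> nx = ub (b + 1)"
  by (cases b) (simp_all add: ub_def seq_asc nx_nx)

text \<open>\<open>chk b as\<close> is the restriction of the identity to the points with \<open>b + \<Sum>i. as\<^sub>i x\<^sub>i = 0\<close>.\<close>

definition chk :: "bit \<Rightarrow> bit list \<Rightarrow> mor" where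
  "chk b as = (ub b *** idm (length as)) >>> pass as >>> (idm (length as) *** pu)"

lemma chk_dom [simp]: "dom (chk b as) = length as" "cod (chk b as) = length as" "wf (chk b as)"
  by (simp_all add: chk_def)

text \<open>Two ancillas travel across all wires. The second one goes first, so they leave in the
  order in which they entered.\<close>

definition dpass :: "bit list \<Rightarrow> bit list \<Rightarrow> mor" where
  "dpass as bs = (idm 1 *** pass bs) >>> (pass as *** idm 1)"

lemma dpass_Nil [simp]: "dpass [] [] = idm 2"
  by (simp add: dpass_def ten_idm)

lemma dpass_dom [simp]:
  "length as = length bs \<Longrightarrow> dom (dpass as bs) = length bs + 2"
  "length as = length bs \<Longrightarrow> cod (dpass as bs) = length bs + 2"
  by (simp_all add: dpass_def)

lemma dpass_Cons:
  assumes "length as = length bs"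
  shows "dpass (r # as) (s # bs) = (dstep r s *** idm (length bs)) >>> (idm 1 *** dpass as bs)"
proof -
  let ?n = "length bs"
  have "(idm 2 *** pass bs) >>> (step r *** idm (?n + 1)) = (step r *** idm (?n + 1)) >>> (idm 2 *** pass bs)"
    by (rule slide) simp_all
  from seq_cut2[OF this] show ?thesis
    using assms by (simp add: dpass_def dstep_def lay)
qed

text \<open>By \<open>dpass_Cons\<close> the joint journey splits into one \<open>dstep\<close> per
  crossed wire, so a gate between the ancillas that can be exchanged with a single
  \<open>dstep\<close> can be exchanged with the whole journey.\<close>

lemma gate_dpass:
  assumes "length as = length bs" and g: "dom g = 2" "cod g = 2"
    and loc: "\<And>r s. (g *** idm 1) >>> dstep r s = dstep (h r s) (k r s) >>> (idm 1 *** g)"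
  shows "(g *** idm (length bs)) >>> dpass as bs
    = dpass (map2 h as bs) (map2 k as bs) >>> (idm (length bs) *** g)"
  using assms(1)
proof (induction as bs rule: list_induct2)
  case Nil
  then show ?case using g by simp
next
  case (Cons r as s bs)
  let ?n = "length bs"
  have "(g *** idm (Suc ?n)) >>> dpass (r # as) (s # bs)
      = (((g *** idm 1) >>> dstep r s) *** idm ?n) >>> (idm 1 *** dpass as bs)"
    using Cons.hyps g by (simp add: dpass_Cons lay)
  also have "\<dots> = (dstep (h r s) (k r s) *** idm ?n) >>> (idm 1 *** ((g *** idm ?n) >>> dpass as bs))"
    unfolding loc using Cons.hyps g by (simp add: lay)
  also have "\<dots> = (dstep (h r s) (k r s) *** idm ?n) >>>
      (idm 1 *** (dpass (map2 h as bs) (map2 k as bs) >>> (idm ?n *** g)))"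
    unfolding Cons.IH ..
  finally show ?case using Cons.hyps g by (simp add: dpass_Cons lay)
qed

text \<open>The ancilla of the second check can be prepared early and that of the first postselected
  late. Consecutive checks thus become a joint journey of two ancillas, on which gates between the
  ancillas can act.\<close>

lemma chk_seq_chk:
  assumes "length as = length bs"
  shows "chk b bs >>> chk a as =
    (ub a *** ub b *** idm (length bs)) >>> dpass as bs >>> (idm (length bs) *** pu *** pu)"
proof -
  let ?n = "length bs"
  let ?X = "(ub b *** idm ?n) >>> pass bs"
  have 1: "?X >>> (idm ?n *** pu) >>> (ub a *** idm ?n) = (ub a *** idm ?n) >>> (idm 1 *** ?X) >>> (idm 1 *** idm ?n *** pu)"
    using slide[of 0 "ub a" ?n "?X >>> (idm ?n *** pu)" ?n 1] by (simp add: lay)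
  have 2: "(idm 1 *** idm ?n *** pu) >>> pass as = (pass as *** idm 1) >>> (idm ?n *** idm 1 *** pu)"
    using slide[of "?n + 1" "pass as" 0 pu 1 "?n + 1"] assms by (simp add: lay)
  have "chk b bs >>> chk a as = (?X >>> (idm ?n *** pu) >>> (ub a *** idm ?n)) >>> pass as >>> (idm ?n *** pu)"
    using assms by (simp add: chk_def seq_asc)
  also have "\<dots> = (ub a *** idm ?n) >>> (idm 1 *** ?X) >>> ((idm 1 *** idm ?n *** pu) >>> pass as) >>> (idm ?n *** pu)"
    unfolding 1 by (simp only: seq_asc)
  also have "\<dots> = (ub a *** idm ?n) >>> (idm 1 *** ub b *** idm ?n) >>> dpass as bs >>> (idm ?n *** idm 1 *** pu) >>> (idm ?n *** pu)"
    unfolding 2 dpass_def by (simp add: idm_ten_seq seq_asc)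
  also have "(idm ?n *** idm 1 *** pu) >>> (idm ?n *** pu) = idm ?n *** pu *** pu"
    using slide_right[of 1 pu 0 pu] by (simp add: interchange)
  also have "(ub a *** idm ?n) >>> (idm 1 *** ub b *** idm ?n) >>> k = (ub a *** ub b *** idm ?n) >>> k" for k
    by (subst slide_left[of ?n "ub b *** idm ?n" 1 "ub a", THEN seq_cut]) simp_all
  finally show ?thesis .
qed

text \<open>A control prepared by \<open>iu\<close> makes the gate idle; a \<open>nx\<close> on the
  control passes through the gate and leaves a copy on the target.\<close>

lemma ub_ub_cx: "(ub a *** ub b) >>> cx = ub a *** ub (b + a)"
proof -
  have nxs: "(nx *** idm 1) >>> cx = cx >>> (nx *** nx)" by (rule nx_control)
  have u: "(iu *** f) >>> cx = iu *** f" if "dom f = 0" "cod f = 1" for f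
  proof -
    have "(iu *** f) >>> cx = (idm 0 *** f) >>> (iu *** idm 1) >>> cx"
      using that by (simp add: slide_right[of 0 iu 1 f, THEN seq_cut, simplified])
    then show ?thesis using that slide_right[of 0 iu 1 f] by (simp add: iu_control)
  qed
  show ?thesis
  proof (cases "a = 0")
    case True
    then show ?thesis by (simp add: ub_def u)
  next
    case False
    have "((iu >>> nx) *** ub b) >>> cx = (iu *** ub b) >>> (nx *** idm 1) >>> cx"
      by (simp add: interchange[THEN seq_cut])
    also have "\<dots> = (iu *** ub b) >>> cx >>> (nx *** nx)" by (simp add: nx_control)
    also have "\<dots> = (iu >>> nx) *** (ub b >>> nx)"
      by (simp add: u[THEN seq_cut] interchange)
    finally have "((iu >>> nx) *** ub b) >>> cx = (iu >>> nx) *** ub (b + 1)" by (simp only: ub_nx)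
    then show ?thesis using False by (simp add: ub_def)
  qed
qed

lemma cx_pu_pu: "cx >>> (pu *** pu) = pu *** pu"
proof -
  have pp: "(pu *** idm 1) >>> pu = pu *** pu"
    using slide_left[of 1 pu 0 pu] by simp
  show ?thesis using pu_control[THEN seq_cut, of pu] by (simp only: pp)
qed

text \<open>The hexagon with zero wires makes \<open>sw n 0\<close> idempotent, and it is
  invertible, so it is the identity.\<close>

lemma sw_0 [simp]: "sw n 0 = idm n" "sw 0 n = idm n"
proof -
  have "sw n 0 = sw n 0 >>> sw n 0" using sw_hexagon[of n 0 0] by simp
  then have "sw n 0 >>> sw 0 n = sw n 0 >>> sw n 0 >>> sw 0 n" by (metis seq_asc)
  then show 1: "sw n 0 = idm n" by simp
  show "sw 0 n = idm n" using sw_sw[of n 0] by (simp add: 1)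
qed

lemma sx_pu_pu: "sx >>> (pu *** pu) = pu *** pu"
  using sw_natural[of 0 pu 0 pu] by simp

lemma ub_ub_sx: "(ub a *** ub b) >>> sx = ub b *** ub a"
  using sw_natural[of 1 "ub a" 1 "ub b"] by simp

lemma map2_proj:
  assumes "length as = length bs"
  shows "map2 (\<lambda>r s. r) as bs = as" "map2 (\<lambda>r s. s) as bs = bs"
  using assms by (induction as bs rule: list_induct2) auto

text \<open>A swap of the two ancillas is absorbed by the postselections \<open>pu *** pu\<close>,
  and slid back it exchanges the preparations and the coefficients.\<close>

lemma chk_commute:
  assumes l: "length as = length bs"
  shows "chk b bs >>> chk a as = chk a as >>> chk b bs"
proof -
  let ?n = "length bs"
  have "chk b bs >>> chk a as = (((ub b *** ub a) >>> sx) *** idm ?n) >>> dpass as bs >>> (idm ?n *** pu *** pu)"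
    using l by (simp only: chk_seq_chk ub_ub_sx ten_asc)
  also have "\<dots> = (ub b *** ub a *** idm ?n) >>> ((sx *** idm ?n) >>> dpass as bs) >>> (idm ?n *** pu *** pu)"
    by (simp add: seq_ten_idm seq_asc ten_asc)
  also have "(sx *** idm ?n) >>> dpass as bs = dpass bs as >>> (idm ?n *** sx)"
    using gate_dpass[OF l, of sx "\<lambda>r s. s" "\<lambda>r s. r"] sx_dstep l by (simp add: w_defs map2_proj)
  also have "(ub b *** ub a *** idm ?n) >>> (dpass bs as >>> (idm ?n *** sx)) >>> (idm ?n *** pu *** pu)
     = (ub b *** ub a *** idm ?n) >>> dpass bs as >>> (idm ?n *** (sx >>> (pu *** pu)))"
    by (simp add: idm_ten_seq seq_asc)
  also have "\<dots> = chk a as >>> chk b bs" using l by (simp add: sx_pu_pu chk_seq_chk)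
  finally show ?thesis .
qed

text \<open>A \<open>cx\<close> from the first ancilla to the second is invisible to the
  postselections \<open>pu *** pu\<close>. Slid back to the preparations it adds the first affine
  function to the second.\<close>

lemma chk_add:
  assumes l: "length as = length bs"
  shows "chk b bs >>> chk a as = chk (a + b) (map2 (+) as bs) >>> chk a as"
proof -
  let ?n = "length bs" and ?cs = "map2 (+) as bs"
  have lc: "length ?cs = ?n" using l by simp
  have "chk b bs >>> chk a as = (ub a *** ub b *** idm ?n) >>> dpass as bs >>> (idm ?n *** (cx >>> (pu *** pu)))"
    using l by (simp only: chk_seq_chk cx_pu_pu)
  \<comment> \<open>\<open>bs\<close> is rewritten as \<open>as + (as + bs)\<close>, the shape that
    the exchange with \<open>cx\<close> produces from the coefficients \<open>?cs\<close>.\<close>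
  also have "\<dots> = (ub a *** ub b *** idm ?n) >>> dpass as (map2 (+) as ?cs) >>> (idm ?n *** (cx >>> (pu *** pu)))"
  proof -
    have "map2 (+) as ?cs = bs"
      using l by (induction as bs rule: list_induct2) (auto simp: add.assoc[symmetric])
    then show ?thesis by simp
  qed
  also have "\<dots> = (ub a *** ub b *** idm ?n) >>> (dpass as (map2 (+) as ?cs) >>> (idm ?n *** cx)) >>> (idm ?n *** (pu *** pu))"
    by (simp add: idm_ten_seq seq_asc)
  also have "dpass as (map2 (+) as ?cs) >>> (idm ?n *** cx) = (cx *** idm ?n) >>> dpass as ?cs"
    using gate_dpass[of as ?cs cx "\<lambda>r s. r" "(+)"] cx_dstep l by (simp add: w_defs map2_proj)
  also have "(ub a *** ub b *** idm ?n) >>> ((cx *** idm ?n) >>> dpass as ?cs) >>> (idm ?n *** (pu *** pu))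
     = (((ub a *** ub b) >>> cx) *** idm ?n) >>> dpass as ?cs >>> (idm ?n *** (pu *** pu))"
    by (simp add: seq_ten_idm seq_asc ten_asc)
  also have "\<dots> = chk (b + a) ?cs >>> chk a as"
    using l by (simp add: ub_ub_cx chk_seq_chk ten_asc)
  finally show ?thesis by (simp add: add.commute)
qed

lemma pass_replicate_0: "pass (replicate n 0) = sw 1 n"
proof (induction n)
  case (Suc n)
  then show ?case using sw_hexagon[of 1 1 n] by simp (simp only: Suc_eq_plus1_left)
qed simp

text \<open>Without coefficients the ancilla merely swaps past the wires, and its preparation meets
  its postselection in a scalar. For \<open>b = 0\<close> this is the empty diagram, for
  \<open>b = 1\<close> it is \<open>ez\<close>.\<close>

lemma chk_replicate_0: "chk b (replicate n 0) = idm n *** (ub b >>> pu)"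
proof -
  have "(ub b *** idm n) >>> sw 1 n = idm n *** ub b" by (subst sw_natural) simp_all
  then have "((ub b *** idm n) >>> sw 1 n) >>> (idm n *** pu) = idm n *** (ub b >>> pu)"
    by (simp add: idm_ten_seq)
  then show ?thesis by (simp add: chk_def pass_replicate_0 seq_asc)
qed

lemma chk_zero: "chk 0 (replicate n 0) = idm n"
  by (simp add: chk_replicate_0 ub_def iu_pu)

lemma ez_commute: "f *** ez = ez *** f"
  using sw_natural[of "cod f" f 0 ez] by simp

lemma chk_one: "chk 1 (replicate n 0) = ez *** idm n"
  by (simp add: chk_replicate_0 ub_def iu_nx_pu seq_asc ez_commute)

lemma pass_append:
  "pass (as @ bs) = (pass as *** idm (length bs)) >>> (idm (length as) *** pass bs)"
  by (induction as) (simp_all add: lay)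

text \<open>A gate on neighbouring wires slides freely past the preparation, the postselection and
  the crossings of all other wires. Only the crossings of its own wires matter, and these are the
  hypothesis \<open>loc\<close>.\<close>

lemma gate_chk:
  assumes "length ks = k" "length ks' = k" and g: "dom g = k" "cod g = k"
    and loc: "(idm 1 *** g) >>> pass ks = pass ks' >>> (g *** idm 1)"
  shows "(idm (length as) *** g *** idm (length bs)) >>> chk b (as @ ks @ bs)
    = chk b (as @ ks' @ bs) >>> (idm (length as) *** g *** idm (length bs))"
proof -
  let ?i = "length as" and ?j = "length bs"
  let ?G = "idm ?i *** g *** idm ?j"
  have 1: "?G >>> (ub b *** idm (?i + k + ?j)) = (ub b *** idm (?i + k + ?j)) >>> (idm 1 *** ?G)"
  proof -
    have "(idm 0 *** ?G) >>> (ub b *** idm (?i + k + ?j)) = (ub b *** idm (?i + k + ?j)) >>> (idm 1 *** ?G)"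
      by (rule slide) (simp_all add: g add.assoc)
    then show ?thesis by (simp only: ten_unit)
  qed
  have 2: "(idm 1 *** ?G) >>> pass (as @ ks @ bs) = pass (as @ ks' @ bs) >>> (?G *** idm 1)"
  proof -
    have a: "(idm (1 + ?i) *** g *** idm ?j) >>> (pass as *** idm (k + ?j)) = (pass as *** idm (k + ?j)) >>> (idm (1 + ?i) *** g *** idm ?j)"
      by (rule slide) (simp_all add: g)
    have c: "(g *** idm (?j + 1)) >>> (idm k *** pass bs) = (idm k *** pass bs) >>> (g *** idm (?j + 1))"
      by (rule slide[symmetric]) (simp_all add: g)
    have "(idm 1 *** ?G) >>> pass (as @ ks @ bs)
      = ((idm (1 + ?i) *** g *** idm ?j) >>> (pass as *** idm (k + ?j))) >>> (idm ?i *** ((pass ks *** idm ?j) >>> (idm k *** pass bs)))"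
      using assms(1) by (simp add: pass_append lay)
    also have "\<dots> = (pass as *** idm (k + ?j)) >>> (idm ?i *** (((idm 1 *** g) >>> pass ks) *** idm ?j)) >>> (idm (?i + k) *** pass bs)"
      unfolding a using assms(1) g by (simp add: lay)
    also have "\<dots> = (pass as *** idm (k + ?j)) >>> (idm ?i *** pass ks' *** idm ?j) >>> (idm ?i *** ((g *** idm (?j + 1)) >>> (idm k *** pass bs)))"
      unfolding loc using assms(2) g by (simp add: lay)
    also have "\<dots> = pass (as @ ks' @ bs) >>> (?G *** idm 1)"
      unfolding c using assms(2) g by (simp add: pass_append lay)
    finally show ?thesis .
  qed
  have 3: "(?G *** idm 1) >>> (idm (?i + k + ?j) *** pu) = (idm (?i + k + ?j) *** pu) >>> ?G"
  proof -
    have "(?G *** idm 1) >>> (idm (?i + k + ?j) *** pu) = (idm (?i + k + ?j) *** pu) >>> (?G *** idm 0)"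
      by (rule slide[symmetric]) (simp_all add: g add.assoc)
    then show ?thesis by (simp only: ten_unit)
  qed
  have "?G >>> chk b (as @ ks @ bs)
    = (?G >>> (ub b *** idm (?i + k + ?j))) >>> pass (as @ ks @ bs) >>> (idm (?i + k + ?j) *** pu)"
    using assms(1) by (simp add: chk_def seq_asc add.assoc)
  also have "\<dots> = (ub b *** idm (?i + k + ?j)) >>> ((idm 1 *** ?G) >>> pass (as @ ks @ bs)) >>> (idm (?i + k + ?j) *** pu)"
    unfolding 1 by (simp only: seq_asc)
  also have "\<dots> = (ub b *** idm (?i + k + ?j)) >>> pass (as @ ks' @ bs) >>> (?G *** idm 1) >>> (idm (?i + k + ?j) *** pu)"
    unfolding 2 by (simp only: seq_asc)
  also have "\<dots> = chk b (as @ ks' @ bs) >>> ?G"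
    unfolding 3 using assms(2) by (simp add: chk_def seq_asc add.assoc)
  finally show ?thesis .
qed

text \<open>The form r x + s y, pulled back along (x, y) to (x, x + y), has the coefficients r + s
  and s.\<close>

lemma cx_chk:
  "(cx *** idm (length as)) >>> chk b (r # s # as) = chk b ((r + s) # s # as) >>> (cx *** idm (length as))"
proof -
  have "pass [r, s] = (step r *** idm 1) >>> (idm 1 *** step s)" for r s
    by (simp add: lay)
  then have "(idm 1 *** cx) >>> pass [r, s] = pass [r + s, s] >>> (cx *** idm 1)"
    using cx_steps[of r s] by (simp add: w_defs seq_asc del: pass.simps)
  then show ?thesis using gate_chk[of "[r, s]" 2 "[r + s, s]" cx "[]" as b] by simp
qed

lemma sx_chk:
  "(idm (length as) *** sx *** idm (length bs)) >>> chk b (as @ r # s # bs)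
    = chk b (as @ s # r # bs) >>> (idm (length as) *** sx *** idm (length bs))"
proof -
  have "pass [r, s] = (step r *** idm 1) >>> (idm 1 *** step s)" for r s
    by (simp add: lay)
  then have "(idm 1 *** sx) >>> pass [r, s] = pass [s, r] >>> (sx *** idm 1)"
    using sx_steps[of r s] by (simp add: w_defs seq_asc del: pass.simps)
  then show ?thesis using gate_chk[of "[r, s]" 2 "[s, r]" sx as bs b] by simp
qed


section \<open>Free wires and the elimination of a wire\<close>

definition par :: "bit list \<Rightarrow> mor" where
  "par as = pass as >>> (idm (length as) *** pu)"

lemma par_dom [simp]: "dom (par as) = length as + 1" "cod (par as) = length as" "wf (par as)"
  by (simp_all add: par_def)

lemma par_Nil [simp]: "par [] = pu"
  by (simp add: par_def)

lemma par_Cons: "par (r # as) = (step r *** idm (length as)) >>> (idm 1 *** par as)"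
  by (simp add: par_def lay)

text \<open>Separating the preparation from the rest of the check makes it possible to feed other
  states, in particular \<open>ce\<close>, into the ancilla.\<close>

lemma chk_par: "chk b as = (ub b *** idm (length as)) >>> par as"
  by (simp add: chk_def par_def)

lemma chk_Cons: "chk b (r # as) = (((ub b *** idm 1) >>> step r) *** idm (length as)) >>> (idm 1 *** par as)"
  by (simp add: chk_par par_Cons lay)

lemma ub_sx: "(ub b *** idm 1) >>> sx = idm 1 *** ub b"
  using sw_natural[of 1 "ub b" 1 "idm 1"] by simp

lemma chk_Cons_0: "chk b (0 # as) = idm 1 *** chk b as"
  by (simp add: chk_Cons ub_sx) (simp add: chk_par lay)

lemma nx_chk:
  "(nx *** idm (length as)) >>> chk b (r # as) = chk (b + r) (r # as) >>> (nx *** idm (length as))"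
proof -
  let ?n = "length as"
  \<comment> \<open>A not on the crossed wire leaves its \<open>r\<close>-th power on the ancilla.
    This power then slides back to the preparation and changes \<open>b\<close> into
    \<open>b + r\<close>.\<close>
  define N where "N = (if r = 0 then idm 1 else nx)"
  have N [simp]: "dom N = 1" "cod N = 1" by (simp_all add: N_def)
  have ubN: "ub (b + r) = ub b >>> N"
    by (cases "r = 0") (simp_all add: N_def ub_nx)
  have sx1: "(nx *** idm 1) >>> sx = sx >>> (idm 1 *** nx)" "(idm 1 *** nx) >>> sx = sx >>> (nx *** idm 1)"
    using sw_natural[of 1 nx 1 "idm 1"] sw_natural[of 1 "idm 1" 1 nx] by simp_all
  have 1: "(idm 1 *** nx) >>> step r = step r >>> (nx *** N)"
    by (cases "r = 0")
      (simp_all add: step_def N_def sx1 sx1[THEN seq_cut2] seq_asc nx_control)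
  have 2: "(N *** idm 1) >>> step r = step r >>> (idm 1 *** N)"
    by (cases "r = 0")
      (simp_all add: step_def N_def sx1 sx1[THEN seq_cut2] seq_asc nx_target ten_idm)
  have 3: "(idm 0 *** nx) >>> (ub b *** idm 1) = (ub b *** idm 1) >>> (idm 1 *** nx)"
    by (rule slide) simp_all
  have 4: "(idm 1 *** par as) >>> (nx *** idm ?n) = (nx *** idm (?n + 1)) >>> (idm 1 *** par as)"
    by (rule slide) simp_all
  have "(nx *** idm ?n) >>> chk b (r # as)
    = ((((idm 0 *** nx) >>> (ub b *** idm 1)) >>> step r) *** idm ?n) >>> (idm 1 *** par as)"
    by (simp add: chk_Cons seq_ten_idm seq_asc)
  also have "\<dots> = (((ub b *** idm 1) >>> step r >>> (nx *** N)) *** idm ?n) >>> (idm 1 *** par as)"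
    unfolding 3 seq_asc 1 ..
  also have "nx *** N = (idm 1 *** N) >>> (nx *** idm 1)"
    by (simp add: interchange)
  also have "step r >>> (idm 1 *** N) >>> (nx *** idm 1) = (N *** idm 1) >>> step r >>> (nx *** idm 1)"
    using 2 by (metis seq_asc)
  also have "(((ub b *** idm 1) >>> (N *** idm 1) >>> step r >>> (nx *** idm 1)) *** idm ?n) >>> (idm 1 *** par as)
    = ((((ub b >>> N) *** idm 1) >>> step r) *** idm ?n) >>> (nx *** idm (?n + 1)) >>> (idm 1 *** par as)"
    by (simp add: lay)
  also have "\<dots> = chk (b + r) (r # as) >>> (nx *** idm ?n)"
    unfolding 4[symmetric] by (simp add: chk_Cons ubN seq_asc)
  finally show ?thesis .
qed

text \<open>The diagram \<open>(ce *** idm 1) >>> cx >>> (pu *** pu)\<close> is \<open>pu\<close> by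
  the unit law, and \<open>(ce >>> pu) *** pu\<close> because the postselections absorb
  \<open>cx\<close>. Precomposing with \<open>iu\<close> cancels the common
  \<open>pu\<close>.\<close>

lemma ce_pu: "ce >>> pu = idm 0"
proof -
  have "(ce *** idm 1) >>> cx >>> (pu *** pu) = ((ce *** idm 1) >>> cx >>> (idm 1 *** pu)) >>> pu"
    using slide_right[of 1 pu 0 pu] by (simp add: seq_asc)
  then have "(ce >>> pu) *** pu = pu"
    by (simp only: ce_unit cx_pu_pu) (simp add: interchange)
  then have "iu >>> ((ce >>> pu) *** pu) = iu >>> pu" by simp
  moreover have "iu >>> ((ce >>> pu) *** pu) = (ce >>> pu) *** (iu >>> pu)"
    using interchange[of "idm 0" "ce >>> pu" iu pu] by simp
  ultimately show ?thesis by (simp add: iu_pu)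
qed

text \<open>The unit of a Frobenius structure is determined by its unit law.\<close>

lemma ce_nx: "ce >>> nx = ce"
proof -
  have nn: "cx >>> (nx *** idm 1) = (nx *** nx) >>> cx"
  proof -
    have "(nx *** nx) >>> cx = (nx *** idm 1) >>> (idm 1 *** nx) >>> cx"
      by (simp add: seq_asc[symmetric] interchange)
    also have "\<dots> = cx >>> (nx *** nx) >>> (idm 1 *** nx)"
      by (simp add: nx_target nx_control[THEN seq_cut2] seq_asc)
    finally show ?thesis by (simp add: interchange nx_nx)
  qed
  \<comment> \<open>Conjugating the right unit law of \<open>ce\<close> by \<open>nx\<close> shows
    that \<open>ce >>> nx\<close> is a right unit as well.\<close>
  have 1: "(idm 1 *** (ce >>> nx)) >>> cx >>> (idm 1 *** pu) = idm 1"
  proof -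
    have "idm 1 *** (ce >>> nx) = nx >>> (idm 1 *** ce) >>> (nx *** nx)"
      using interchange[of nx nx "idm 0" "ce >>> nx"] by (simp add: interchange nx_nx)
    then have "(idm 1 *** (ce >>> nx)) >>> cx >>> (idm 1 *** pu)
        = nx >>> (idm 1 *** ce) >>> (cx >>> (nx *** idm 1)) >>> (idm 1 *** pu)"
      unfolding nn by (simp add: seq_asc)
    also have "\<dots> = nx >>> ((idm 1 *** ce) >>> cx >>> (idm 1 *** pu)) >>> nx"
      using slide_left[of 1 pu 1 nx] slide_right[of 1 nx 0 pu] by (simp add: seq_asc)
    finally show ?thesis by (simp add: ce_unit nx_nx)
  qed
  \<comment> \<open>The product of the left unit \<open>ce\<close> and the right unit
    \<open>ce >>> nx\<close> equals both of them.\<close>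
  have "(ce >>> nx) = (ce >>> nx) >>> (ce *** idm 1) >>> cx >>> (idm 1 *** pu)"
    by (simp add: ce_unit)
  also have "\<dots> = ce >>> (idm 1 *** (ce >>> nx)) >>> cx >>> (idm 1 *** pu)"
    using slide_left[of 0 "ce >>> nx" 1 ce] slide_right[of 0 ce 1 "ce >>> nx"] by (simp add: seq_asc[symmetric])
  also have "\<dots> = ce" by (simp add: 1)
  finally show ?thesis .
qed

lemma ce_sx: "(ce *** idm 1) >>> sx = idm 1 *** ce" "(idm 1 *** ce) >>> sx = ce *** idm 1"
  using sw_natural[of 1 ce 1 "idm 1"] sw_natural[of 1 "idm 1" 1 ce] by simp_all

lemma state_wd:
  assumes [simp]: "dom f = 0" "cod f = 1"
  shows "(idm 1 *** f *** idm 1) >>> wd = cx >>> (idm 1 *** f *** idm 1)"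
proof -
  have sx: "(f *** idm 1) >>> sx = idm 1 *** f" "(idm 1 *** f) >>> sx = f *** idm 1"
    using sw_natural[of 1 f 1 "idm 1"] sw_natural[of 1 "idm 1" 1 f] by simp_all
  have 1: "(idm 1 *** f *** idm 1) >>> wq = idm 2 *** f"
    unfolding wq_def by (subst interchange) (simp_all add: sx ten_idm_asc)
  have 2: "(idm 2 *** f) >>> wa = cx >>> (idm 2 *** f)"
  proof -
    have "(idm 2 *** f) >>> (cx *** idm 1) = (cx *** idm 0) >>> (idm 2 *** f)"
      by (rule slide) simp_all
    then show ?thesis by (simp only: wa_def ten_unit)
  qed
  have 3: "(idm 2 *** f) >>> wq = idm 1 *** f *** idm 1"
    using ten_idm_asc[of 1 1 f] interchange[of "idm 1" "idm 1" "idm 1 *** f" sx]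
    by (simp add: wq_def sx)
  show ?thesis unfolding wd_def using 1 2 3 by (metis seq_asc)
qed

lemma wa_effect:
  assumes [simp]: "dom f = 1" "cod f = 0"
  shows "wa >>> (idm 2 *** f) = (idm 2 *** f) >>> cx"
proof -
  have "(cx *** idm 1) >>> (idm 2 *** f) = (idm 2 *** f) >>> (cx *** idm 0)"
    by (rule slide[symmetric]) simp_all
  then show ?thesis by (simp only: wa_def ten_unit)
qed

text \<open>Uniqueness of the unit again, with the control wire as a parameter: \<open>?e\<close>
  obeys the left unit law next to that wire, and multiplying it with the right unit
  \<open>ce\<close> evaluates to \<open>?e\<close> and to \<open>idm 1 *** ce\<close>.\<close>

lemma ce_cx: "(idm 1 *** ce) >>> cx = idm 1 *** ce"
proof -
  let ?e = "(idm 1 *** ce) >>> cx"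
  have ab: "wa >>> wb = wd >>> wb >>> wa"
    by (simp add: w_norm)
  have "(?e *** idm 1) >>> (idm 1 *** (cx >>> (idm 1 *** pu)))
      = (idm 1 *** ce *** idm 1) >>> (wa >>> wb) >>> (idm 2 *** pu)"
    by (simp add: w_defs lay)
  also have "\<dots> = ((idm 1 *** ce *** idm 1) >>> wd) >>> wb >>> wa >>> (idm 2 *** pu)"
    by (simp add: ab seq_asc)
  \<comment> \<open>\<open>wd\<close> slips in front of the state on the middle wire,
    \<open>wa\<close> behind the effect on the last one. Both turn into \<open>cx\<close> on the two
    remaining wires, and these cancel once the unit law has been applied between them.\<close>
  also have "\<dots> = cx >>> ((idm 1 *** ce *** idm 1) >>> wb >>> (idm 2 *** pu)) >>> cx"
    by (simp add: state_wd wa_effect seq_asc)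
  also have "(idm 1 *** ce *** idm 1) >>> wb >>> (idm 2 *** pu)
      = idm 1 *** ((ce *** idm 1) >>> cx >>> (idm 1 *** pu))"
    by (simp add: w_defs lay)
  also have "cx >>> (idm 1 *** ((ce *** idm 1) >>> cx >>> (idm 1 *** pu))) >>> cx = idm 2"
    by (simp add: ce_unit ten_idm cx_cx)
  finally have 1: "(?e *** idm 1) >>> (idm 1 *** (cx >>> (idm 1 *** pu))) = idm 2" .
  have "?e = ?e >>> (idm 1 *** ((idm 1 *** ce) >>> cx >>> (idm 1 *** pu)))"
    by (simp add: ce_unit ten_idm)
  also have "\<dots> = (?e >>> (idm 2 *** ce)) >>> (idm 1 *** (cx >>> (idm 1 *** pu)))"
    by (simp add: lay)
  also have "?e >>> (idm 2 *** ce) = (idm 1 *** ce) >>> (?e *** idm 1)"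
  proof -
    have "(idm 1 *** ce) >>> (?e *** idm 1) = (?e *** idm 0) >>> (idm 2 *** ce)"
      by (rule slide) simp_all
    then show ?thesis by (simp only: ten_unit)
  qed
  also have "((idm 1 *** ce) >>> (?e *** idm 1)) >>> (idm 1 *** (cx >>> (idm 1 *** pu))) = (idm 1 *** ce) >>> idm 2"
    unfolding seq_asc[of "idm 1 *** ce"] 1 ..
  finally show ?thesis by simp
qed

lemma ce_step: "(ce *** idm 1) >>> step r = idm 1 *** ce"
  by (simp add: step_def ce_sx ce_sx[THEN seq_cut] ce_cx)

text \<open>An ancilla in the state \<open>ce\<close> is a free bit: it absorbs every controlled-not
  on its way, and its final postselection is the trivial scalar \<open>ce >>> pu\<close>.\<close>

lemma ce_par: "(ce *** idm (length as)) >>> par as = idm (length as)"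
proof (induction as)
  case Nil
  then show ?case by (simp add: ce_pu)
next
  case (Cons r as)
  have "(ce *** idm (Suc (length as))) >>> par (r # as)
      = (((ce *** idm 1) >>> step r) *** idm (length as)) >>> (idm 1 *** par as)"
    by (simp add: par_Cons lay)
  also have "\<dots> = idm 1 *** ((ce *** idm (length as)) >>> par as)"
    unfolding ce_step by (simp add: idm_ten_seq ten_asc)
  finally show ?case by (simp add: Cons.IH ten_idm idm_Suc)
qed

text \<open>An equation with coefficient 1 at the first wire has exactly one solution in that wire,
  so if the wire is free before and discarded after, the equation imposes nothing on the
  others.\<close>

lemma chk_elim: "(ce *** idm (length as)) >>> chk b (1 # as) >>> (de *** idm (length as)) = idm (length as)"
proof -
  let ?n = "length as"
  \<comment> \<open>Copying the first wire to the ancilla and discarding the original passes the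
    wire on, negated if \<open>b\<close> is 1. Since the wire is \<open>ce\<close>, which absorbs
    \<open>nx\<close>, what travels on is a free ancilla.\<close>
  have ud: "(idm 1 *** ub b) >>> cx >>> (de *** idm 1) = (if b = 0 then idm 1 else nx)"
  proof (cases "b = 0")
    case True
    then show ?thesis by (simp add: ub_def de_counit)
  next
    case False
    have "(idm 1 *** (iu >>> nx)) >>> cx >>> (de *** idm 1) = (idm 1 *** iu) >>> cx >>> (idm 1 *** nx) >>> (de *** idm 1)"
      by (simp add: idm_ten_seq seq_asc nx_target[THEN seq_cut2])
    also have "\<dots> = ((idm 1 *** iu) >>> cx >>> (de *** idm 1)) >>> nx"
      using slide_left[of 1 nx 0 de] slide_right[of 1 de 1 nx] by (simp add: seq_asc)
    finally show ?thesis using False by (simp add: ub_def de_counit)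
  qed
  have uce: "(idm 0 *** ce) >>> (ub b *** idm 1) = ce >>> (ub b *** idm 1)" by simp
  have 1: "(idm 1 *** par as) >>> (de *** idm ?n) = (de *** idm (?n + 1)) >>> (idm 0 *** par as)"
    by (rule slide) simp_all
  have "(ce *** idm ?n) >>> chk b (1 # as) >>> (de *** idm ?n)
    = ((ce >>> (ub b *** idm 1) >>> step 1 >>> (de *** idm 1)) *** idm ?n) >>> par as"
    unfolding chk_Cons seq_asc 1 by (simp add: lay)
  also have "ce >>> (ub b *** idm 1) >>> step 1 >>> (de *** idm 1)
      = ce >>> (idm 1 *** ub b) >>> cx >>> (de *** idm 1)"
    by (simp add: step_def ub_sx[THEN seq_cut] seq_asc)
  also have "\<dots> = ce" unfolding ud by (simp add: ce_nx)
  finally show ?thesis by (simp add: ce_par)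
qed

lemma par_replicate_0: "par (replicate n 0) = pu *** idm n"
  using sw_natural[of 0 pu n "idm n"] by (simp add: par_def pass_replicate_0)

lemma chk_first: "chk 0 (1 # replicate n 0) = ((idm 1 *** iu) >>> cx >>> (idm 1 *** pu)) *** idm n"
proof -
  have "(iu *** idm 1) >>> sx = idm 1 *** iu" using ub_sx[of 0] by (simp add: ub_def)
  then have "(iu *** idm 1) >>> sx >>> cx = (idm 1 *** iu) >>> cx" by (rule seq_cut)
  then have "chk 0 (1 # replicate n 0) = (((idm 1 *** iu) >>> cx) *** idm n) >>> (idm 1 *** pu *** idm n)"
    by (simp add: chk_Cons par_replicate_0 step_def ub_def)
  then show ?thesis by (simp add: lay)
qed

text \<open>Reduces the generator \<open>iu\<close> to a free wire on which x = 0 is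
  checked.\<close>

lemma iu_chk: "(ce *** idm n) >>> chk 0 (1 # replicate n 0) = iu *** idm n"
proof -
  have "ce >>> (idm 1 *** iu) = iu >>> (ce *** idm 1)"
    using slide_left[of 0 iu 1 ce] slide_right[of 0 ce 1 iu] by simp
  then have "ce >>> (idm 1 *** iu) >>> cx >>> (idm 1 *** pu) = iu >>> (ce *** idm 1) >>> cx >>> (idm 1 *** pu)"
    by (rule seq_cut2)
  then show ?thesis by (simp add: chk_first interchange ce_unit)
qed

text \<open>Reduces \<open>pu\<close> to the check x = 0 followed by discarding the wire, so that
  closure of normal forms under \<open>de\<close> settles it.\<close>

lemma pu_chk: "chk 0 (1 # replicate n 0) >>> (de *** idm n) = pu *** idm n"
proof -
  have "(idm 1 *** iu) >>> cx >>> (idm 1 *** pu) >>> de = ((idm 1 *** iu) >>> cx >>> (de *** idm 1)) >>> pu"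
    using slide_right[of 1 de 0 pu] slide_left[of 1 pu 0 de] by (simp add: seq_asc)
  then show ?thesis by (simp add: chk_first interchange de_counit seq_asc)
qed


subsection \<open>The Frobenius structure and bending of wires\<close>

lemma wa_state:
  assumes [simp]: "dom f = 0" "cod f = 1"
  shows "(idm 2 *** f) >>> wa = cx >>> (idm 2 *** f)"
proof -
  have "(idm 2 *** f) >>> (cx *** idm 1) = (cx *** idm 0) >>> (idm 2 *** f)"
    by (rule slide) simp_all
  then show ?thesis by (simp only: wa_def ten_unit)
qed

lemma wd_effect:
  assumes [simp]: "dom f = 1" "cod f = 0"
  shows "wd >>> (idm 1 *** f *** idm 1) = (idm 1 *** f *** idm 1) >>> cx"
proof -
  have sx: "sx >>> (f *** idm 1) = idm 1 *** f" "sx >>> (idm 1 *** f) = f *** idm 1"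
    using sw_natural[of 0 f 1 "idm 1"] sw_natural[of 1 "idm 1" 0 f] by simp_all
  have 1: "wq >>> (idm 1 *** f *** idm 1) = idm 2 *** f"
    unfolding wq_def by (subst interchange) (simp_all add: sx ten_idm_asc)
  have 3: "wq >>> (idm 2 *** f) = idm 1 *** f *** idm 1"
    using ten_idm_asc[of 1 1 f] interchange[of "idm 1" "idm 1" sx "idm 1 *** f"]
    by (simp add: wq_def sx)
  show ?thesis unfolding wd_def using 1 wa_effect[of f] 3 by (simp add: seq_asc) (metis seq_asc)
qed

text \<open>Copying, \<open>(idm 1 *** iu) >>> cx\<close>, and its dagger form a Frobenius pair. In
  wires, the two sides differ by a controlled-not whose control is postselected.\<close>

lemma frobenius:
  "(idm 1 *** ((idm 1 *** iu) >>> cx)) >>> ((cx >>> (idm 1 *** pu)) *** idm 1)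
    = (cx >>> (idm 1 *** pu)) >>> ((idm 1 *** iu) >>> cx)"
proof -
  have wb: "wb >>> (idm 1 *** pu *** idm 1) = idm 1 *** pu *** idm 1"
    by (simp add: wb_def interchange pu_control)
  \<comment> \<open>Moving \<open>wb\<close> past \<open>wa\<close> costs a \<open>wd\<close>; at
    the end \<open>wb\<close> is absorbed by the \<open>pu\<close> on its control.\<close>
  have ba: "wb >>> wa >>> x = wa >>> wd >>> wb >>> x" for x
    by (simp only: w_ba[THEN seq_cut2] seq_asc w_da[THEN seq_cut2])
  have ip: "(idm 2 *** iu) >>> (idm 1 *** pu *** idm 1) = (idm 1 *** pu) >>> (idm 1 *** iu)"
  proof -
    have "idm 2 *** iu = idm 1 *** idm 1 *** iu" by (simp add: ten_idm_asc)
    then show ?thesis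
      using slide_right[of 1 pu 1 iu] slide_left[of 0 iu 0 pu] by (simp add: interchange)
  qed
  have "(idm 1 *** ((idm 1 *** iu) >>> cx)) >>> ((cx >>> (idm 1 *** pu)) *** idm 1)
      = (idm 2 *** iu) >>> wb >>> wa >>> (idm 1 *** pu *** idm 1)"
    by (simp add: wa_def wb_def lay)
  also have "\<dots> = (idm 2 *** iu) >>> wa >>> wd >>> (idm 1 *** pu *** idm 1)"
    by (simp only: ba wb)
  also have "\<dots> = cx >>> ((idm 2 *** iu) >>> (idm 1 *** pu *** idm 1)) >>> cx"
    using wa_state[of iu, THEN seq_cut2] wd_effect[of pu] by (simp add: seq_asc)
  finally show ?thesis by (simp add: ip seq_asc)
qed

text \<open>The nested pairing of wire i with the i-th wire from the end; the basic pair is a copied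
  \<open>ce\<close>. \<open>cup\<close> adds its new pair outside and \<open>cap\<close> contracts
  the innermost pair, so in the snake equation the two new pairs meet directly.\<close>

primrec cup :: "nat \<Rightarrow> mor" where
  "cup 0 = idm 0"
| "cup (Suc n) = (ce >>> (idm 1 *** iu) >>> cx) >>> (idm 1 *** cup n *** idm 1)"

primrec cap :: "nat \<Rightarrow> mor" where
  "cap 0 = idm 0"
| "cap (Suc n) = (idm n *** (cx >>> (idm 1 *** pu) >>> de) *** idm n) >>> cap n"

lemma cup_dom [simp]: "dom (cup n) = 0" "cod (cup n) = n + n" "wf (cup n)"
  by (induction n) auto

lemma cap_dom [simp]: "dom (cap n) = n + n" "cod (cap n) = 0" "wf (cap n)"
  by (induction n) auto

lemma snake_1:
  "(idm 1 *** (ce >>> (idm 1 *** iu) >>> cx)) >>> ((cx >>> (idm 1 *** pu) >>> de) *** idm 1) = idm 1"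
proof -
  have "(idm 1 *** (ce >>> (idm 1 *** iu) >>> cx)) >>> ((cx >>> (idm 1 *** pu) >>> de) *** idm 1)
    = (idm 1 *** ce) >>> ((idm 1 *** ((idm 1 *** iu) >>> cx)) >>> ((cx >>> (idm 1 *** pu)) *** idm 1)) >>> (de *** idm 1)"
    by (simp add: lay)
  also have "\<dots> = ((idm 1 *** ce) >>> cx >>> (idm 1 *** pu)) >>> ((idm 1 *** iu) >>> cx >>> (de *** idm 1))"
    unfolding frobenius by (simp only: seq_asc)
  finally show ?thesis by (simp add: ce_unit de_counit)
qed

lemma snake: "(idm n *** cup n) >>> (cap n *** idm n) = idm n"
proof (induction n)
  case (Suc n)
  let ?u = "ce >>> (idm 1 *** iu) >>> cx" and ?p = "cx >>> (idm 1 *** pu) >>> de"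
  have 1: "(idm 2 *** (cup n *** idm 1)) >>> (?p *** idm (n + n + 1)) = (?p *** idm 1) >>> (idm 0 *** (cup n *** idm 1))"
    by (rule slide) simp_all
  have "(idm (Suc n) *** cup (Suc n)) >>> (cap (Suc n) *** idm (Suc n))
    = (idm n *** idm 1 *** ?u) >>> (idm n *** ((idm 2 *** (cup n *** idm 1)) >>> (?p *** idm (n + n + 1)))) >>> (cap n *** idm n *** idm 1)"
    by (simp add: lay)
  also have "\<dots> = (idm n *** ((idm 1 *** ?u) >>> (?p *** idm 1))) >>> (((idm n *** cup n) >>> (cap n *** idm n)) *** idm 1)"
    unfolding 1 by (simp add: lay)
  also have "\<dots> = idm (Suc n)"
    unfolding snake_1 Suc.IH by (simp add: ten_idm idm_Suc add.commute)
  finally show ?case .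
qed simp

definition bend :: "mor \<Rightarrow> mor" where
  "bend f = cup (dom f) >>> (idm (dom f) *** f)"

text \<open>By the snake equation, capping off the bent wires recovers the morphism.\<close>

lemma bend_inj:
  assumes "dom f = dom g" "cod f = cod g" "bend f = bend g"
  shows "f = g"
proof -
  have "(idm n *** bend f) >>> (cap n *** idm m) = f" if "dom f = n" "cod f = m" for f n m
  proof -
    have 1: "(idm (n + n) *** f) >>> (cap n *** idm m) = (cap n *** idm n) >>> (idm 0 *** f)"
      by (rule slide) (simp_all add: that)
    have "(idm n *** bend f) >>> (cap n *** idm m)
      = (idm n *** cup n) >>> ((idm (n + n) *** f) >>> (cap n *** idm m))"
      by (simp add: bend_def that lay)
    also have "\<dots> = ((idm n *** cup n) >>> (cap n *** idm n)) >>> f"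
      unfolding 1 by (simp add: seq_asc)
    finally show ?thesis by (simp add: snake that)
  qed
  then show ?thesis using assms by metis
qed


subsection \<open>The zero scalar\<close>

lemma ez_seq_ez: "ez >>> ez = ez"
  using slide_left[of 0 ez 0 ez] by (simp add: ez_ez)

lemma ez_seq: "cod f = dom g \<Longrightarrow> ez *** (f >>> g) = (ez *** f) >>> (ez *** g)"
  by (simp add: interchange ez_seq_ez)

text \<open>Being equal next to \<open>ez\<close> is a congruence: \<open>ez\<close> is idempotent,
  so each factor can be given its own copy.\<close>

lemma ez_seq_cong:
  assumes "ez *** f = ez *** f'" "ez *** g = ez *** g'" "cod f = dom g" "cod f' = dom g'"
  shows "ez *** (f >>> g) = ez *** (f' >>> g')"
  using assms by (simp add: ez_seq)

lemma ez_ten_cong: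
  assumes "ez *** f = ez *** f'" "ez *** g = ez *** g'"
  shows "ez *** f *** g = ez *** f' *** g'"
proof -
  have "ez *** f *** g = ez *** f' *** g" using assms(1) by (simp add: ten_asc[symmetric])
  also have "\<dots> = f' *** ez *** g" by (simp add: ten_asc[symmetric] ez_commute)
  also have "\<dots> = f' *** ez *** g'" using assms(2) by simp
  also have "\<dots> = ez *** f' *** g'" by (simp add: ten_asc[symmetric] ez_commute)
  finally show ?thesis .
qed

text \<open>Next to \<open>ez\<close> the gate \<open>cx\<close> becomes an identity, and the counit
  law of \<open>de\<close> then says that the wire may be cut.\<close>

lemma ez_idm_1: "ez *** idm 1 = ez *** (de >>> iu)"
proof -
  have "ez *** ((idm 1 *** iu) >>> cx >>> (de *** idm 1)) = ez *** ((idm 1 *** iu) >>> idm 2 >>> (de *** idm 1))"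
    by (intro ez_seq_cong ez_cx refl) simp_all
  also have "(idm 1 *** iu) >>> idm 2 >>> (de *** idm 1) = de >>> iu"
    using slide_right[of 1 de 1 iu] slide_left[of 0 iu 0 de] by simp
  finally show ?thesis by (simp add: de_counit)
qed

lemma ez_pu: "ez *** pu = ez *** de"
  using ez_seq_cong[OF ez_idm_1 refl[of "ez *** pu"]] by (simp add: seq_asc iu_pu)

text \<open>Next to \<open>ez\<close> there is no difference between \<open>pu\<close> and
  \<open>de\<close>, so a loop is as trivial as \<open>ce >>> pu\<close>. This is why the exponent
  is lost on the empty apex.\<close>

lemma ez_loop: "ez *** (ce >>> de) = ez"
  using ez_seq_cong[OF refl[of "ez *** ce"] ez_pu] by (simp add: ce_pu)

lemma ez_step: "ez *** step r = ez *** step 0"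
  using ez_seq_cong[OF refl[of "ez *** sx"] ez_cx] by (simp add: step_def)

lemma ez_ub: "ez *** ub b = ez *** ub 0"
  using ez_seq_cong[OF refl[of "ez *** iu"] ez_nx] by (simp add: ub_def)

lemma ez_par: "ez *** par as = ez *** par (replicate (length as) 0)"
proof (induction as)
  case (Cons r as)
  then show ?case unfolding length_Cons replicate_Suc par_Cons length_replicate
    by (intro ez_seq_cong ez_ten_cong ez_step refl) simp_all
qed simp

lemma ez_chk: "ez *** chk b as = ez *** idm (length as)"
proof -
  have "ez *** chk b as = ez *** chk 0 (replicate (length as) 0)"
    unfolding chk_par length_replicate by (intro ez_seq_cong ez_ten_cong ez_ub ez_par refl) simp_all
  then show ?thesis by (simp add: chk_zero)
qed


subsection \<open>Normal forms of states\<close>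

text \<open>A pair \<open>(b, as)\<close> stands for the function b + \<Sum> a x with coefficients
  \<open>as\<close>; in a list of checks it is the equation that this function vanishes.\<close>

type_synonym affine_fn = "bit \<times> bit list"

primrec pw :: "nat \<Rightarrow> mor \<Rightarrow> mor" where
  "pw 0 f = idm 0"
| "pw (Suc k) f = f *** pw k f"

lemma pw_dom [simp]: "dom (pw k f) = k * dom f" "cod (pw k f) = k * cod f" "wf f \<Longrightarrow> wf (pw k f)"
  by (induction k) auto

lemma pw_add: "pw (k + l) f = pw k f *** pw l f"
  by (induction k) (auto simp: ten_asc)

primrec chks :: "nat \<Rightarrow> affine_fn list \<Rightarrow> mor" where
  "chks n [] = idm n"
| "chks n (c # L) = chk (fst c) (snd c) >>> chks n L"

definition valid :: "nat \<Rightarrow> affine_fn list \<Rightarrow> bool" where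
  "valid n L \<longleftrightarrow> (\<forall>c\<in>set L. length (snd c) = n)"

lemma valid_simps [simp]:
  "valid n []" "valid n (c # L) \<longleftrightarrow> length (snd c) = n \<and> valid n L"
  "valid n (L @ M) \<longleftrightarrow> valid n L \<and> valid n M"
  by (auto simp: valid_def)

lemma chks_dom [simp]:
  "valid n L \<Longrightarrow> dom (chks n L) = n" "valid n L \<Longrightarrow> cod (chks n L) = n" "valid n L \<Longrightarrow> wf (chks n L)"
  by (induction L) auto

lemma chks_append: "valid n L \<Longrightarrow> valid n M \<Longrightarrow> chks n (L @ M) = chks n L >>> chks n M"
  by (induction L) (auto simp: seq_asc)

lemma chk_chks_commute:
  assumes "valid n L" "length as = n"
  shows "chk b as >>> chks n L = chks n L >>> chk b as"
  using assms
proof (induction L)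
  case (Cons c L)
  then show ?case
    using chk_commute[of "snd c" as b "fst c", THEN seq_cut2] by (simp add: seq_asc)
qed simp

lemma chks_commute:
  assumes "valid n L" "valid n M"
  shows "chks n L >>> chks n M = chks n M >>> chks n L"
  using assms
proof (induction L)
  case (Cons c L)
  then show ?case
    using chk_chks_commute[of n M "snd c" "fst c", THEN seq_cut2] by (simp add: seq_asc)
qed simp

lemma map2_add_self: "map2 (+) as as = replicate (length as) (0 :: bit)"
  by (induction as) auto

lemma chk_idem: "chk b as >>> chk b as = chk b as"
  using chk_add[of as as b b] by (simp add: map2_add_self chk_zero)

lemma chks_absorb:
  assumes "valid n L" "c \<in> set L"
  shows "chk (fst c) (snd c) >>> chks n L = chks n L"
  using assms
proof (induction L)
  case (Cons d L)
  then show ?case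
  proof (cases "c = d")
    case True
    then show ?thesis by (simp add: chk_idem[THEN seq_cut])
  next
    case False
    then show ?thesis
      using Cons chk_commute[of "snd d" "snd c" "fst c" "fst d", THEN seq_cut2]
      by (auto simp: valid_def)
  qed
qed simp

text \<open>One step of Gaussian elimination: in the presence of an equation with leading
  coefficient 1, every equation that involves the first wire may be replaced by its sum with that
  pivot.\<close>

lemma chks_eliminate:
  assumes "valid (Suc n) L" "length as = n"
  shows "\<exists>L'. valid n L' \<and> chk b (1 # as) >>> chks (Suc n) L = chk b (1 # as) >>> (idm 1 *** chks n L')"
  using assms(1)
proof (induction L)
  case Nil
  then show ?case using assms(2) by (intro exI[of _ "[]"]) (simp add: ten_idm)
next
  case (Cons c L)
  let ?x = "chk b (1 # as)"
  obtain L' where L': "valid n L'" "?x >>> chks (Suc n) L = ?x >>> (idm 1 *** chks n L')"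
    using Cons by auto
  have *: "\<exists>d. length (snd d) = n \<and> ?x >>> chk (fst c) (snd c) = ?x >>> (idm 1 *** chk (fst d) (snd d))"
  proof -
    obtain r cs where c: "snd c = r # cs" "length cs = n"
      using Cons.prems by (cases "snd c") auto
    show ?thesis
    proof (cases "r = 0")
      case True
      then show ?thesis using c by (intro exI[of _ "(fst c, cs)"]) (simp add: chk_Cons_0)
    next
      case False
      have "?x >>> chk (fst c) (snd c) = chk (fst c) (snd c) >>> ?x"
        using chk_commute c assms(2) by simp
      also have "\<dots> = chk (b + fst c) (0 # map2 (+) as cs) >>> ?x"
        using chk_add[of "1 # as" "snd c" "fst c" b] c assms(2) False by simp
      also have "\<dots> = ?x >>> chk (b + fst c) (0 # map2 (+) as cs)"
        using chk_commute c assms(2) by simp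
      finally show ?thesis
        using c assms(2) by (intro exI[of _ "(b + fst c, map2 (+) as cs)"]) (simp add: chk_Cons_0)
    qed
  qed
  then obtain d where d: "length (snd d) = n" "?x >>> chk (fst c) (snd c) = ?x >>> (idm 1 *** chk (fst d) (snd d))"
    by blast
  have comm: "?x >>> (idm 1 *** chk (fst d) (snd d)) = (idm 1 *** chk (fst d) (snd d)) >>> ?x"
    using chk_commute[of "1 # as" "0 # snd d" "fst d" b] d(1) assms(2) by (simp add: chk_Cons_0)
  have "?x >>> chks (Suc n) (c # L) = (idm 1 *** chk (fst d) (snd d)) >>> ?x >>> chks (Suc n) L"
    using d(2)[THEN seq_cut2] comm[THEN seq_cut2] by simp
  also have "\<dots> = ?x >>> (idm 1 *** chk (fst d) (snd d)) >>> (idm 1 *** chks n L')"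
    using L'(2) comm[THEN seq_cut2] by simp
  also have "\<dots> = ?x >>> (idm 1 *** chks n (d # L'))"
    using d(1) L'(1) by (simp add: interchange)
  finally show ?case using d(1) L'(1) by (intro exI[of _ "d # L'"]) simp
qed

lemma chks_independent:
  assumes "valid (Suc n) L" "\<And>c. c \<in> set L \<Longrightarrow> hd (snd c) = 0"
  shows "\<exists>L'. valid n L' \<and> chks (Suc n) L = idm 1 *** chks n L'"
  using assms
proof (induction L)
  case Nil
  then show ?case by (intro exI[of _ "[]"]) (simp add: ten_idm idm_Suc)
next
  case (Cons c L)
  obtain L' where L': "valid n L'" "chks (Suc n) L = idm 1 *** chks n L'"
    using Cons by auto
  obtain cs where c: "snd c = 0 # cs" "length cs = n"
    using Cons.prems(1) Cons.prems(2)[of c] by (cases "snd c") auto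
  show ?case
    using L' c by (intro exI[of _ "(fst c, cs) # L'"]) (simp add: chk_Cons_0 interchange)
qed

section \<open>Closure of normal forms under all morphisms\<close>

definition nf :: "nat \<Rightarrow> nat \<Rightarrow> affine_fn list \<Rightarrow> mor" where
  "nf k n L = pw k (ce >>> de) *** (pw n ce >>> chks n L)"

definition is_nf :: "nat \<Rightarrow> mor \<Rightarrow> bool" where
  "is_nf n f \<longleftrightarrow> (\<exists>k L. valid n L \<and> f = nf k n L)"

lemma nf_dom [simp]: "dom (nf k n L) = 0" "valid n L \<Longrightarrow> cod (nf k n L) = n"
  by (simp_all add: nf_def)

lemma is_nf_dom: "is_nf n f \<Longrightarrow> dom f = 0 \<and> cod f = n"
  by (auto simp: is_nf_def)

lemma is_nf_idm: "is_nf n f \<Longrightarrow> f >>> idm n = f"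
  by (metis is_nf_dom seq_id(2))

lemma nf_seq:
  assumes "valid n L" "dom g = n"
  shows "nf k n L >>> g = pw k (ce >>> de) *** (pw n ce >>> chks n L >>> g)"
  using interchange[of "pw k (ce >>> de)" "idm 0" "pw n ce >>> chks n L" g] assms
  by (simp add: nf_def seq_asc)

text \<open>Quantifying over idle wires on both sides makes the property stable under composition
  and tensor, so that it has to be verified for the generators and the symmetry only.\<close>

definition keeps :: "mor \<Rightarrow> bool" where
  "keeps f \<longleftrightarrow> (\<forall>i j s. is_nf (i + dom f + j) s \<longrightarrow> is_nf (i + cod f + j) (s >>> (idm i *** f *** idm j)))"

lemma keepsD: "keeps f \<Longrightarrow> is_nf (i + dom f + j) s \<Longrightarrow> is_nf (i + cod f + j) (s >>> (idm i *** f *** idm j))"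
  by (simp add: keeps_def)

lemma keeps_idm: "keeps (idm n)"
  by (simp add: keeps_def ten_idm ten_idm_asc add.assoc is_nf_idm)

lemma keeps_seq:
  assumes "keeps f" "keeps g" "cod f = dom g"
  shows "keeps (f >>> g)"
  unfolding keeps_def
proof (intro allI impI)
  fix i j s assume "is_nf (i + dom (f >>> g) + j) s"
  then have "is_nf (i + dom g + j) (s >>> (idm i *** f *** idm j))"
    using keepsD[OF assms(1)] assms(3) by simp
  from keepsD[OF assms(2) this]
  show "is_nf (i + cod (f >>> g) + j) (s >>> (idm i *** (f >>> g) *** idm j))"
    using assms(3) by (simp add: seq_asc interchange)
qed

lemma keeps_pad:
  assumes "keeps f"
  shows "keeps (idm k *** f *** idm l)"
  unfolding keeps_def
proof (intro allI impI)
  fix i j s assume "is_nf (i + dom (idm k *** f *** idm l) + j) s"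
  then have "is_nf ((i + k) + dom f + (l + j)) s" by (simp add: add_ac)
  from keepsD[OF assms this]
  show "is_nf (i + cod (idm k *** f *** idm l) + j) (s >>> (idm i *** (idm k *** f *** idm l) *** idm j))"
    by (simp add: ten_asc ten_idm ten_idm_asc add_ac)
qed

lemma keeps_ten:
  assumes "keeps f" "keeps g"
  shows "keeps (f *** g)"
proof -
  have "keeps ((f *** idm (dom g)) >>> (idm (cod f) *** g))"
    using keeps_pad[OF assms(1), of 0 "dom g"] keeps_pad[OF assms(2), of "cod f" 0]
    by (intro keeps_seq) simp_all
  then show ?thesis by (simp add: slide_left)
qed

lemma pw_ce_gate:
  assumes "pw k ce >>> g = pw k ce" "dom g = k" "cod g = k"
  shows "pw (i + k + j) ce >>> (idm i *** g *** idm j) = pw (i + k + j) ce"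
  using assms by (simp add: pw_add ten_asc interchange)

text \<open>A gate that can be exchanged with checks moves in front of all of them, where the free
  wires absorb it; its only trace is a change of the equations.\<close>

lemma keeps_gate:
  assumes g: "dom g = k" "cod g = k" and ce: "pw k ce >>> g = pw k ce"
    and chk: "\<And>c. length (snd c) = i + k + j \<Longrightarrow> \<exists>c'. length (snd c') = i + k + j \<and>
      chk (fst c) (snd c) >>> (idm i *** g *** idm j) = (idm i *** g *** idm j) >>> chk (fst c') (snd c')"
    and s: "is_nf (i + k + j) s"
  shows "is_nf (i + k + j) (s >>> (idm i *** g *** idm j))"
proof -
  let ?n = "i + k + j" and ?G = "idm i *** g *** idm j"
  have *: "\<exists>L'. valid ?n L' \<and> chks ?n L >>> ?G = ?G >>> chks ?n L'" if "valid ?n L" for L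
    using that
  proof (induction L)
    case Nil
    then show ?case using g by (intro exI[of _ "[]"]) (simp add: add.assoc)
  next
    case (Cons c L)
    obtain L' where L': "valid ?n L'" "chks ?n L >>> ?G = ?G >>> chks ?n L'" using Cons by auto
    obtain c' where c': "length (snd c') = ?n" "chk (fst c) (snd c) >>> ?G = ?G >>> chk (fst c') (snd c')"
      using chk[of c] Cons.prems by (metis valid_simps(2))
    show ?case using L' c' c'(2)[THEN seq_cut2]
      by (intro exI[of _ "c' # L'"]) (simp add: seq_asc)
  qed
  obtain m L where L: "valid ?n L" "s = nf m ?n L" using s by (auto simp: is_nf_def)
  obtain L' where L': "valid ?n L'" "chks ?n L >>> ?G = ?G >>> chks ?n L'" using * L(1) by blast
  have "s >>> ?G = nf m ?n L'"
    using L L' g pw_ce_gate[OF ce g, THEN seq_cut] by (simp add: nf_seq add.assoc) (simp add: nf_def)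
  then show ?thesis using L'(1) by (auto simp: is_nf_def)
qed

lemma pw_ce_2: "pw 2 ce = ce *** ce"
  by (simp add: numeral_2_eq_2)

lemma pw_1: "pw 1 f = f"
  by (simp add: One_nat_def)

lemma keeps_sx: "keeps sx"
  unfolding keeps_def
proof (intro allI impI)
  fix i j s assume "is_nf (i + dom sx + j) s"
  then have s: "is_nf (i + 2 + j) s" by simp
  have ce: "pw 2 ce >>> sx = pw 2 ce"
    using sw_natural[of 1 ce 1 ce] by (simp add: pw_ce_2)
  have "is_nf (i + 2 + j) (s >>> (idm i *** sx *** idm j))"
  proof (rule keeps_gate[OF _ _ ce _ s])
    fix c :: affine_fn assume c: "length (snd c) = i + 2 + j"
    define as where "as = take i (snd c)"
    obtain r t bs where d: "drop i (snd c) = r # t # bs" "length bs = j"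
      using c by (metis (no_types, lifting) Suc_length_conv add_diff_cancel_left' length_drop add.assoc add_2_eq_Suc)
    have eq: "snd c = as @ r # t # bs" "length as = i"
      using c d by (auto simp: as_def) (metis append_take_drop_id)
    show "\<exists>c'. length (snd c') = i + 2 + j \<and>
      chk (fst c) (snd c) >>> (idm i *** sx *** idm j) = (idm i *** sx *** idm j) >>> chk (fst c') (snd c')"
      using sx_chk[of as bs "fst c" t r] eq d(2) by (intro exI[of _ "(fst c, as @ t # r # bs)"]) simp
  qed simp_all
  then show "is_nf (i + cod sx + j) (s >>> (idm i *** sx *** idm j))" by simp
qed

lemma keeps_sw_1: "keeps (sw 1 m)"
proof (induction m)
  case 0
  then show ?case using keeps_idm by simp
next
  case (Suc m)
  have "sw 1 (Suc m) = (sx *** idm m) >>> (idm 1 *** sw 1 m)"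
    using sw_hexagon[of 1 1 m] by (simp only: Suc_eq_plus1_left)
  moreover have "keeps ((sx *** idm m) >>> (idm 1 *** sw 1 m))"
    by (intro keeps_seq keeps_ten keeps_sx keeps_idm Suc.IH) simp
  ultimately show ?case by simp
qed

text \<open>The hexagon in the other argument, obtained by inverting the given one: both sides are
  inverse to \<open>sw k (n + m)\<close>.\<close>

lemma sw_hexagon': "sw (n + m) k = (idm n *** sw m k) >>> (sw n k *** idm m)"
proof -
  have "(sw k n *** idm m) >>> (idm n *** sw k m) >>> (idm n *** sw m k) >>> (sw n k *** idm m) = idm (k + n + m)"
    by (subst interchange[THEN seq_cut]) (simp_all add: interchange ten_idm)
  then have 1: "sw k (n + m) >>> (idm n *** sw m k) >>> (sw n k *** idm m) = idm (k + n + m)"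
    by (simp add: sw_hexagon seq_asc)
  have "sw (n + m) k = sw (n + m) k >>> sw k (n + m) >>> (idm n *** sw m k) >>> (sw n k *** idm m)"
    unfolding 1 by (simp add: add.assoc)
  also have "\<dots> = (idm n *** sw m k) >>> (sw n k *** idm m)"
    by (subst sw_sw[THEN seq_cut]) simp
  finally show ?thesis .
qed

lemma keeps_sw: "keeps (sw n m)"
proof (induction n)
  case 0
  then show ?case using keeps_idm by simp
next
  case (Suc n)
  have "sw (Suc n) m = (idm 1 *** sw n m) >>> (sw 1 m *** idm n)"
    using sw_hexagon'[of 1 n m] by (simp only: Suc_eq_plus1_left)
  moreover have "keeps ((idm 1 *** sw n m) >>> (sw 1 m *** idm n))"
    by (intro keeps_seq keeps_ten keeps_sw_1 keeps_idm Suc.IH) simp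
  ultimately show ?case by simp
qed

text \<open>Swaps preserve normal forms, and naturality of the symmetry brings the wires on which
  \<open>f\<close> acts to the front and back again.\<close>

lemma keeps_front:
  assumes "\<And>j s. is_nf (dom f + j) s \<Longrightarrow> is_nf (cod f + j) (s >>> (f *** idm j))"
  shows "keeps f"
  unfolding keeps_def
proof (intro allI impI)
  fix i j s assume s: "is_nf (i + dom f + j) s"
  let ?s1 = "s >>> (sw i (dom f) *** idm j)"
  have "is_nf (dom f + (i + j)) ?s1"
    using keepsD[OF keeps_sw, of 0 i "dom f" j s] s by (simp add: add_ac)
  then have "is_nf (cod f + (i + j)) (?s1 >>> (f *** idm (i + j)))" by (rule assms)
  then have "is_nf (i + cod f + j) ((?s1 >>> (f *** idm (i + j))) >>> (sw (cod f) i *** idm j))"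
    using keepsD[OF keeps_sw, of 0 "cod f" i j] by (simp add: add_ac)
  moreover have "(sw i (dom f) *** idm j) >>> (f *** idm (i + j)) >>> (sw (cod f) i *** idm j) = idm i *** f *** idm j"
  proof -
    have "(sw i (dom f) >>> (f *** idm i)) >>> sw (cod f) i = ((idm i *** f) >>> sw i (cod f)) >>> sw (cod f) i"
      using sw_natural[of i "idm i" "cod f" f] by simp
    then have "sw i (dom f) >>> (f *** idm i) >>> sw (cod f) i = idm i *** f"
      by (simp add: seq_asc)
    then have "(sw i (dom f) >>> (f *** idm i) >>> sw (cod f) i) *** idm j = idm i *** f *** idm j"
      by (simp add: ten_asc)
    then show ?thesis by (simp add: seq_ten_idm ten_asc ten_idm add.commute)
  qed
  ultimately show "is_nf (i + cod f + j) (s >>> (idm i *** f *** idm j))"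
    by (simp add: seq_asc)
qed


lemma bit_add_cancel [simp]: "(a :: bit) + b + b = a" "(a :: bit) + (a + b) = b"
  by (cases a; cases b; simp)+

lemma is_nfI: "f = nf k n L \<Longrightarrow> valid n L \<Longrightarrow> is_nf n f"
  by (auto simp: is_nf_def)

lemma is_nf_Suc: "is_nf (1 + n) f = is_nf (Suc n) f"
  by (simp only: Suc_eq_plus1_left)

lemma keeps_nx: "keeps nx"
proof (rule keeps_front)
  fix j s assume s: "is_nf (dom nx + j) s"
  have "is_nf (0 + 1 + j) (s >>> (idm 0 *** nx *** idm j))"
  proof (rule keeps_gate)
    fix c :: affine_fn assume "length (snd c) = 0 + 1 + j"
    then obtain r as where c: "snd c = r # as" "length as = j" by (cases "snd c") auto
    show "\<exists>c'. length (snd c') = 0 + 1 + j \<and>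
      chk (fst c) (snd c) >>> (idm 0 *** nx *** idm j) = (idm 0 *** nx *** idm j) >>> chk (fst c') (snd c')"
      \<comment> \<open>The exchange law is read from right to left, so it is used at the constant
        \<open>fst c + r\<close>, to which it adds \<open>r\<close> once more.\<close>
      using nx_chk[of as "fst c + r" r] c by (intro exI[of _ "(fst c + r, r # as)"]) simp
  qed (use s in \<open>simp_all add: pw_1 ce_nx\<close>)
  then show "is_nf (cod nx + j) (s >>> (nx *** idm j))" by simp
qed

lemma keeps_cx: "keeps cx"
proof (rule keeps_front)
  fix j s assume s: "is_nf (dom cx + j) s"
  have ce: "(ce *** ce) >>> cx = ce *** ce"
  proof -
    have "ce *** ce = ce >>> (idm 1 *** ce)" using slide_left[of 0 ce 1 ce] by simp
    then show ?thesis by (simp add: seq_asc ce_cx)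
  qed
  have "is_nf (0 + 2 + j) (s >>> (idm 0 *** cx *** idm j))"
  proof (rule keeps_gate)
    fix c :: affine_fn assume "length (snd c) = 0 + 2 + j"
    then obtain r t as where c: "snd c = r # t # as" "length as = j"
      by (cases "snd c"; cases "tl (snd c)") auto
    show "\<exists>c'. length (snd c') = 0 + 2 + j \<and>
      chk (fst c) (snd c) >>> (idm 0 *** cx *** idm j) = (idm 0 *** cx *** idm j) >>> chk (fst c') (snd c')"
      \<comment> \<open>Again read from right to left: the leading coefficient \<open>r + t\<close>
        becomes \<open>r + t + t\<close>, which is \<open>r\<close>.\<close>
      using cx_chk[of as "fst c" "r + t" t] c by (intro exI[of _ "(fst c, (r + t) # t # as)"]) simp
  qed (use s in \<open>simp_all add: pw_ce_2 ce\<close>)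
  then show "is_nf (cod cx + j) (s >>> (cx *** idm j))" by simp
qed

lemma chks_shift:
  "valid n L \<Longrightarrow> chks (Suc n) (map (\<lambda>c. (fst c, 0 # snd c)) L) = idm 1 *** chks n L"
  by (induction L) (simp_all add: ten_idm idm_Suc chk_Cons_0 interchange)

lemma valid_shift: "valid n L \<Longrightarrow> valid (Suc n) (map (\<lambda>c. (fst c, 0 # snd c)) L)"
  by (auto simp: valid_def)

lemma nf_ten_state:
  assumes "valid j L" "dom f = 0"
  shows "nf k j L >>> (f *** idm j) = pw k (ce >>> de) *** f *** (pw j ce >>> chks j L)"
proof -
  have "(idm 0 *** (pw j ce >>> chks j L)) >>> (f *** idm j) = f *** (pw j ce >>> chks j L)"
    using assms by (intro slide_right) simp_all
  then show ?thesis using assms by (simp add: nf_seq seq_asc)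
qed

text \<open>The new wire is free: every equation receives the coefficient 0 for it.\<close>

lemma keeps_ce: "keeps ce"
proof (rule keeps_front)
  fix j s assume "is_nf (dom ce + j) s"
  then obtain k L where L: "valid j L" "s = nf k j L" by (auto simp: is_nf_def)
  have "s >>> (ce *** idm j) = nf k (Suc j) (map (\<lambda>c. (fst c, 0 # snd c)) L)"
    using L interchange[of ce "idm 1" "pw j ce" "chks j L"]
    by (simp add: nf_ten_state) (simp add: nf_def chks_shift)
  then have "is_nf (Suc j) (s >>> (ce *** idm j))"
    by (rule is_nfI) (rule valid_shift[OF L(1)])
  then show "is_nf (cod ce + j) (s >>> (ce *** idm j))"
    by (simp add: is_nf_Suc)
qed

lemma is_nf_chk:
  assumes "is_nf n s" "length as = n"
  shows "is_nf n (s >>> chk b as)"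
proof -
  obtain k L where L: "valid n L" "s = nf k n L" using assms by (auto simp: is_nf_def)
  have "s >>> chk b as = nf k n (L @ [(b, as)])"
    using L assms(2) by (simp add: nf_seq) (simp add: nf_def chks_append)
  then show ?thesis by (rule is_nfI) (simp add: L(1) assms(2))
qed

lemma keeps_iu: "keeps iu"
proof (rule keeps_front)
  fix j s assume s: "is_nf (dom iu + j) s"
  have "is_nf (Suc j) (s >>> (ce *** idm j))"
    using keepsD[OF keeps_ce, of 0 j s] s by (simp add: is_nf_Suc)
  then have "is_nf (Suc j) ((s >>> (ce *** idm j)) >>> chk 0 (1 # replicate j 0))"
    by (rule is_nf_chk) simp
  then show "is_nf (cod iu + j) (s >>> (iu *** idm j))"
    by (simp add: seq_asc iu_chk is_nf_Suc)
qed

lemma keeps_ez: "keeps ez"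
proof (rule keeps_front)
  fix j s assume "is_nf (dom ez + j) s"
  then have "is_nf j (s >>> chk 1 (replicate j 0))"
    by (intro is_nf_chk) simp_all
  then show "is_nf (cod ez + j) (s >>> (ez *** idm j))" by (simp add: chk_one)
qed

text \<open>If some equation involves the discarded wire, it serves as a pivot: it is removed
  together with the wire. Otherwise the wire is free, and discarding it leaves a loop that raises
  the exponent by one.\<close>

lemma keeps_de: "keeps de"
proof (rule keeps_front)
  fix j s assume "is_nf (dom de + j) s"
  then have "is_nf (Suc j) s" by (simp add: is_nf_Suc)
  then obtain k L where L: "valid (Suc j) L" "s = nf k (Suc j) L" by (auto simp: is_nf_def)
  have ce: "(ce *** pw j ce) = pw j ce >>> (ce *** idm j)"
    using slide_right[of 0 ce j "pw j ce"] by simp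
  show "is_nf (cod de + j) (s >>> (de *** idm j))"
  proof (cases "\<exists>c\<in>set L. hd (snd c) = 1")
    case True
    then obtain c where c: "c \<in> set L" "hd (snd c) = 1" by blast
    then obtain as where as: "snd c = 1 # as" "length as = j"
      using L(1) by (cases "snd c") (auto simp: valid_def)
    obtain L' where L': "valid j L'"
      "chk (fst c) (1 # as) >>> chks (Suc j) L = chk (fst c) (1 # as) >>> (idm 1 *** chks j L')"
      using chks_eliminate[OF L(1) as(2)] by blast
    \<comment> \<open>Since checks are idempotent, a further copy of the pivot can be put in front,
      where it clears the first coefficient of every member of \<open>L\<close>.\<close>
    have eq: "chks (Suc j) L = chk (fst c) (1 # as) >>> (idm 1 *** chks j L')"
      using chks_absorb[OF L(1) c(1)] L'(2) as(1) by simp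
    have d: "(idm 1 *** chks j L') >>> (de *** idm j) = (de *** idm j) >>> (idm 0 *** chks j L')"
      by (rule slide) (simp_all add: L'(1))
    have "(ce *** pw j ce) >>> chks (Suc j) L >>> (de *** idm j)
      = pw j ce >>> ((ce *** idm j) >>> chk (fst c) (1 # as) >>> (de *** idm j)) >>> chks j L'"
      unfolding eq seq_asc d ce by simp
    also have "\<dots> = pw j ce >>> chks j L'"
      using as(2) L'(1) chk_elim[of as "fst c"] by simp
    finally have "s >>> (de *** idm j) = nf k j L'"
      using L by (simp add: nf_seq) (simp add: nf_def)
    then have "is_nf j (s >>> (de *** idm j))" by (rule is_nfI) (rule L'(1))
    then show ?thesis by simp
  next
    case False
    then obtain L' where L': "valid j L'" "chks (Suc j) L = idm 1 *** chks j L'"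
      using chks_independent[OF L(1)] by auto
    have "(ce *** pw j ce) >>> chks (Suc j) L >>> (de *** idm j) = (ce >>> de) *** (pw j ce >>> chks j L')"
      using L' by (simp add: interchange)
    then have "s >>> (de *** idm j) = pw (k + 1) (ce >>> de) *** (pw j ce >>> chks j L')"
      using L by (simp add: nf_seq pw_add pw_1 ten_asc)
    then have "s >>> (de *** idm j) = nf (k + 1) j L'" by (simp only: nf_def)
    then have "is_nf j (s >>> (de *** idm j))" by (rule is_nfI) (rule L'(1))
    then show ?thesis by simp
  qed
qed

lemma keeps_pu: "keeps pu"
proof (rule keeps_front)
  fix j s assume "is_nf (dom pu + j) s"
  then have "is_nf (0 + dom de + j) (s >>> chk 0 (1 # replicate j 0))"
    by (intro is_nf_chk) (simp_all add: is_nf_Suc)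
  from keepsD[OF keeps_de this] show "is_nf (cod pu + j) (s >>> (pu *** idm j))"
    by (simp add: seq_asc pu_chk)
qed

lemma keeps_gn: "keeps (gn x)"
  by (cases x) (simp_all add: keeps_cx keeps_nx keeps_iu keeps_pu keeps_ez keeps_de keeps_ce)

lemma keeps_abs_mor: "wf_term gen_arity t \<Longrightarrow> keeps (abs_mor t)"
proof (induction t)
  case (Seq t1 t2)
  then show ?case unfolding abs_mor_simps
    by (intro keeps_seq) (simp_all add: dom.abs_eq cod.abs_eq)
qed (simp_all add: abs_mor_simps keeps_gn keeps_idm keeps_sw keeps_ten)

theorem state_is_nf:
  assumes "wf f" "dom f = 0"
  shows "is_nf (cod f) f"
proof -
  obtain t where t: "f = abs_mor t" using mor.abs_induct[of "\<lambda>f. \<exists>t. f = abs_mor t" f] by blast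
  have "is_nf 0 (idm 0)" unfolding is_nf_def by (intro exI[of _ 0] exI[of _ "[]"]) (simp add: nf_def)
  moreover have "keeps f"
    using keeps_abs_mor assms(1) unfolding t wf.abs_eq by blast
  ultimately show ?thesis using keepsD[of f 0 0 "idm 0"] assms(2) by simp
qed


subsection \<open>Solution sets determine normal forms\<close>

definition ev :: "affine_fn \<Rightarrow> bit list \<Rightarrow> bit" where
  "ev c x = fst c + sum_list (map2 (*) (snd c) x)"

definition addf :: "affine_fn \<Rightarrow> affine_fn \<Rightarrow> affine_fn" where
  "addf c d = (fst c + fst d, map2 (+) (snd c) (snd d))"

definition sol :: "nat \<Rightarrow> affine_fn list \<Rightarrow> bit list set" where
  "sol n L = {x. length x = n \<and> (\<forall>c\<in>set L. ev c x = 0)}"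

abbreviation chkf :: "affine_fn \<Rightarrow> mor" where
  "chkf c \<equiv> chk (fst c) (snd c)"

lemma length_addf [simp]: "length (snd (addf c d)) = min (length (snd c)) (length (snd d))"
  by (simp add: addf_def)

lemma ev_addf:
  assumes "length (snd c) = length x" "length (snd d) = length x"
  shows "ev (addf c d) x = ev c x + ev d x"
proof -
  have "sum_list (map2 (*) (map2 (+) as bs) x) = sum_list (map2 (*) as x) + sum_list (map2 (*) bs x)"
    if "length as = length bs" "length bs = length x" for as bs :: "bit list"
    using that by (induction as bs x rule: list_induct3) (simp_all add: algebra_simps)
  then show ?thesis using assms by (simp add: ev_def addf_def add_ac)
qed

lemma ev_three:
  assumes "length (snd c) = n" "length x = n" "length y = n" "length z = n"
  shows "ev c (map2 (+) x (map2 (+) y z)) = ev c x + (ev c y + ev c z)"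
proof -
  have *: "sum_list (map2 (*) as (map2 (+) x y)) = sum_list (map2 (*) as x) + sum_list (map2 (*) as y)"
    if "length as = length x" "length x = length y" for as x y :: "bit list"
    using that by (induction as x y rule: list_induct3) (simp_all add: algebra_simps)
  show ?thesis using assms by (simp add: ev_def * add_ac)
qed

lemma addf_commute: "addf c d = addf d c"
proof -
  have "map2 (+) as bs = map2 (+) bs as" for as bs :: "bit list"
  proof (induction as arbitrary: bs)
    case (Cons a as)
    then show ?case by (cases bs) (auto simp: add.commute)
  qed simp
  then show ?thesis by (simp add: addf_def add.commute)
qed

lemma addf_addf:
  assumes "length (snd c) = length (snd d)"
  shows "addf d (addf c d) = c" "addf (addf c d) d = c"
proof -
  have "map2 (+) bs (map2 (+) as bs) = as" "map2 (+) (map2 (+) as bs) bs = as"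
    if "length as = length bs" for as bs :: "bit list"
    using that by (induction as bs rule: list_induct2) (simp_all add: add.commute add.left_commute)
  then show "addf d (addf c d) = c" "addf (addf c d) d = c"
    using assms by (simp_all add: addf_def add.left_commute)
qed

lemma chkf_add: "length (snd c) = length (snd d) \<Longrightarrow> chkf d >>> chkf c = chkf (addf c d) >>> chkf c"
  using chk_add[of "snd c" "snd d" "fst d" "fst c"] by (simp add: addf_def)

lemma ev_zero:
  assumes "length (snd c) = n" "\<And>x. length x = n \<Longrightarrow> ev c x = 0"
  shows "c = (0, replicate n 0)"
proof -
  have dot0: "sum_list (map2 (*) as (replicate (length as) 0)) = 0" for as :: "bit list"
    by (induction as) auto
  have "fst c = 0" using assms(2)[of "replicate n 0"] dot0[of "snd c"] assms(1) by (simp add: ev_def)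
  moreover have *: "as = replicate (length as) 0"
    if "\<And>x. length x = length as \<Longrightarrow> sum_list (map2 (*) as x) = 0" for as :: "bit list"
    using that
  proof (induction as)
    case (Cons a as)
    have "sum_list (map2 (*) as x) = 0" if "length x = length as" for x
      using Cons.prems[of "0 # x"] that by simp
    moreover have "a = 0"
      using Cons.prems[of "1 # replicate (length as) 0"] dot0[of as] by simp
    ultimately show ?case using Cons.IH by simp
  qed simp
  moreover have "snd c = replicate n 0"
    using *[of "snd c"] assms calculation by (simp add: ev_def)
  ultimately show ?thesis by (simp add: prod_eq_iff)
qed

lemma ev_const: "ev (b, replicate n 0) x = b"
proof -
  have "sum_list (map2 (*) (replicate n 0) x) = (0 :: bit)"
    by (induction n arbitrary: x) (auto simp: zip_Cons1 split: list.split)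
  then show ?thesis by (simp add: ev_def)
qed

lemma sol_Cons: "sol n (d # L) = {x \<in> sol n L. ev d x = 0}"
  by (auto simp: sol_def)

text \<open>
  An affine function that vanishes where \<open>d\<close> does, on a nonempty affine space meeting the zero
  set of \<open>d\<close>, agrees on that space with \<open>0\<close> or with \<open>d\<close>.
\<close>

lemma chks_implied:
  assumes "valid n L" "length (snd c) = n" "sol n L \<noteq> {}" "\<And>x. x \<in> sol n L \<Longrightarrow> ev c x = 0"
  shows "chks n L >>> chkf c = chks n L"
  using assms
proof (induction L arbitrary: c)
  case Nil
  then have "c = (0, replicate n 0)" by (intro ev_zero) (auto simp: sol_def)
  then show ?case by (simp add: chk_zero)
next
  case (Cons d L)
  have ne: "sol n L \<noteq> {}" and v: "valid n L" and d: "length (snd d) = n"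
    using Cons.prems by (auto simp: sol_Cons)
  obtain x where x: "x \<in> sol n L" "ev d x = 0" using Cons.prems(3) by (auto simp: sol_Cons)
  show ?case
  proof (cases "\<forall>y\<in>sol n L. ev c y = 0")
    case True
    then show ?thesis using Cons.IH[OF v Cons.prems(2) ne] by (simp add: seq_asc)
  next
    case False
    then obtain y where y: "y \<in> sol n L" "ev c y = 1" by auto
    have z: "ev (addf c d) z = 0" if "z \<in> sol n L" for z
    proof -
      have l: "length x = n" "length y = n" "length z = n"
        using x y that by (auto simp: sol_def)
      \<comment> \<open>As \<open>d\<close> is 0 at \<open>x\<close> and 1 at \<open>y\<close>, the
        point x + y + z lies in the zero set of \<open>d\<close> exactly when \<open>z\<close> does
        not. So the value of \<open>c\<close> at \<open>z\<close> is known in both cases, and it is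
        that of \<open>d\<close>.\<close>
      define w where "w = map2 (+) x (map2 (+) y z)"
      have "w \<in> sol n L"
        using x(1) y(1) that v l ev_three[of _ n x y z]
        by (auto simp: sol_def w_def valid_def)
      then have "ev d w = 0 \<Longrightarrow> ev c w = 0" using Cons.prems(4) by (simp add: sol_Cons)
      moreover have "ev d y \<noteq> 0" using y Cons.prems(4)[of y] by (auto simp del: bit_not_zero_iff simp: sol_Cons)
      moreover have "ev c x = 0" using x Cons.prems(4) by (simp add: sol_Cons)
      ultimately have "ev d z = 1 \<Longrightarrow> ev c z = 1"
        using ev_three[OF d l] ev_three[OF Cons.prems(2) l] x(2) y(2)
        by (cases "ev c z = 1") (simp_all add: w_def)
      moreover have "ev d z = 0 \<Longrightarrow> ev c z = 0" using that Cons.prems(4) by (simp add: sol_Cons)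
      ultimately show ?thesis
        using ev_addf[of c z d] Cons.prems(2) d l by (cases "ev d z = 0") auto
    qed
    \<comment> \<open>The function c + d is now handled by the induction hypothesis; adding
      \<open>d\<close> turns its check into that of \<open>c\<close>.\<close>
    have cd: "chks n L >>> chkf (addf c d) = chks n L"
      using Cons.IH[OF v _ ne z] Cons.prems(2) d by simp
    have "chks n L >>> chkf d >>> chkf c = chks n L >>> chkf (addf c d) >>> chkf d"
      using chkf_add[of d c] chk_commute[of "snd c" "snd d" "fst d" "fst c"] Cons.prems(2) d
      by (simp add: addf_commute[of d])
    also have "\<dots> = chks n L >>> chkf d" using cd by (simp add: seq_asc[symmetric])
    finally show ?thesis
      using chk_chks_commute[OF v d] chk_chks_commute[OF v d, THEN seq_cut2] by (simp add: seq_asc)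
  qed
qed

text \<open>When \<open>d\<close> is the equation that makes the system contradictory,
  \<open>d\<close> is constantly 1 on the previous nonempty solution set. So the check of d + 1 is
  implied there, and together with \<open>d\<close> it yields the check of the constant 1.\<close>

lemma chks_empty:
  assumes "valid n L" "sol n L = {}"
  shows "chks n L >>> chk 1 (replicate n 0) = chks n L"
  using assms
proof (induction L)
  case Nil
  then have "replicate n 0 \<notin> sol n []" by blast
  then show ?case by (simp add: sol_def)
next
  case (Cons d L)
  have v: "valid n L" and d: "length (snd d) = n" using Cons.prems by auto
  show ?case
  proof (cases "sol n L = {}")
    case True
    then show ?thesis using Cons.IH v by (simp add: seq_asc)
  next
    case False
    let ?o = "(1, replicate n 0) :: affine_fn"
    let ?e = "addf d ?o"
    have e: "ev ?e x = 0" if "x \<in> sol n L" for x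
    proof -
      have "ev d x = 1" using that Cons.prems(2) by (auto simp: sol_Cons)
      then show ?thesis using that d ev_addf[of d x ?o] by (simp add: sol_def ev_const)
    qed
    have "chks n L >>> chkf ?e = chks n L"
      using chks_implied[OF v _ False e] d by simp
    then have "chks n L >>> chkf d = chks n L >>> chkf ?e >>> chkf d"
      by (simp add: seq_asc[symmetric])
    also have "chkf ?e >>> chkf d = chkf (addf d ?e) >>> chkf d"
      using chkf_add[of d ?e] d by simp
    also have "addf d ?e = ?o"
      using addf_addf(1)[of ?o d] d addf_commute[of d ?o] by simp
    finally have f: "chks n L >>> chkf d = chks n L >>> chkf d >>> chkf ?o"
      using chk_commute[of "snd ?o" "snd d"] d by simp
    show ?thesis
      using f[symmetric] chk_chks_commute[OF v d] chk_chks_commute[OF v d, THEN seq_cut2] by (simp add: seq_asc)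
  qed
qed

text \<open>Each of the two products of checks absorbs the other, and they commute, so both equal
  their common product.\<close>

lemma nf_eqI:
  assumes "valid n L" "valid n M" "sol n L = sol n M" "sol n L \<noteq> {}"
  shows "nf k n L = nf k n M"
proof -
  have *: "chks n L >>> chks n M' = chks n L"
    if "valid n L" "valid n M'" "sol n L \<subseteq> sol n M'" "sol n L \<noteq> {}" for L M'
    using that(2,3)
  proof (induction M')
    case (Cons c M')
    then have "chks n L >>> chkf c = chks n L"
      using chks_implied[OF that(1) _ that(4), of c] by (auto simp: sol_Cons)
    then show ?case using Cons by (simp add: seq_cut sol_Cons subset_iff)
  qed (simp add: that(1))
  have "chks n L = chks n M"
    using *[of L M] *[of M L] chks_commute[of n L M] assms by simp
  then show ?thesis by (simp add: nf_def)
qed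

text \<open>A contradictory system produces \<open>ez\<close>, which erases the checks and all
  loops; the result depends on neither \<open>k\<close> nor \<open>L\<close>.\<close>

lemma nf_empty:
  assumes "valid n L" "sol n L = {}"
  shows "nf k n L = ez *** pw n ce"
proof -
  have loops: "ez *** pw k (ce >>> de) = ez" for k
  proof (induction k)
    case (Suc k)
    then have "ez *** pw (Suc k) (ce >>> de) = (ez *** (ce >>> de)) *** pw k (ce >>> de)" by (simp add: ten_asc)
    then show ?case using Suc by (simp add: ez_loop)
  qed simp
  have ck: "ez *** chks n L = ez *** idm n"
    using assms(1)
  proof (induction L)
    case (Cons c L)
    then show ?case
      using ez_seq_cong[of "chkf c" "idm n" "chks n L" "idm n"] ez_chk[of "fst c" "snd c"] by simp
  qed simp
  have "chks n L = chks n L >>> (ez *** idm n)"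
    using chks_empty[OF assms] by (simp add: chk_one)
  also have "\<dots> = ez *** chks n L"
    using slide_right[of 0 ez n "chks n L"] assms(1) by simp
  finally have "chks n L = ez *** idm n" using ck by simp
  then have "nf k n L = (pw k (ce >>> de) *** ez) *** pw n ce"
    using slide_right[of 0 ez n "pw n ce"] by (simp add: nf_def ten_asc)
  then show ?thesis by (simp add: ez_commute loops)
qed


section \<open>Counting semantics\<close>

definition bl :: "nat \<Rightarrow> bit list set" where
  "bl n = {x. length x = n}"

lemma bl_iff [simp]: "x \<in> bl n \<longleftrightarrow> length x = n"
  by (simp add: bl_def)

lemma UNIV_bit: "(UNIV :: bit set) = {0, 1}"
  using bit_cases by blast

lemma finite_bl [simp]: "finite (bl n)"
proof -
  have "finite (UNIV :: bit set)" by (simp add: UNIV_bit)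
  then show ?thesis using finite_lists_length_eq[of "UNIV :: bit set" n] by (simp add: bl_def)
qed

lemma eq_append_iff: "length a = k \<Longrightarrow> y = a @ b \<longleftrightarrow> take k y = a \<and> drop k y = b"
  by (metis append_eq_conv_conj)

lemma bl_append: "bl (m + n) = (\<lambda>(u, v). u @ v) ` (bl m \<times> bl n)"
proof
  show "bl (m + n) \<subseteq> (\<lambda>(u, v). u @ v) ` (bl m \<times> bl n)"
  proof
    fix w :: "bit list" assume "w \<in> bl (m + n)"
    then show "w \<in> (\<lambda>(u, v). u @ v) ` (bl m \<times> bl n)"
      by (intro image_eqI[of _ _ "(take m w, drop m w)"]) simp_all
  qed
qed auto

lemma sum_bl_append: "(\<Sum>w\<in>bl (m + n). f w) = (\<Sum>u\<in>bl m. \<Sum>v\<in>bl n. f (u @ v))"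
proof -
  have "inj_on (\<lambda>(u, v). u @ v) (bl m \<times> bl n)" by (auto simp: inj_on_def)
  then show ?thesis by (simp add: bl_append sum.reindex sum.cartesian_product case_prod_unfold)
qed

lemma bl_0: "bl 0 = {[]}"
  by auto

lemma sum_bl_Suc: "(\<Sum>w\<in>bl (Suc n). f w) = (\<Sum>w\<in>bl n. f (0 # w)) + (\<Sum>w\<in>bl n. f (1 # w))"
proof -
  have "bl 1 = {[0], [1 :: bit]}"
    using bit_cases by (auto simp: length_Suc_conv One_nat_def)
  then show ?thesis using sum_bl_append[of f 1 n] by (simp add: Suc_eq_plus1_left)
qed

lemma sum_bl_delta:
  fixes g :: "bit list \<Rightarrow> nat"
  shows "(\<Sum>z\<in>bl n. of_bool (z = a) * g z) = of_bool (length a = n) * g a"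
    "(\<Sum>z\<in>bl n. g z * of_bool (z = a)) = of_bool (length a = n) * g a"
proof -
  have "(\<Sum>z\<in>bl n. of_bool (z = a) * g z) = (\<Sum>z\<in>bl n. if z = a then g z else 0)"
    by (intro sum.cong) auto
  then show 1: "(\<Sum>z\<in>bl n. of_bool (z = a) * g z) = of_bool (length a = n) * g a" by simp
  then show "(\<Sum>z\<in>bl n. g z * of_bool (z = a)) = of_bool (length a = n) * g a"
    by (simp add: mult.commute)
qed

text \<open>
  \<open>cmat t x y\<close> is the number of points of the apex of the span denoted by \<open>t\<close> that lie
  over \<open>x\<close> and \<open>y\<close>.
\<close>

fun gsem :: "gen \<Rightarrow> bit list \<Rightarrow> bit list \<Rightarrow> bool" where
  "gsem CNOT x y \<longleftrightarrow> y = [x ! 0, x ! 0 + x ! 1]"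
| "gsem NOT x y \<longleftrightarrow> y = [x ! 0 + 1]"
| "gsem U x y \<longleftrightarrow> y = [0]"
| "gsem Ud x y \<longleftrightarrow> x = [0]"
| "gsem Z x y \<longleftrightarrow> False"
| "gsem E x y \<longleftrightarrow> True"
| "gsem Ed x y \<longleftrightarrow> True"

abbreviation "tdm \<equiv> tdom gen_arity"
abbreviation "tcd \<equiv> tcod gen_arity"
abbreviation "twf \<equiv> wf_term gen_arity"

fun cmat :: "gen pterm \<Rightarrow> bit list \<Rightarrow> bit list \<Rightarrow> nat" where
  "cmat (Gen g) x y = of_bool (length x = fst (gen_arity g) \<and> length y = snd (gen_arity g) \<and> gsem g x y)"
| "cmat (Idn n) x y = of_bool (length x = n \<and> y = x)"
| "cmat (Swap n m) x y = of_bool (length x = n + m \<and> y = drop n x @ take n x)"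
| "cmat (s ;; t) x y = (\<Sum>z\<in>bl (tcd s). cmat s x z * cmat t z y)"
| "cmat (s \<oslash> t) x y =
    cmat s (take (tdm s) x) (take (tcd s) y) * cmat t (drop (tdm s) x) (drop (tcd s) y)"

lemma cmat_support:
  assumes "twf t" "length x \<noteq> tdm t \<or> length y \<noteq> tcd t"
  shows "cmat t x y = 0"
  using assms
proof (induction t arbitrary: x y)
  case (Ten s t)
  show ?case
  proof (rule ccontr)
    assume "cmat (s \<oslash> t) x y \<noteq> 0"
    then have "cmat s (take (tdm s) x) (take (tcd s) y) \<noteq> 0" "cmat t (drop (tdm s) x) (drop (tcd s) y) \<noteq> 0"
      by simp_all
    then have "length (take (tdm s) x) = tdm s" "length (take (tcd s) y) = tcd s"
      "length (drop (tdm s) x) = tdm t" "length (drop (tcd s) y) = tcd t"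
      using Ten.IH Ten.prems(1) by (metis wf_term.simps(2))+
    then show False using Ten.prems(2) by auto
  qed
qed auto

lemma cmat_seq_assoc:
  assumes "tcd t = n"
  shows "cmat ((s ;; t) ;; r) x y = cmat (s ;; (t ;; r)) x y"
proof -
  have "cmat ((s ;; t) ;; r) x y = (\<Sum>w\<in>bl (tcd t). \<Sum>z\<in>bl (tcd s). cmat s x z * cmat t z w * cmat r w y)"
    by (simp add: sum_distrib_right)
  also have "\<dots> = (\<Sum>z\<in>bl (tcd s). \<Sum>w\<in>bl (tcd t). cmat s x z * cmat t z w * cmat r w y)"
    by (rule sum.swap)
  finally show ?thesis by (simp add: sum_distrib_left mult.assoc)
qed

lemma cmat_ten_seq:
  assumes "tcd s = tdm t" "tcd s' = tdm t'"
  shows "cmat ((s ;; t) \<oslash> (s' ;; t')) x y = cmat ((s \<oslash> s') ;; (t \<oslash> t')) x y"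
proof -
  have "cmat ((s \<oslash> s') ;; (t \<oslash> t')) x y =
    (\<Sum>u\<in>bl (tcd s). \<Sum>v\<in>bl (tcd s'). (cmat s (take (tdm s) x) u * cmat s' (drop (tdm s) x) v) *
       (cmat t u (take (tcd t) y) * cmat t' v (drop (tcd t) y)))"
    using assms by (simp add: sum_bl_append)
  also have "\<dots> = (\<Sum>u\<in>bl (tcd s). cmat s (take (tdm s) x) u * cmat t u (take (tcd t) y)) *
      (\<Sum>v\<in>bl (tcd s'). cmat s' (drop (tdm s) x) v * cmat t' v (drop (tcd t) y))"
    by (simp add: sum_product mult_ac)
  finally show ?thesis by simp
qed

text \<open>Evaluating functions instead of matrix products keeps the check of the relations small.\<close>

fun gfun :: "gen \<Rightarrow> bit list \<Rightarrow> bit list" where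
  "gfun CNOT x = [x ! 0, x ! 0 + x ! 1]"
| "gfun NOT x = [x ! 0 + 1]"
| "gfun U x = [0]"
| "gfun _ x = []"

fun functional :: "gen pterm \<Rightarrow> bool" where
  "functional (Gen g) \<longleftrightarrow> g \<in> {CNOT, NOT, U, E}"
| "functional (s ;; t) \<longleftrightarrow> functional s \<and> functional t"
| "functional (s \<oslash> t) \<longleftrightarrow> functional s \<and> functional t"
| "functional _ \<longleftrightarrow> True"

fun tfun :: "gen pterm \<Rightarrow> bit list \<Rightarrow> bit list" where
  "tfun (Gen g) x = gfun g x"
| "tfun (Idn n) x = x"
| "tfun (Swap n m) x = drop n x @ take n x"
| "tfun (s ;; t) x = tfun t (tfun s x)"
| "tfun (s \<oslash> t) x = tfun s (take (tdm s) x) @ tfun t (drop (tdm s) x)"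

lemma tfun_length: "functional t \<Longrightarrow> twf t \<Longrightarrow> length x = tdm t \<Longrightarrow> length (tfun t x) = tcd t"
  by (induction t arbitrary: x) auto

lemma cmat_functional:
  "functional t \<Longrightarrow> twf t \<Longrightarrow> length x = tdm t \<Longrightarrow> cmat t x y = of_bool (y = tfun t x)"
proof (induction t arbitrary: x y)
  case (Gen g)
  then show ?case by (cases g) auto
next
  case (Seq s t)
  then have "cmat (s ;; t) x y = (\<Sum>z\<in>bl (tcd s). of_bool (z = tfun s x) * cmat t z y)"
    by (simp cong: sum.cong)
  then show ?case using Seq tfun_length[of s x] by (simp add: sum_bl_delta)
next
  case (Ten s t)
  have "y = tfun s (take (tdm s) x) @ tfun t (drop (tdm s) x) \<longleftrightarrow>
      take (tcd s) y = tfun s (take (tdm s) x) \<and> drop (tcd s) y = tfun t (drop (tdm s) x)"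
    using Ten.prems tfun_length[of s "take (tdm s) x"] by (intro eq_append_iff) simp
  then show ?case using Ten by auto
qed auto

lemma cmat_functional_seq:
  assumes "functional s" "twf s" "length x = tdm s"
  shows "cmat (s ;; t) x y = cmat t (tfun s x) y"
  using assms cmat_functional[OF assms] tfun_length[OF assms]
  by (simp add: sum_bl_delta)

lemma cmat_functional_eq:
  assumes "functional s" "functional t" "twf s" "twf t" "tdm s = tdm t"
    "\<And>x. length x = tdm s \<Longrightarrow> tfun s x = tfun t x" "length x = tdm s"
  shows "cmat s x y = cmat t x y"
  using assms by (simp add: cmat_functional)

lemma length_2_bits: "length x = 2 \<longleftrightarrow> (\<exists>a b. x = [a, b])"
  by (auto simp: numeral_2_eq_2 length_Suc_conv)

lemma length_3_bits: "length x = 3 \<longleftrightarrow> (\<exists>a b c. x = [a, b, c])"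
  by (auto simp: numeral_3_eq_3 length_Suc_conv)

lemma length_1_bits: "length x = 1 \<longleftrightarrow> (\<exists>a. x = [a])"
  by (auto simp: One_nat_def length_Suc_conv)

lemmas length_bits = length_1_bits length_2_bits length_3_bits

lemmas c_defs = cc_op_def c3_12_def c3_21_def c3_23_def c3_32_def c3_13_def delta_def deltad_def

lemma sum_bl_12:
  "(\<Sum>w\<in>bl 1. f w) = f [0] + f [1]"
  "(\<Sum>w\<in>bl 2. f w) = f [0, 0] + f [0, 1] + f [1, 0] + f [1, 1]"
  by (simp_all add: sum_bl_Suc bl_0 numeral_2_eq_2 One_nat_def add_ac)

lemma cmat_rels_Iso:
  assumes "(s, t) \<in> rels_Iso_Affcb2" "length x = tdm s"
  shows "cmat s x y = cmat t x y"
  using assms(1) unfolding rels_Iso_Affcb2_def rels_Iso_cb2_def Un_iff insert_iff empty_iff prod.inject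
  apply (elim disjE conjE FalseE; hypsubst)
  apply (rule cmat_functional_eq; (use assms(2) in \<open>simp add: c_defs; fail\<close>)?;
     (simp add: c_defs length_bits; elim exE; simp add: take_Cons' drop_Cons' add_ac; fail)?)+
  done

lemma cmat_rels:
  assumes "(s, t) \<in> rels_spAffcb2" "length x = tdm s" "length y = tcd s"
  shows "cmat s x y = cmat t x y"
proof (cases "(s, t) \<in> rels_Iso_Affcb2")
  case True
  then show ?thesis using cmat_rels_Iso assms(2) by blast
next
  case False
  consider "s = (uu \<oslash> Idn 1) ;; cc" "t = uu \<oslash> Idn 1" | "s = cc ;; (ud \<oslash> Idn 1)" "t = ud \<oslash> Idn 1"
    \<comment> \<open>The variables \<open>u\<close> and \<open>v\<close> cover the three relations
      by which \<open>zz\<close> absorbs a gate; both sides count nothing.\<close>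
    | "s = zz \<oslash> zz" "t = zz" | u v where "s = zz \<oslash> u" "t = zz \<oslash> v"
    | "s = uu ;; ud" "t = Idn 0" | "s = uu ;; nn ;; ud" "t = zz"
    | "s = delta ;; (eps \<oslash> Idn 1)" "t = Idn 1" | "s = delta ;; (Idn 1 \<oslash> eps)" "t = Idn 1"
    | "s = (epsd \<oslash> Idn 1) ;; deltad" "t = Idn 1" | "s = (Idn 1 \<oslash> epsd) ;; deltad" "t = Idn 1"
    using assms(1)
    unfolding rels_spAffcb2_def rels_pAffcb2_def rels_piAffcb2_def Un_iff insert_iff empty_iff prod.inject
    by (elim disjE conjE FalseE; use False in simp)
  then show ?thesis
  proof cases
    case 1
    show ?thesis unfolding 1
      by (rule cmat_functional_eq) (use assms(2) 1 in \<open>auto simp: length_bits\<close>)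
  next
    case 2
    then obtain a b where x: "x = [a, b]" using assms(2) by (auto simp: length_bits)
    have "cmat s x y = cmat t [a, a + b] y"
      unfolding 2 x by (subst cmat_functional_seq) simp_all
    also have "\<dots> = cmat t x y"
      unfolding 2 x by (cases "a = 0") (simp_all add: take_Cons' drop_Cons')
    finally show ?thesis .
  next
    case 5
    then show ?thesis using assms(2,3) by (simp add: sum_bl_12)
  next
    case 6
    then show ?thesis using assms(2,3) by (simp add: sum_bl_12)
  next
    case 7
    show ?thesis unfolding 7
      by (rule cmat_functional_eq) (use assms(2) 7 in \<open>auto simp: length_bits c_defs take_Cons' drop_Cons'\<close>)
  next
    case 8
    show ?thesis unfolding 8
      by (rule cmat_functional_eq) (use assms(2) 8 in \<open>auto simp: length_bits c_defs take_Cons' drop_Cons'\<close>)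
  next
    case 9
    \<comment> \<open>The term \<open>epsd\<close> is not a function, but \<open>deltad\<close>
      starts with one. Evaluating it leaves a sum over two bits with a single postselection.\<close>
    have d: "cmat deltad [a, b] z = cmat (Idn 1 \<oslash> ud) [a, a + b] z" for a b z
      unfolding deltad_def by (subst cmat_functional_seq) simp_all
    obtain a b where xy: "x = [a]" "y = [b]" using assms(2,3) 9 by (auto simp: length_bits c_defs)
    have "cmat s [a] [b] = (\<Sum>z\<in>bl 2. cmat (epsd \<oslash> Idn 1) [a] z * cmat deltad z [b])"
      unfolding 9 cmat.simps(4) by simp
    also have "\<dots> = cmat (Idn 1) [a] [b]"
      unfolding sum_bl_12 d by (cases "a = 0"; cases "b = 0") (simp_all add: take_Cons' drop_Cons')
    finally show ?thesis by (simp only: xy 9)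
  next
    case 10
    have d: "cmat deltad [a, b] z = cmat (Idn 1 \<oslash> ud) [a, a + b] z" for a b z
      unfolding deltad_def by (subst cmat_functional_seq) simp_all
    obtain a b where xy: "x = [a]" "y = [b]" using assms(2,3) 10 by (auto simp: length_bits c_defs)
    have "cmat s [a] [b] = (\<Sum>z\<in>bl 2. cmat (Idn 1 \<oslash> epsd) [a] z * cmat deltad z [b])"
      unfolding 10 cmat.simps(4) by simp
    also have "\<dots> = cmat (Idn 1) [a] [b]"
      unfolding sum_bl_12 d by (cases "a = 0"; cases "b = 0") (simp_all add: take_Cons' drop_Cons')
    finally show ?thesis by (simp only: xy 10)
  qed simp_all
qed

lemma cmat_seq_Swap:
  assumes "tcd s = m + m'" "length y' = m'" "length y = m"
  shows "cmat (s ;; Swap m m') x (y' @ y) = cmat s x (y @ y')"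
proof -
  have "cmat (Swap m m') z (y' @ y) = of_bool (z = y @ y')" if "length z = m + m'" for z
    using that assms(2,3) by (auto simp: append_eq_conv_conj) (metis append_take_drop_id)
  then have "cmat (s ;; Swap m m') x (y' @ y) = (\<Sum>z\<in>bl (m + m'). cmat s x z * of_bool (z = y @ y'))"
    using assms(1) by (auto intro!: sum.cong)
  then show ?thesis using assms by (simp add: sum_bl_delta)
qed

lemma drop_split: "n \<le> l \<Longrightarrow> l \<le> length x \<Longrightarrow> drop n x = drop n (take l x) @ drop l x"
  using drop_append[of n "take l x" "drop l x"] by simp

lemma cmat_Swap_seq:
  assumes "length x = n" "length x' = n'"
  shows "cmat (Swap n n' ;; t) (x @ x') y = cmat t (x' @ x) y"
  using assms by (subst cmat_functional_seq) simp_all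

theorem cmat_sound:
  assumes "peq gen_arity rels_spAffcb2 n m s t" "length x = n" "length y = m"
  shows "cmat s x y = cmat t x y"
  using assms
proof (induction arbitrary: x y rule: peq.induct)
  case (peq_seq n m s s' k t t')
  have "tcd s = m" "tcd s' = m"
    using peq_typed[OF peq_seq.hyps(1)] by (simp_all add: typed_iff)
  then show ?case using peq_seq by (auto intro!: sum.cong)
next
  case (peq_ten n m s s' n' m' t t')
  have "tdm s = n" "tdm s' = n" "tcd s = m" "tcd s' = m"
    using peq_typed[OF peq_ten.hyps(1)] by (simp_all add: typed_iff)
  then show ?case using peq_ten by simp
next
  case (peq_rel s t n m)
  then show ?case using cmat_rels by (simp add: typed_iff)
next
  case (seq_id_left s n m)
  then show ?case by (subst cmat_functional_seq) simp_all
next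
  case (seq_id_right s n m)
  have "(\<Sum>z\<in>bl m. cmat s x z * of_bool (length z = m \<and> y = z)) = (\<Sum>z\<in>bl m. cmat s x z * of_bool (z = y))"
    by (intro sum.cong) auto
  then show ?case using seq_id_right by (simp add: typed_iff sum_bl_delta)
next
  case (seq_assoc s n m t k r l)
  then show ?case using cmat_seq_assoc by blast
next
  case (ten_id n m)
  then show ?case by (auto simp: append_eq_conv_conj) (metis append_take_drop_id)+
next
  case (ten_seq s n m t k s' n' m' t' k')
  then show ?case by (intro cmat_ten_seq) (simp_all add: typed_iff)
next
  case (ten_assoc s n m t n' m' r n'' m'')
  then show ?case by (simp add: typed_iff take_drop drop_drop add.commute mult.assoc)
next
  case (swap_natural s n m t n' m')
  obtain x1 x2 where x: "x = x1 @ x2" "length x1 = n" "length x2 = n'"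
    using swap_natural.prems(1) by (intro that[of "take n x" "drop n x"]) simp_all
  obtain y1 y2 where y: "y = y1 @ y2" "length y1 = m'" "length y2 = m"
    using swap_natural.prems(2) by (intro that[of "take m' y" "drop m' y"]) simp_all
  have ty: "tdm s = n" "tcd s = m" "tdm t = n'" "tcd t = m'" using swap_natural.hyps by (simp_all add: typed_iff)
  have "cmat ((s \<oslash> t) ;; Swap m m') x y = cmat (s \<oslash> t) x (y2 @ y1)"
    unfolding y using y ty by (intro cmat_seq_Swap) simp_all
  also have "\<dots> = cmat (t \<oslash> s) (x2 @ x1) y"
    using x y ty by simp
  also have "\<dots> = cmat (Swap n n' ;; (t \<oslash> s)) x y"
    unfolding x using x by (intro cmat_Swap_seq[symmetric])
  finally show ?case .
next
  case (swap_swap n m)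
  then show ?case by (intro cmat_functional_eq) auto
next
  case (swap_hexagon n m k)
  then show ?case
    by (intro cmat_functional_eq) (auto simp: take_drop drop_drop add_ac intro: drop_split)
qed (simp_all add: typed_iff)

text \<open>Soundness speaks of well-typed terms and lists of matching lengths. For other lengths
  well-typed terms count nothing, and ill-typed terms are sent to 0, so the function respects
  \<open>eqv\<close> on all terms.\<close>

lift_definition M :: "mor \<Rightarrow> bit list \<Rightarrow> bit list \<Rightarrow> nat" is
  "\<lambda>t x y. if twf t then cmat t x y else 0"
proof (intro ext)
  fix s t :: "gen pterm" and x y assume st: "eqv s t"
  show "(if twf s then cmat s x y else 0) = (if twf t then cmat t x y else 0)"
  proof (cases "twf s \<and> length x = tdm s \<and> length y = tcd s")
    case True
    then show ?thesis using st cmat_sound[of "tdm s" "tcd s" s t x y] unfolding eqv_def by metis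
  next
    case False
    then show ?thesis using st cmat_support[of s x y] cmat_support[of t x y] by (auto simp: eqv_def)
  qed
qed

lemma M_support: "length x \<noteq> dom f \<or> length y \<noteq> cod f \<Longrightarrow> M f x y = 0"
  by transfer (auto dest: cmat_support)

lemma M_seq: "wf (f >>> g) \<Longrightarrow> M (f >>> g) x y = (\<Sum>z\<in>bl (cod f). M f x z * M g z y)"
  by transfer auto

lemma M_ten: "wf f \<Longrightarrow> wf g \<Longrightarrow> M (f *** g) x y =
    M f (take (dom f) x) (take (cod f) y) * M g (drop (dom f) x) (drop (cod f) y)"
  by transfer auto

lemma M_idm: "M (idm n) x y = of_bool (length x = n \<and> y = x)"
  by transfer auto

lemma M_gn: "M (gn g) x y = of_bool (length x = fst (gen_arity g) \<and> length y = snd (gen_arity g) \<and> gsem g x y)"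
  by transfer auto

lemma M_sw: "M (sw n m) x y = of_bool (length x = n + m \<and> y = drop n x @ take n x)"
  by transfer auto

lemma M_seq_fun:
  assumes "wf (f >>> g)" "length x = dom f"
    "length (\<phi> x) = cod f" "\<And>y. M f x y = of_bool (y = \<phi> x)"
  shows "M (f >>> g) x y = M g (\<phi> x) y"
  using assms by (simp add: M_seq sum_bl_delta)

lemma M_step: "M (step r) [a, b] y = of_bool (y = [b, a + r * b])"
proof -
  have "M sx [a, b] y = of_bool (y = [b, a])" for y by (simp add: M_sw take_Cons' drop_Cons')
  moreover from this have "M (sx >>> cx) [a, b] y = M cx [b, a] y"
    by (intro M_seq_fun) simp_all
  ultimately show ?thesis by (cases "r = 0") (auto simp: step_def M_gn add.commute)
qed

lemma M_pass: "length x = length as \<Longrightarrow>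
    M (pass as) (a # x) y = of_bool (y = x @ [a + sum_list (map2 (*) as x)])"
proof (induction as arbitrary: a x y)
  case Nil
  then show ?case by (auto simp: M_idm)
next
  case (Cons r as)
  then obtain b z where x: "x = b # z" "length z = length as" by (cases x) auto
  have "M (pass (r # as)) (a # x) y = M (idm 1 *** pass as) (b # (a + r * b) # z) y"
    unfolding pass.simps
  proof (rule M_seq_fun[where \<phi> = "\<lambda>_. b # (a + r * b) # z"])
    fix y
    have "take 2 (a # x) = [a, b]" "drop 2 (a # x) = z" by (simp_all add: x)
    moreover have "y = b # (a + r * b) # z \<longleftrightarrow> take 2 y = [b, a + r * b] \<and> drop 2 y = z"
      using eq_append_iff[of "[b, a + r * b]" 2 y z] by simp
    ultimately show "M (step r *** idm (length as)) (a # x) y = of_bool (y = b # (a + r * b) # z)"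
      using x by (auto simp: M_ten M_step M_idm)
  qed (use x in simp_all)
  also have "\<dots> = of_bool (take 1 y = [b] \<and> drop 1 y = z @ [a + r * b + sum_list (map2 (*) as z)])"
    using x Cons.IH[of z "a + r * b" "drop 1 y"] by (auto simp: M_ten M_idm One_nat_def)
  also have "take 1 y = [b] \<and> drop 1 y = z @ [a + r * b + sum_list (map2 (*) as z)] \<longleftrightarrow>
      y = x @ [a + sum_list (map2 (*) (r # as) x)]"
    using eq_append_iff[of "[b]" 1 y "z @ [a + r * b + sum_list (map2 (*) as z)]"]
    by (simp add: x add.assoc)
  finally show ?case .
qed

lemma M_ub: "M (ub b) [] y = of_bool (y = [b])"
proof (cases "b = 0")
  case False
  have "M (iu >>> nx) [] y = M nx [0] y"
    by (rule M_seq_fun[where \<phi> = "\<lambda>_. [0]"]) (auto simp: M_gn)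
  then show ?thesis using False by (auto simp: ub_def M_gn)
qed (auto simp: ub_def M_gn)

lemma M_chk:
  assumes "length x = length as"
  shows "M (chk b as) x y = of_bool (y = x \<and> ev (b, as) x = 0)"
proof -
  let ?n = "length as" and ?e = "ev (b, as) x"
  have "M (chk b as) x y = M (pass as >>> (idm ?n *** pu)) (b # x) y"
    unfolding chk_def
  proof (rule M_seq_fun[where \<phi> = "\<lambda>_. b # x"])
    fix y
    show "M (ub b *** idm ?n) x y = of_bool (y = b # x)"
      using eq_append_iff[of "[b]" 1 y x] assms by (auto simp: M_ten M_ub M_idm)
  qed (use assms in simp_all)
  also have "\<dots> = M (idm ?n *** pu) (x @ [?e]) y"
  proof (rule M_seq_fun[where \<phi> = "\<lambda>_. x @ [?e]"])
    fix y
    show "M (pass as) (b # x) y = of_bool (y = x @ [?e])"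
      using assms by (simp add: M_pass ev_def)
  qed (use assms in simp_all)
  also have "\<dots> = of_bool (y = x \<and> ?e = 0)"
  proof -
    have "take ?n y = x \<and> drop ?n y = [] \<longleftrightarrow> y = x"
      using eq_append_iff[of x ?n y "[]"] assms by auto
    then show ?thesis using assms by (auto simp: M_ten M_idm M_gn)
  qed
  finally show ?thesis .
qed

lemma M_chks:
  assumes "valid n L" "length x = n"
  shows "M (chks n L) x y = of_bool (y = x \<and> x \<in> sol n L)"
  using assms(1)
proof (induction L arbitrary: y)
  case Nil
  then show ?case using assms by (auto simp: M_idm sol_def)
next
  case (Cons c L)
  have "M (chks n (c # L)) x y = (\<Sum>z\<in>bl n. of_bool (z = x) * (of_bool (ev c x = 0) * M (chks n L) z y))"
    using Cons.prems assms(2) by (auto simp: M_seq M_chk intro!: sum.cong)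
  also have "\<dots> = of_bool (ev c x = 0) * M (chks n L) x y"
    using assms(2) by (simp add: sum_bl_delta)
  finally show ?case using Cons by (auto simp: sol_Cons)
qed

lemma M_pw_ce: "length y = n \<Longrightarrow> M (pw n ce) [] y = 1"
proof (induction n arbitrary: y)
  case (Suc n)
  then show ?case by (simp add: M_ten M_gn)
qed (simp add: M_idm)

lemma card_bl_1: "card (bl 1) = 2"
  using sum_bl_12(1)[of "\<lambda>_. 1 :: nat"] by simp

lemma M_loops: "M (pw k (ce >>> de)) [] [] = 2 ^ k"
  by (induction k) (simp_all add: M_idm M_ten M_seq M_gn card_bl_1)

lemma M_nf: "valid n L \<Longrightarrow> M (nf k n L) [] y = 2 ^ k * of_bool (y \<in> sol n L)"
proof -
  assume L: "valid n L"
  have "M (pw n ce >>> chks n L) [] y = (\<Sum>z\<in>bl n. M (pw n ce) [] z * M (chks n L) z y)"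
    using L by (simp add: M_seq)
  also have "\<dots> = (\<Sum>z\<in>bl n. of_bool (z = y) * of_bool (z \<in> sol n L))"
    using L by (intro sum.cong) (auto simp: M_pw_ce M_chks)
  also have "\<dots> = of_bool (length y = n) * of_bool (y \<in> sol n L)" by (rule sum_bl_delta)
  also have "\<dots> = of_bool (y \<in> sol n L)" by (simp add: sol_def)
  finally show ?thesis using L by (simp add: nf_def M_ten M_loops)
qed

theorem M_complete:
  assumes "wf f" "wf g" "dom f = dom g" "cod f = cod g" "M f = M g"
  shows "f = g"
proof -
  let ?n = "dom f + cod f"
  have wfb: "wf (bend f)" "wf (bend g)" using assms by (simp_all add: bend_def)
  have "M (bend f) = M (bend g)"
    using assms wfb by (intro ext) (simp add: bend_def M_seq M_ten)
  moreover obtain k L where L: "valid ?n L" "bend f = nf k ?n L"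
    using state_is_nf[OF wfb(1)] by (auto simp: bend_def is_nf_def)
  moreover obtain l N where N: "valid ?n N" "bend g = nf l ?n N"
    using state_is_nf[OF wfb(2)] assms by (auto simp: bend_def is_nf_def)
  ultimately have eq: "2 ^ k * of_bool (y \<in> sol ?n L) = (2 ^ l * of_bool (y \<in> sol ?n N) :: nat)" for y
    using M_nf[of ?n L k y] M_nf[of ?n N l y] by simp
  \<comment> \<open>A power of two is never 0, so the supports of the two counting functions are the
    two solution sets.\<close>
  have sol: "sol ?n L = sol ?n N"
  proof -
    have "y \<in> sol ?n L \<longleftrightarrow> y \<in> sol ?n N" for y
      using eq[of y] by (cases "y \<in> sol ?n L"; cases "y \<in> sol ?n N") auto
    then show ?thesis by blast
  qed
  have "bend f = bend g"
  proof (cases "sol ?n L = {}")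
    \<comment> \<open>Here the exponents cannot be compared, and need not be: the normal form of a
      contradictory system does not depend on them.\<close>
    case True
    then show ?thesis using L N sol by (simp add: nf_empty)
  next
    case False
    then obtain y where "y \<in> sol ?n L" by blast
    then have "(2 :: nat) ^ k = 2 ^ l" using eq[of y] sol by simp
    then have "k = l" by simp
    then show ?thesis using L N sol False nf_eqI[of ?n L N k] by simp
  qed
  then show ?thesis using bend_inj assms by blast
qed


section \<open>Spans and their counting functions\<close>

lemma pts_F2 [simp]: "pts (F2 n) = carrier_vec n" "amb (F2 n) = n"
  by (simp_all add: F2_def)

lemma pts_carrier: "is_aff_space X \<Longrightarrow> x \<in> pts X \<Longrightarrow> x \<in> carrier_vec (amb X)"
  by (auto simp: is_aff_space_def)

lemma affine_map_pts: "affine_map X Y f \<Longrightarrow> x \<in> pts X \<Longrightarrow> f x \<in> pts Y"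
  by (simp add: affine_map_def)

lemma pr_append:
  "dim_vec x = amb X \<Longrightarrow> pr1 X Y (x @\<^sub>v y) = x"
  "dim_vec y = amb Y \<Longrightarrow> pr2 X Y (x @\<^sub>v y) = y"
  by (auto simp: pr1_def pr2_def vec_first_def vec_last_def)

lemma affine_map_comp:
  assumes "is_aff_space X" "is_aff_space Y" "is_aff_space W" "affine_map X Y f" "affine_map Y W g"
  shows "affine_map X W (g \<circ> f)"
  using assms by (simp add: affine_map_iff)

lemma pullback_pts: "pts (pullback X Y f g) = {x @\<^sub>v y | x y. x \<in> pts X \<and> y \<in> pts Y \<and> f x = g y}"
  "amb (pullback X Y f g) = amb X + amb Y"
  by (simp_all add: pullback_def)

lemma append_three:
  assumes "x \<in> carrier_vec n" "x' \<in> carrier_vec n" "x'' \<in> carrier_vec n"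
    "y \<in> carrier_vec m" "y' \<in> carrier_vec m" "y'' \<in> carrier_vec m"
  shows "(x @\<^sub>v y) + (x' @\<^sub>v y') + (x'' @\<^sub>v y'') = ((x :: bit vec) + x' + x'') @\<^sub>v (y + y' + y'')"
  using assms append_vec_add[of x n x' y m y'] append_vec_add[of "x + x'" n x'' "y + y'" m y''] by simp

context
  fixes X Y W :: aff_space and f g
  assumes aff: "is_aff_space X" "is_aff_space Y" "is_aff_space W" "affine_map X W f" "affine_map Y W g"
begin

lemma is_aff_space_pullback: "is_aff_space (pullback X Y f g)"
  unfolding is_aff_space_iff
proof (intro conjI ballI)
  show "pts (pullback X Y f g) \<subseteq> carrier_vec (amb (pullback X Y f g))"
    using aff(1,2) by (auto simp: pullback_pts dest!: pts_carrier)
  fix u v w assume "u \<in> pts (pullback X Y f g)" "v \<in> pts (pullback X Y f g)" "w \<in> pts (pullback X Y f g)"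
  then obtain x y x' y' x'' y'' where uvw: "u = x @\<^sub>v y" "v = x' @\<^sub>v y'" "w = x'' @\<^sub>v y''"
    and x: "x \<in> pts X" "x' \<in> pts X" "x'' \<in> pts X" and y: "y \<in> pts Y" "y' \<in> pts Y" "y'' \<in> pts Y"
    and eq: "f x = g y" "f x' = g y'" "f x'' = g y''"
    by (auto simp: pullback_pts)
  have "u + v + w = (x + x' + x'') @\<^sub>v (y + y' + y'')"
    unfolding uvw using x y aff(1,2) by (intro append_three) (auto intro: pts_carrier)
  moreover have "x + x' + x'' \<in> pts X" "y + y' + y'' \<in> pts Y"
    using aff(1,2) x y by (auto simp: is_aff_space_iff)
  moreover have "f (x + x' + x'') = g (y + y' + y'')"
    using aff x y eq by (simp add: affine_map_iff)
  ultimately show "u + v + w \<in> pts (pullback X Y f g)" by (auto simp: pullback_pts)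
qed

lemma affine_map_pr:
  "affine_map (pullback X Y f g) X (pr1 X Y)" "affine_map (pullback X Y f g) Y (pr2 X Y)"
proof -
  note affs = affine_map_iff[OF is_aff_space_pullback aff(1)] affine_map_iff[OF is_aff_space_pullback aff(2)]
  have X: "dim_vec x = amb X" if "x \<in> pts X" for x using that aff(1) by (auto dest!: pts_carrier)
  have Y: "dim_vec x = amb Y" if "x \<in> pts Y" for x using that aff(2) by (auto dest!: pts_carrier)
  have *: "pr1 X Y ((x @\<^sub>v y) + (x' @\<^sub>v y') + (x'' @\<^sub>v y'')) = x + x' + x''"
    "pr2 X Y ((x @\<^sub>v y) + (x' @\<^sub>v y') + (x'' @\<^sub>v y'')) = y + y' + y''"
    if "x \<in> pts X" "x' \<in> pts X" "x'' \<in> pts X" "y \<in> pts Y" "y' \<in> pts Y" "y'' \<in> pts Y" for x x' x'' y y' y''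
  proof -
    have "(x @\<^sub>v y) + (x' @\<^sub>v y') + (x'' @\<^sub>v y'') = (x + x' + x'') @\<^sub>v (y + y' + y'')"
      using that aff(1,2) by (intro append_three) (auto intro: pts_carrier)
    then show "pr1 X Y ((x @\<^sub>v y) + (x' @\<^sub>v y') + (x'' @\<^sub>v y'')) = x + x' + x''"
      "pr2 X Y ((x @\<^sub>v y) + (x' @\<^sub>v y') + (x'' @\<^sub>v y'')) = y + y' + y''"
      using that X Y by (simp_all add: pr_append)
  qed
  show "affine_map (pullback X Y f g) X (pr1 X Y)" "affine_map (pullback X Y f g) Y (pr2 X Y)"
    unfolding affs by (auto simp: pullback_pts pr_append X Y *)
qed

end

text \<open>Seen as a pullback over the one-point space, the product inherits its structure and its
  affine projections from the results on pullbacks.\<close>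

lemma aff_prod_pullback: "aff_prod X Y = pullback X Y (\<lambda>_. vNil) (\<lambda>_. vNil)"
  by (simp add: aff_prod_def pullback_def)

lemma affine_map_const: "is_aff_space X \<Longrightarrow> affine_map X (F2 0) (\<lambda>_. vNil)"
  by (simp add: affine_map_iff)

lemma is_aff_space_prod: "is_aff_space X \<Longrightarrow> is_aff_space Y \<Longrightarrow> is_aff_space (aff_prod X Y)"
  unfolding aff_prod_pullback by (rule is_aff_space_pullback[of _ _ "F2 0"]) (simp_all add: affine_map_const)

lemma affine_map_pr_prod:
  assumes "is_aff_space X" "is_aff_space Y"
  shows "affine_map (aff_prod X Y) X (pr1 X Y)" "affine_map (aff_prod X Y) Y (pr2 X Y)"
  unfolding aff_prod_pullback using assms
  by (auto intro!: affine_map_pr[of _ _ "F2 0"] affine_map_const)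

lemma affine_map_pair:
  assumes "is_aff_space W" "is_aff_space X" "is_aff_space Y" "affine_map W X p" "affine_map W Y q"
  shows "affine_map W (aff_prod X Y) (\<lambda>w. p w @\<^sub>v q w)"
  unfolding affine_map_iff[OF assms(1) is_aff_space_prod[OF assms(2,3)]]
proof (intro conjI ballI)
  fix x assume x: "x \<in> pts W"
  then have px: "p x \<in> pts X" "q x \<in> pts Y" using assms by (auto intro: affine_map_pts)
  then show "p x @\<^sub>v q x \<in> pts (aff_prod X Y)" by (auto simp: aff_prod_def)
  fix y z assume y: "y \<in> pts W" and z: "z \<in> pts W"
  then have "p y \<in> pts X" "p z \<in> pts X" "q y \<in> pts Y" "q z \<in> pts Y"
    using assms by (auto intro: affine_map_pts)
  then have "(p x @\<^sub>v q x) + (p y @\<^sub>v q y) + (p z @\<^sub>v q z) = (p x + p y + p z) @\<^sub>v (q x + q y + q z)"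
    using px assms(2,3) by (intro append_three) (auto intro: pts_carrier)
  moreover have "p (x + y + z) = p x + p y + p z" "q (x + y + z) = q x + q y + q z"
    using assms x y z by (simp_all add: affine_map_iff)
  ultimately show "p (x + y + z) @\<^sub>v q (x + y + z) = (p x @\<^sub>v q x) + (p y @\<^sub>v q y) + (p z @\<^sub>v q z)"
    by simp
qed

lemma F2_prod: "aff_prod (F2 n) (F2 m) = F2 (n + m)"
proof -
  have "{x @\<^sub>v y | x y. x \<in> carrier_vec n \<and> y \<in> carrier_vec m} = (carrier_vec (n + m) :: bit vec set)"
  proof -
    have "v \<in> {x @\<^sub>v y | x y. x \<in> carrier_vec n \<and> y \<in> carrier_vec m}" if "v \<in> carrier_vec (n + m)" for v :: "bit vec"
      using vec_first_last_append[OF that] vec_first_carrier vec_last_carrier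
      by (metis (mono_tags, lifting) mem_Collect_eq)
    then show ?thesis by auto
  qed
  then show ?thesis by (simp add: aff_prod_def F2_def)
qed

lemma is_span_comp:
  assumes s: "is_span s" and t: "is_span t" and eq: "tgt s = src t"
  shows "is_span (span_comp s t)"
proof -
  let ?P = "pullback (apex s) (apex t) (rleg s) (lleg t)"
  note A = s[unfolded is_span_def] t[unfolded is_span_def]
  have P: "is_aff_space ?P"
    using A eq by (intro is_aff_space_pullback[of _ _ "tgt s"]) auto
  have "affine_map ?P (apex s) (pr1 (apex s) (apex t))" "affine_map ?P (apex t) (pr2 (apex s) (apex t))"
    using A eq by (auto intro!: affine_map_pr[of _ _ "tgt s"])
  then show ?thesis using A P
    by (auto simp: is_span_def span_comp_def intro: affine_map_comp)
qed

lemma is_span_tens: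
  assumes s: "is_span s" and t: "is_span t"
  shows "is_span (span_tens s t)"
proof -
  note A = s[unfolded is_span_def] t[unfolded is_span_def]
  let ?P = "aff_prod (apex s) (apex t)"
  have P: "is_aff_space ?P" using A by (simp add: is_aff_space_prod)
  have pr: "affine_map ?P (apex s) (pr1 (apex s) (apex t))" "affine_map ?P (apex t) (pr2 (apex s) (apex t))"
    using A by (auto intro: affine_map_pr_prod)
  have "affine_map ?P X (\<lambda>v. p (pr1 (apex s) (apex t) v))" if "affine_map (apex s) X p" "is_aff_space X" for X p
    using affine_map_comp[OF P _ _ pr(1) that(1)] A that by (simp add: o_def)
  moreover have "affine_map ?P X (\<lambda>v. p (pr2 (apex s) (apex t) v))" if "affine_map (apex t) X p" "is_aff_space X" for X p
    using affine_map_comp[OF P _ _ pr(2) that(1)] A that by (simp add: o_def)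
  ultimately show ?thesis using A P
    by (auto simp: is_span_def span_tens_def intro!: affine_map_pair is_aff_space_prod)
qed

lemma is_span_graph:
  "is_aff_space X \<Longrightarrow> is_aff_space Y \<Longrightarrow> affine_map X Y f \<Longrightarrow> is_span (graph_span X Y f)"
  by (simp add: is_span_def graph_span_def affine_map_iff)

lemma is_span_dagger: "is_span s \<Longrightarrow> is_span (span_dagger s)"
  by (simp add: is_span_def span_dagger_def)

text \<open>Indexed by lists rather than vectors, so that it can be compared with
  \<open>cmat\<close> directly.\<close>

definition cnt :: "span \<Rightarrow> bit list \<Rightarrow> bit list \<Rightarrow> nat" where
  "cnt s x y = card {a \<in> pts (apex s). list_of_vec (lleg s a) = x \<and> list_of_vec (rleg s a) = y}"

text \<open>The part of the pullback over \<open>x\<close> and \<open>y\<close> is the disjoint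
  union, over the points of the middle foot, of products of fibres. This is where composition
  becomes matrix multiplication.\<close>

lemma cnt_comp:
  assumes s: "is_span s" and t: "is_span t" and eq: "tgt s = F2 m" "src t = F2 m"
  shows "cnt (span_comp s t) x y = (\<Sum>z\<in>bl m. cnt s x z * cnt t z y)"
proof -
  note A = s[unfolded is_span_def] t[unfolded is_span_def]
  let ?A = "pts (apex s)" and ?B = "pts (apex t)"
  let ?S = "\<lambda>z. {a \<in> ?A. list_of_vec (lleg s a) = x \<and> list_of_vec (rleg s a) = z}"
  let ?T = "\<lambda>z. {b \<in> ?B. list_of_vec (lleg t b) = z \<and> list_of_vec (rleg t b) = y}"
  have dim: "dim_vec a = amb (apex s)" "dim_vec (rleg s a) = m" if "a \<in> ?A" for a
    using that A eq affine_map_pts[of "apex s" "tgt s" "rleg s" a] by (auto dest!: pts_carrier)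
  have dim': "dim_vec b = amb (apex t)" if "b \<in> ?B" for b
    using that A by (auto dest!: pts_carrier)
  have lv: "list_of_vec v = list_of_vec w \<longleftrightarrow> v = w" for v w :: "bit vec"
    by (metis vec_list)
  have "cnt (span_comp s t) x y = card ((\<lambda>(a, b). a @\<^sub>v b) ` (\<Union>z\<in>bl m. ?S z \<times> ?T z))"
    unfolding cnt_def
  proof (rule arg_cong[of _ _ card], rule equalityI; rule subsetI)
    fix v assume "v \<in> {a \<in> pts (apex (span_comp s t)).
      list_of_vec (lleg (span_comp s t) a) = x \<and> list_of_vec (rleg (span_comp s t) a) = y}"
    then obtain a b where "v = a @\<^sub>v b" "a \<in> ?A" "b \<in> ?B" "rleg s a = lleg t b"
      "list_of_vec (lleg s a) = x" "list_of_vec (rleg t b) = y"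
      by (auto simp: span_comp_def pullback_pts pr_append dim dim')
    then show "v \<in> (\<lambda>(a, b). a @\<^sub>v b) ` (\<Union>z\<in>bl m. ?S z \<times> ?T z)"
      using dim(2)[of a] by (intro image_eqI[of _ _ "(a, b)"]) auto
  next
    fix v assume "v \<in> (\<lambda>(a, b). a @\<^sub>v b) ` (\<Union>z\<in>bl m. ?S z \<times> ?T z)"
    then obtain a b where v: "v = a @\<^sub>v b" "a \<in> ?A" "b \<in> ?B" "rleg s a = lleg t b"
      "list_of_vec (lleg s a) = x" "list_of_vec (rleg t b) = y"
      by (auto simp: lv)
    then have "v \<in> pts (apex (span_comp s t))"
      by (simp add: span_comp_def pullback_pts) blast
    then show "v \<in> {a \<in> pts (apex (span_comp s t)).
        list_of_vec (lleg (span_comp s t) a) = x \<and> list_of_vec (rleg (span_comp s t) a) = y}"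
      using v by (simp add: span_comp_def pr_append dim dim')
  qed
  also have "\<dots> = card (\<Union>z\<in>bl m. ?S z \<times> ?T z)"
  proof (rule card_image, rule inj_onI, clarsimp)
    fix a b a' b' assume "a \<in> ?A" "a' \<in> ?A" "a @\<^sub>v b = a' @\<^sub>v b'"
    then show "a = a' \<and> b = b'"
      using append_vec_eq[OF carrier_vecI carrier_vecI, of a "amb (apex s)" a' b b'] dim by simp
  qed
  also have "\<dots> = (\<Sum>z\<in>bl m. card (?S z \<times> ?T z))"
    using finite_pts A by (intro card_UN_disjoint) auto
  finally show ?thesis by (simp add: card_cartesian_product cnt_def)
qed

lemma cnt_tens:
  assumes s: "is_span s" and t: "is_span t" and eq: "src s = F2 n" "tgt s = F2 m"
  shows "cnt (span_tens s t) x y = cnt s (take n x) (take m y) * cnt t (drop n x) (drop m y)"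
proof -
  note A = s[unfolded is_span_def] t[unfolded is_span_def]
  let ?A = "pts (apex s)" and ?B = "pts (apex t)"
  let ?S = "{a \<in> ?A. list_of_vec (lleg s a) = take n x \<and> list_of_vec (rleg s a) = take m y}"
  let ?T = "{b \<in> ?B. list_of_vec (lleg t b) = drop n x \<and> list_of_vec (rleg t b) = drop m y}"
  have dim: "dim_vec a = amb (apex s)" "dim_vec (rleg s a) = m" "dim_vec (lleg s a) = n" if "a \<in> ?A" for a
    using that A eq affine_map_pts[of "apex s" "tgt s" "rleg s" a] affine_map_pts[of "apex s" "src s" "lleg s" a]
    by (auto dest!: pts_carrier)
  have dim': "dim_vec b = amb (apex t)" if "b \<in> ?B" for b
    using that A by (auto dest!: pts_carrier)
  have sp: "list_of_vec v @ w = x \<longleftrightarrow> list_of_vec v = take n x \<and> w = drop n x" if "dim_vec v = n" for v :: "bit vec" and w x n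
    using eq_append_iff[of "list_of_vec v" n x w] that by auto
  have "cnt (span_tens s t) x y = card ((\<lambda>(a, b). a @\<^sub>v b) ` (?S \<times> ?T))"
    unfolding cnt_def
  proof (rule arg_cong[of _ _ card], rule equalityI; rule subsetI)
    fix v assume "v \<in> {a \<in> pts (apex (span_tens s t)).
      list_of_vec (lleg (span_tens s t) a) = x \<and> list_of_vec (rleg (span_tens s t) a) = y}"
    then obtain a b where "v = a @\<^sub>v b" "a \<in> ?A" "b \<in> ?B"
      "list_of_vec (lleg s a) @ list_of_vec (lleg t b) = x" "list_of_vec (rleg s a) @ list_of_vec (rleg t b) = y"
      by (auto simp: span_tens_def aff_prod_def pr_append dim dim')
    then show "v \<in> (\<lambda>(a, b). a @\<^sub>v b) ` (?S \<times> ?T)"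
      using dim(2,3)[of a] by (intro image_eqI[of _ _ "(a, b)"]) (auto simp: sp)
  qed (auto simp: span_tens_def aff_prod_def pr_append dim dim')
  also have "\<dots> = card (?S \<times> ?T)"
  proof (rule card_image, rule inj_onI, clarsimp)
    fix a b a' b' assume "a \<in> ?A" "a' \<in> ?A" "a @\<^sub>v b = a' @\<^sub>v b'"
    then show "a = a' \<and> b = b'"
      using append_vec_eq[OF carrier_vecI carrier_vecI, of a "amb (apex s)" a' b b'] dim by simp
  qed
  finally show ?thesis by (simp add: card_cartesian_product cnt_def)
qed

lemma cnt_graph:
  "cnt (graph_span (F2 n) Y f) x y = of_bool (length x = n \<and> y = list_of_vec (f (vec_of_list x)))"
proof -
  have "a \<in> carrier_vec n \<and> list_of_vec a = x \<longleftrightarrow> length x = n \<and> a = vec_of_list x" for a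
    by (metis carrier_vecD carrier_vecI length_list_of_vec list_vec vec_list)
  then have "{a \<in> carrier_vec n. list_of_vec a = x \<and> list_of_vec (f a) = y} =
      (if length x = n \<and> y = list_of_vec (f (vec_of_list x)) then {vec_of_list x} else {})"
    by (auto simp: vec_list)
  then show ?thesis by (simp add: cnt_def graph_span_def)
qed

lemma cnt_dagger: "cnt (span_dagger s) x y = cnt s y x"
  by (simp add: cnt_def span_dagger_def conj_commute)

lemma affine_iso_sym: "affine_iso X Y f \<Longrightarrow> \<exists>g. affine_iso Y X g \<and> (\<forall>y\<in>pts Y. g y \<in> pts X \<and> f (g y) = y)"
proof -
  assume f: "affine_iso X Y f"
  then obtain g where "affine_map Y X g" "\<forall>x\<in>pts X. g (f x) = x" "\<forall>y\<in>pts Y. f (g y) = y"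
    by (auto simp: affine_iso_def)
  then show ?thesis using f
    by (intro exI[of _ g]) (auto simp: affine_iso_def intro: affine_map_pts)
qed

lemma affine_iso_trans:
  assumes "is_aff_space X" "is_aff_space Y" "is_aff_space W" "affine_iso X Y f" "affine_iso Y W g"
  shows "affine_iso X W (g \<circ> f)"
proof -
  obtain f' g' where "affine_map Y X f'" "\<forall>x\<in>pts X. f' (f x) = x" "\<forall>y\<in>pts Y. f (f' y) = y"
    "affine_map W Y g'" "\<forall>x\<in>pts Y. g' (g x) = x" "\<forall>y\<in>pts W. g (g' y) = y"
    using assms(4,5) unfolding affine_iso_def by blast
  moreover have "affine_map X Y f" "affine_map Y W g" using assms(4,5) by (auto simp: affine_iso_def)
  ultimately show ?thesis using assms(1-3)
    unfolding affine_iso_def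
    by (intro conjI exI[of _ "f' \<circ> g'"]) (auto intro: affine_map_comp affine_map_pts dest: affine_map_pts)
qed

lemma affine_iso_bij:
  assumes "affine_iso X Y f"
  shows "bij_betw f (pts X) (pts Y)"
proof -
  obtain g where "affine_map Y X g" "\<forall>x\<in>pts X. g (f x) = x" "\<forall>y\<in>pts Y. f (g y) = y"
    using assms by (auto simp: affine_iso_def)
  then show ?thesis using assms
    by (intro bij_betw_byWitness[of _ g]) (auto simp: affine_iso_def intro: affine_map_pts)
qed

lemma cnt_eq_if_rel:
  assumes "(s, t) \<in> span_rel"
  shows "cnt s = cnt t"
proof (intro ext)
  fix x y
  obtain h where h: "affine_iso (apex s) (apex t) h"
    "\<And>a. a \<in> pts (apex s) \<Longrightarrow> lleg t (h a) = lleg s a \<and> rleg t (h a) = rleg s a"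
    using assms by (auto simp: span_rel_def)
  have b: "bij_betw h (pts (apex s)) (pts (apex t))" using affine_iso_bij h(1) by blast
  let ?S = "{a \<in> pts (apex s). list_of_vec (lleg s a) = x \<and> list_of_vec (rleg s a) = y}"
  have "{a \<in> pts (apex t). list_of_vec (lleg t a) = x \<and> list_of_vec (rleg t a) = y} = h ` ?S"
    unfolding bij_betw_imp_surj_on[OF b, symmetric] using h(2) by auto
  moreover have "inj_on h ?S" using b by (auto simp: bij_betw_def inj_on_def)
  ultimately show "cnt s x y = cnt t x y" by (simp add: cnt_def card_image)
qed


section \<open>Spans with equal counting functions are isomorphic\<close>

lemma inj_vec_of_list: "inj vec_of_list"
  by (metis injI list_vec)

lemma carrier_vec_bl: "carrier_vec n = vec_of_list ` bl n"
proof -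
  have "v \<in> vec_of_list ` bl n" if "v \<in> carrier_vec n" for v :: "bit vec"
    using that by (intro image_eqI[of _ _ "list_of_vec v"]) (simp_all add: vec_list)
  then show ?thesis by (auto intro: carrier_vecI)
qed

lemma finite_carrier_vec: "finite (carrier_vec n :: bit vec set)"
  by (simp add: carrier_vec_bl)

lemma card_carrier_vec_Suc: "card (carrier_vec (Suc n) :: bit vec set) = 2 * card (carrier_vec n :: bit vec set)"
proof -
  have "card (carrier_vec k :: bit vec set) = card (bl k)" for k
    by (simp add: carrier_vec_bl card_image inj_on_subset[OF inj_vec_of_list])
  then show ?thesis using sum_bl_Suc[of "\<lambda>_. 1 :: nat" n] by simp
qed

lemma bits_cancel: "(a::bit) + b + c + a + b = c"
  by (cases a; cases b; cases c; simp)

lemma vec_bits_cancel: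
  fixes u v w :: "bit vec"
  assumes "u \<in> carrier_vec k" "v \<in> carrier_vec k" "w \<in> carrier_vec k"
  shows "u + v + w + u + v = w"
  using assms bits_cancel by (intro eq_vecI) auto

text \<open>The translate of \<open>S\<close> by a + e stays inside \<open>T\<close> and is disjoint
  from \<open>S\<close>, so \<open>T\<close> contains two copies of \<open>S\<close>.\<close>

lemma card_affine_subspace:
  fixes S T :: "bit vec set"
  assumes T: "T \<subseteq> carrier_vec k" "\<And>u v w. u \<in> T \<Longrightarrow> v \<in> T \<Longrightarrow> w \<in> T \<Longrightarrow> u + v + w \<in> T" "finite T"
    and S: "S \<subseteq> T" "\<And>u v w. u \<in> S \<Longrightarrow> v \<in> S \<Longrightarrow> w \<in> S \<Longrightarrow> u + v + w \<in> S" "a \<in> S"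
    and e: "e \<in> T" "e \<notin> S"
  shows "2 * card S \<le> card T"
proof -
  let ?f = "\<lambda>u. u + a + e"
  have C: "u \<in> carrier_vec k" if "u \<in> T" for u using T(1) that by auto
  have ae: "a \<in> carrier_vec k" "e \<in> carrier_vec k" using C S e by auto
  have inj: "inj_on ?f S"
  proof (rule inj_onI)
    fix u v assume u: "u \<in> S" and v: "v \<in> S" and eq: "u + a + e = v + a + e"
    have "w + a + e + a + e = w" if "w \<in> carrier_vec k" for w
    proof -
      have "w + a + e + a + e = a + e + w + a + e"
        using that ae by (intro eq_vecI) (auto simp: add_ac)
      then show ?thesis using vec_bits_cancel[OF ae that] by simp
    qed
    then show "u = v" using eq u v S(1) C by (metis subsetD)
  qed
  have disj: "?f ` S \<inter> S = {}"
  proof -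
    have False if u: "u \<in> S" "u + a + e \<in> S" for u
    proof -
      have "u + a + e + u + a \<in> S" using S(2)[OF u(2) u(1) S(3)] .
      moreover have "u + a + e + u + a = e" using vec_bits_cancel[OF _ ae] u(1) S(1) C by blast
      ultimately show False using e(2) by (simp only:)
    qed
    then show ?thesis by blast
  qed
  have "?f ` S \<union> S \<subseteq> T" using S(1) T(2) S(3) e(1) by blast
  then have "card (?f ` S \<union> S) \<le> card T" using T(3) by (rule card_mono[rotated])
  moreover have "finite S" using S(1) T(3) by (rule finite_subset)
  then have "card (?f ` S \<union> S) = 2 * card S"
    using disj inj by (simp add: card_Un_disjoint card_image)
  ultimately show ?thesis by simp
qed

text \<open>Pigeonhole: the partial matching leaves \<open>x\<close> unmatched in its fibre, hence
  uses fewer points of the equinumerous fibre on the other side than there are.\<close>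

lemma fiber_partner:
  assumes "finite A" "finite B" "\<And>v. card {a \<in> A. f a = v} = card {b \<in> B. g b = v}"
    and "\<alpha> ` I \<subseteq> A" "\<beta> ` I \<subseteq> B" "inj_on \<alpha> I" "inj_on \<beta> I" "\<And>i. i \<in> I \<Longrightarrow> f (\<alpha> i) = g (\<beta> i)"
    and x: "x \<in> A" "x \<notin> \<alpha> ` I"
  shows "\<exists>y\<in>B. y \<notin> \<beta> ` I \<and> g y = f x"
proof (rule ccontr)
  assume "\<not> ?thesis"
  then have sub: "{b \<in> B. g b = f x} \<subseteq> \<beta> ` {i \<in> I. f (\<alpha> i) = f x}" using assms(8) by auto
  let ?J = "{i \<in> I. f (\<alpha> i) = f x}"
  have fin: "finite ?J"
    using assms(1,4,6) by (metis (no_types, lifting) finite_imageD finite_subset inj_on_subset mem_Collect_eq subsetI image_mono subset_trans)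
  have "card {b \<in> B. g b = f x} \<le> card ?J"
    using sub fin by (meson card_image_le card_mono finite_imageI le_trans)
  also have "\<dots> = card (\<alpha> ` ?J)"
    using assms(6) by (intro card_image[symmetric]) (auto simp: inj_on_def)
  also have "\<dots> < card {a \<in> A. f a = f x}"
  proof (rule psubset_card_mono)
    show "finite {a \<in> A. f a = f x}" using assms(1) by simp
    show "\<alpha> ` ?J \<subset> {a \<in> A. f a = f x}" using assms(4) x by auto
  qed
  finally show False using assms(3) by simp
qed

text \<open>The image properly contains an affine subspace with 2^m points, hence has at least
  2^(m+1) points, as many as the domain. A map between finite sets that loses no points is
  injective.\<close>

lemma affine_image_inj:
  assumes X: "is_aff_space X" and f: "affine_map (F2 (Suc m)) X f"
    and g: "affine_map (F2 m) X g" "inj_on g (carrier_vec m)" "g ` carrier_vec m \<subseteq> f ` carrier_vec (Suc m)"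
    and x: "x \<in> f ` carrier_vec (Suc m)" "x \<notin> g ` carrier_vec m"
  shows "inj_on f (carrier_vec (Suc m))"
proof -
  let ?T = "f ` carrier_vec (Suc m)" and ?S = "g ` carrier_vec m"
  have closed: "u + v + w \<in> h ` carrier_vec k"
    if h: "affine_map (F2 k) X h" and uvw: "u \<in> h ` carrier_vec k" "v \<in> h ` carrier_vec k" "w \<in> h ` carrier_vec k"
    for h k u v w
  proof -
    obtain a b c where abc: "a \<in> carrier_vec k" "b \<in> carrier_vec k" "c \<in> carrier_vec k"
      "u = h a" "v = h b" "w = h c" using uvw by auto
    then have "u + v + w = h (a + b + c)" using h by (simp add: affine_map_iff[OF is_aff_space_F2 X])
    then show ?thesis using abc by (intro image_eqI[of _ h "a + b + c"]) simp_all
  qed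
  have TX: "?T \<subseteq> carrier_vec (amb X)"
    using f X by (auto simp: affine_map_def intro!: pts_carrier)
  have "2 * card ?S \<le> card ?T"
  proof (rule card_affine_subspace[where k = "amb X" and a = "g (0\<^sub>v m)" and e = x])
    show "finite ?T" using finite_carrier_vec by simp
  qed (use TX closed[OF f] closed[OF g(1)] g(3) x in auto)
  then have "card (carrier_vec (Suc m) :: bit vec set) \<le> card ?T"
    using card_image[OF g(2)] by (simp add: card_carrier_vec_Suc)
  then have "card ?T = card (carrier_vec (Suc m) :: bit vec set)"
    using card_image_le[OF finite_carrier_vec, of f "Suc m"] by simp
  then show ?thesis by (rule eq_card_imp_inj_on[OF finite_carrier_vec])
qed

lemma pullbackI: "x \<in> pts X \<Longrightarrow> y \<in> pts Y \<Longrightarrow> f x = g y \<Longrightarrow> x @\<^sub>v y \<in> pts (pullback X Y f g)"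
  unfolding pullback_pts by (rule CollectI, intro exI conjI) (rule refl)

text \<open>
  Affine maps with equinumerous fibres are isomorphic over their target: a maximal partial
  isomorphism, parametrised by \<open>\<gamma>\<close>, is total.
\<close>

lemma affine_iso_over:
  assumes A: "is_aff_space A" and B: "is_aff_space B" and V: "is_aff_space V"
    and f: "affine_map A V f" and g: "affine_map B V g"
    and fib: "\<And>v. card {a \<in> pts A. f a = v} = card {b \<in> pts B. g b = v}"
  shows "\<exists>h. affine_iso A B h \<and> (\<forall>a\<in>pts A. g (h a) = f a)"
proof -
  note fin = finite_pts[OF A] finite_pts[OF B]
  \<comment> \<open>A partial isomorphism over \<open>V\<close> is an affine subspace of this
    pullback on which both projections are injective.\<close>
  define P where "P = pullback A B f g"
  have P: "is_aff_space P" unfolding P_def by (rule is_aff_space_pullback[OF A B V f g])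
  have pr: "affine_map P A (pr1 A B)" "affine_map P B (pr2 A B)"
    unfolding P_def using affine_map_pr[OF A B V f g] by auto
  have dimA: "dim_vec a = amb A" if "a \<in> pts A" for a using pts_carrier[OF A that] by auto
  have dimB: "dim_vec b = amb B" if "b \<in> pts B" for b using pts_carrier[OF B that] by auto
  have fg: "f (pr1 A B v) = g (pr2 A B v)" if "v \<in> pts P" for v
    using that dimA dimB by (auto simp: P_def pullback_pts pr_append)
  show ?thesis
  proof (cases "pts A = {}")
    case True
    have "pts B = {}"
    proof (rule ccontr)
      assume "pts B \<noteq> {}"
      then obtain b where "b \<in> pts B" by blast
      then have "{b' \<in> pts B. g b' = g b} \<noteq> {}" by blast
      then have "card {b' \<in> pts B. g b' = g b} \<noteq> 0" using fin by simp
      then show False using fib[of "g b"] True by simp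
    qed
    then have "affine_iso A B (\<lambda>x. x)"
      using True A B by (auto simp: affine_iso_def affine_map_iff)
    then show ?thesis using True by auto
  next
    case False
    \<comment> \<open>The subspace is given by a parametrisation from \<open>F2 m\<close>, so that
      it can be enlarged with \<open>inj_affine_map_extend\<close>.\<close>
    define good where "good m \<gamma> \<longleftrightarrow> affine_map (F2 m) P \<gamma> \<and>
      inj_on (pr1 A B \<circ> \<gamma>) (carrier_vec m) \<and> inj_on (pr2 A B \<circ> \<gamma>) (carrier_vec m)" for m \<gamma>
    have goodA: "affine_map (F2 m) A (pr1 A B \<circ> \<gamma>)" "affine_map (F2 m) B (pr2 A B \<circ> \<gamma>)"
      "(pr1 A B \<circ> \<gamma>) ` carrier_vec m \<subseteq> pts A" "(pr2 A B \<circ> \<gamma>) ` carrier_vec m \<subseteq> pts B"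
      "\<And>u. u \<in> carrier_vec m \<Longrightarrow> f ((pr1 A B \<circ> \<gamma>) u) = g ((pr2 A B \<circ> \<gamma>) u)" if "good m \<gamma>" for m \<gamma>
    proof -
      have \<gamma>: "affine_map (F2 m) P \<gamma>" using that by (simp add: good_def)
      show 1: "affine_map (F2 m) A (pr1 A B \<circ> \<gamma>)" "affine_map (F2 m) B (pr2 A B \<circ> \<gamma>)"
        using affine_map_comp[OF is_aff_space_F2 P A \<gamma> pr(1)] affine_map_comp[OF is_aff_space_F2 P B \<gamma> pr(2)] .
      show "(pr1 A B \<circ> \<gamma>) ` carrier_vec m \<subseteq> pts A" "(pr2 A B \<circ> \<gamma>) ` carrier_vec m \<subseteq> pts B"
        using affine_map_pts[OF 1(1)] affine_map_pts[OF 1(2)] by auto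
      fix u :: "bit vec" assume "u \<in> carrier_vec m"
      then show "f ((pr1 A B \<circ> \<gamma>) u) = g ((pr2 A B \<circ> \<gamma>) u)"
        using fg affine_map_pts[OF \<gamma>] by simp
    qed
    have "\<exists>m \<gamma>. good m \<gamma> \<and> (pr1 A B \<circ> \<gamma>) ` carrier_vec m = pts A" if "good m \<gamma>" for m \<gamma>
      using that
    proof (induction "card (pts A - (pr1 A B \<circ> \<gamma>) ` carrier_vec m)" arbitrary: m \<gamma> rule: less_induct)
      case less
      note G = goodA[OF less.prems]
      have \<gamma>: "affine_map (F2 m) P \<gamma>" and inj: "inj_on (pr1 A B \<circ> \<gamma>) (carrier_vec m)"
        "inj_on (pr2 A B \<circ> \<gamma>) (carrier_vec m)"
        using less.prems by (auto simp: good_def)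
      show ?case
      proof (cases "(pr1 A B \<circ> \<gamma>) ` carrier_vec m = pts A")
        case True
        then show ?thesis using less.prems by blast
      next
        case False
        then obtain x where x: "x \<in> pts A" "x \<notin> (pr1 A B \<circ> \<gamma>) ` carrier_vec m" using G(3) by blast
        have "\<exists>y\<in>pts B. y \<notin> (pr2 A B \<circ> \<gamma>) ` carrier_vec m \<and> g y = f x"
          by (rule fiber_partner[where f = f and \<alpha> = "pr1 A B \<circ> \<gamma>" and A = "pts A"])
            (rule fin fib G(3,4) inj x | erule G(5))+
        then obtain y where y: "y \<in> pts B" "y \<notin> (pr2 A B \<circ> \<gamma>) ` carrier_vec m" "g y = f x"
          by blast
        define e where "e = x @\<^sub>v y"
        have "e \<in> pts P" unfolding P_def e_def using x(1) y(1) y(3)[symmetric] by (rule pullbackI)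
        moreover have "pr1 A B e = x" "pr2 A B e = y"
          using x(1) y(1) dimA dimB by (simp_all add: e_def pr_append)
        ultimately have e: "e \<in> pts P" "pr1 A B e = x" "pr2 A B e = y" by blast+
        have "e \<notin> \<gamma> ` carrier_vec m" using x(2) e(2) by auto
        then obtain \<gamma>' where \<gamma>': "affine_map (F2 (Suc m)) P \<gamma>'" "inj_on \<gamma>' (carrier_vec (Suc m))"
          "insert e (\<gamma> ` carrier_vec m) \<subseteq> \<gamma>' ` carrier_vec (Suc m)"
          using inj_affine_map_extend[OF P \<gamma> inj_on_imageI2[OF inj(1)] e(1)] by blast
        have sub: "insert x ((pr1 A B \<circ> \<gamma>) ` carrier_vec m) \<subseteq> (pr1 A B \<circ> \<gamma>') ` carrier_vec (Suc m)"
          "insert y ((pr2 A B \<circ> \<gamma>) ` carrier_vec m) \<subseteq> (pr2 A B \<circ> \<gamma>') ` carrier_vec (Suc m)"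
          using image_mono[OF \<gamma>'(3), of "pr1 A B"] image_mono[OF \<gamma>'(3), of "pr2 A B"]
          by (simp_all only: image_insert e image_comp)
        \<comment> \<open>The extension is known to be injective into \<open>P\<close> only.
          Injectivity of its projections follows from the size of their images, each of which gains
          a new point, \<open>x\<close> or \<open>y\<close>.\<close>
        have "inj_on (pr1 A B \<circ> \<gamma>') (carrier_vec (Suc m))"
          using sub(1) x(2) by (intro affine_image_inj[OF A _ G(1) inj(1)])
            (auto intro: affine_map_comp[OF is_aff_space_F2 P A \<gamma>'(1) pr(1)])
        moreover have "inj_on (pr2 A B \<circ> \<gamma>') (carrier_vec (Suc m))"
          using sub(2) y(2) by (intro affine_image_inj[OF B _ G(2) inj(2)])
            (auto intro: affine_map_comp[OF is_aff_space_F2 P B \<gamma>'(1) pr(2)])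
        ultimately have good': "good (Suc m) \<gamma>'" using \<gamma>'(1) by (simp add: good_def)
        have "pts A - (pr1 A B \<circ> \<gamma>') ` carrier_vec (Suc m) \<subset> pts A - (pr1 A B \<circ> \<gamma>) ` carrier_vec m"
        proof -
          have "D - S' \<subset> D - S" if "insert x S \<subseteq> S'" "x \<in> D" "x \<notin> S" for D S S' :: "bit vec set"
            using that by blast
          then show ?thesis using sub(1) x .
        qed
        then show ?thesis using less.hyps[OF _ good'] fin(1) by (simp add: psubset_card_mono)
      qed
    qed
    moreover have "\<exists>\<gamma>. good 0 \<gamma>"
    proof -
      obtain a where a: "a \<in> pts A" using False by blast
      then have "{a' \<in> pts A. f a' = f a} \<noteq> {}" by blast
      then have "card {b \<in> pts B. g b = f a} \<noteq> 0" unfolding fib[symmetric] using fin by simp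
      then have "{b \<in> pts B. g b = f a} \<noteq> {}" by (metis card.empty)
      then obtain b where b: "b \<in> pts B" "g b = f a" by blast
      have e: "a @\<^sub>v b \<in> pts P" unfolding P_def using a b(1) b(2)[symmetric] by (rule pullbackI)
      then have "(a @\<^sub>v b) + (a @\<^sub>v b) + (a @\<^sub>v b) = a @\<^sub>v b"
        using pts_carrier[OF P e] by simp
      then have "affine_map (F2 0) P (\<lambda>_. a @\<^sub>v b)"
        using e by (simp add: affine_map_iff[OF is_aff_space_F2 P])
      moreover have "inj_on k (carrier_vec 0 :: bit vec set)" for k :: "bit vec \<Rightarrow> bit vec"
        by (auto simp: inj_on_def)
      ultimately show ?thesis unfolding good_def by blast
    qed
    ultimately obtain m \<gamma> where g0: "good m \<gamma>" "(pr1 A B \<circ> \<gamma>) ` carrier_vec m = pts A" by blast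
    note G = goodA[OF g0(1)]
    have inj: "inj_on (pr1 A B \<circ> \<gamma>) (carrier_vec m)" "inj_on (pr2 A B \<circ> \<gamma>) (carrier_vec m)"
      using g0(1) by (auto simp: good_def)
    \<comment> \<open>The pigeonhole with the two sides exchanged: a missed point of
      \<open>B\<close> would yield a missed point of \<open>A\<close>.\<close>
    have surj: "(pr2 A B \<circ> \<gamma>) ` carrier_vec m = pts B"
    proof (rule ccontr)
      assume "\<not> ?thesis"
      then obtain y where y: "y \<in> pts B" "y \<notin> (pr2 A B \<circ> \<gamma>) ` carrier_vec m" using G(4) by blast
      have "\<exists>x\<in>pts A. x \<notin> (pr1 A B \<circ> \<gamma>) ` carrier_vec m \<and> f x = g y"
        by (rule fiber_partner[where f = g and \<alpha> = "pr2 A B \<circ> \<gamma>" and A = "pts B"])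
          (rule fin fib[symmetric] G(3,4) inj y | erule G(5)[symmetric])+
      then show False unfolding g0(2) by blast
    qed
    have iso: "affine_iso (F2 m) A (pr1 A B \<circ> \<gamma>)" "affine_iso (F2 m) B (pr2 A B \<circ> \<gamma>)"
      using affine_iso_inj[OF is_aff_space_F2 A G(1)] affine_iso_inj[OF is_aff_space_F2 B G(2)]
        inj g0(2) surj by simp_all
    obtain \<alpha> where \<alpha>: "affine_iso A (F2 m) \<alpha>" "\<And>a. a \<in> pts A \<Longrightarrow> \<alpha> a \<in> carrier_vec m \<and> (pr1 A B \<circ> \<gamma>) (\<alpha> a) = a"
      using affine_iso_sym[OF iso(1)] by auto
    have "affine_iso A B ((pr2 A B \<circ> \<gamma>) \<circ> \<alpha>)"
      by (rule affine_iso_trans[OF A is_aff_space_F2 B \<alpha>(1) iso(2)])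
    moreover have "g (((pr2 A B \<circ> \<gamma>) \<circ> \<alpha>) a) = f a" if "a \<in> pts A" for a
      using G(5)[of "\<alpha> a"] \<alpha>(2)[OF that] by simp
    ultimately show ?thesis by blast
  qed
qed

text \<open>Pairing the legs turns a span into one affine map to the product of its feet, whose
  fibre sizes are the values of \<open>cnt\<close>. An isomorphism over that product respects both
  legs.\<close>

lemma span_rel_if_cnt_eq:
  assumes s: "is_span s" and t: "is_span t" and eq: "src s = src t" "tgt s = tgt t" and cnt: "cnt s = cnt t"
  shows "(s, t) \<in> span_rel"
proof -
  note S = s[unfolded is_span_def] t[unfolded is_span_def]
  let ?V = "aff_prod (src s) (tgt s)"
  let ?f = "\<lambda>a. lleg s a @\<^sub>v rleg s a" and ?g = "\<lambda>b. lleg t b @\<^sub>v rleg t b"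
  have "affine_map (apex s) ?V ?f" "affine_map (apex t) ?V ?g" "is_aff_space ?V"
    using S eq by (auto intro!: affine_map_pair is_aff_space_prod)
  moreover have dim: "dim_vec (lleg s a) = amb (src s)" if "a \<in> pts (apex s)" for a
    using S that affine_map_pts[of "apex s" "src s" "lleg s" a] by (auto dest!: pts_carrier)
  moreover have dim': "dim_vec (lleg t a) = amb (src s)" if "a \<in> pts (apex t)" for a
    using S eq that affine_map_pts[of "apex t" "src t" "lleg t" a] by (auto dest!: pts_carrier)
  have split: "v @\<^sub>v w = z \<longleftrightarrow> list_of_vec v = take k (list_of_vec z) \<and> list_of_vec w = drop k (list_of_vec z)"
    if "dim_vec v = k" for v w z :: "bit vec" and k
    using eq_append_iff[of "list_of_vec v" k "list_of_vec z" "list_of_vec w"] that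
    by (metis length_list_of_vec list_of_vec_append vec_list)
  have "card {a \<in> pts (apex s). ?f a = v} = card {b \<in> pts (apex t). ?g b = v}" for v
  proof -
    have 1: "{a \<in> pts (apex s). ?f a = v} = {a \<in> pts (apex s).
        list_of_vec (lleg s a) = take (amb (src s)) (list_of_vec v) \<and> list_of_vec (rleg s a) = drop (amb (src s)) (list_of_vec v)}"
      using split[OF dim] by blast
    have 2: "{a \<in> pts (apex t). ?g a = v} = {a \<in> pts (apex t).
        list_of_vec (lleg t a) = take (amb (src s)) (list_of_vec v) \<and> list_of_vec (rleg t a) = drop (amb (src s)) (list_of_vec v)}"
      using split[OF dim'] by blast
    show ?thesis unfolding 1 2 using cnt by (simp only: cnt_def[symmetric])
  qed
  ultimately obtain h where h: "affine_iso (apex s) (apex t) h" "\<And>a. a \<in> pts (apex s) \<Longrightarrow> ?g (h a) = ?f a"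
    using affine_iso_over[of "apex s" "apex t" ?V ?f ?g] S by blast
  have "lleg t (h a) = lleg s a \<and> rleg t (h a) = rleg s a" if a: "a \<in> pts (apex s)" for a
  proof -
    have "h a \<in> pts (apex t)" using bij_betwE[OF affine_iso_bij[OF h(1)]] a by blast
    then show ?thesis
      using h(2)[OF a] dim[OF a] dim' append_vec_eq[OF carrier_vecI carrier_vecI, of "lleg t (h a)" "amb (src s)"] by simp
  qed
  then show ?thesis using s t eq h(1) by (auto simp: span_rel_def)
qed

lemma span_rel_iff:
  "(s, t) \<in> span_rel \<longleftrightarrow> is_span s \<and> is_span t \<and> src s = src t \<and> tgt s = tgt t \<and> cnt s = cnt t"
  using span_rel_if_cnt_eq[of s t] cnt_eq_if_rel[of s t] by (auto simp: span_rel_def)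


subsection \<open>The span denoted by a term\<close>

fun span_of :: "gen pterm \<Rightarrow> span" where
  "span_of (Gen g) = gen_span g"
| "span_of (Idn n) = graph_span (F2 n) (F2 n) (\<lambda>x. x)"
| "span_of (Swap n m) = graph_span (aff_prod (F2 n) (F2 m)) (aff_prod (F2 m) (F2 n))
     (\<lambda>v. pr2 (F2 n) (F2 m) v @\<^sub>v pr1 (F2 n) (F2 m) v)"
| "span_of (s ;; t) = span_comp (span_of s) (span_of t)"
| "span_of (s \<oslash> t) = span_tens (span_of s) (span_of t)"

lemma affine_map_F2I:
  assumes "\<And>u. u \<in> carrier_vec n \<Longrightarrow> f u \<in> carrier_vec m"
    "\<And>u v w. u \<in> carrier_vec n \<Longrightarrow> v \<in> carrier_vec n \<Longrightarrow> w \<in> carrier_vec n \<Longrightarrow>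
      f (u + v + w) = f u + f v + f w"
  shows "affine_map (F2 n) (F2 m) f"
  using assms by (simp add: affine_map_iff)

lemma vCons_add: "dim_vec v = dim_vec w \<Longrightarrow> vCons a v + vCons b w = vCons (a + b) (v + w)"
  by (intro eq_vecI) (auto simp: vec_index_vCons)

lemma vNil_carrier: "v \<in> carrier_vec 0 \<longleftrightarrow> v = vNil"
  by (metis carrier_vecD carrier_vecI dim_vec_of_list length_0_conv list.size(3) vec_list vec_of_list_Nil length_list_of_vec)

lemma vNil_add: "(vNil :: bit vec) + vNil = vNil"
  by (rule eq_vecI) (simp_all add: carrier_vecD[OF vNil_carrier[THEN iffD2, OF refl]])

lemma is_span_gen: "is_span (gen_span g)"
proof -
  have U: "affine_map (F2 0) (F2 1) (\<lambda>v. vec_of_list [0])"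
    by (rule affine_map_F2I) (simp_all add: One_nat_def vCons_add vNil_carrier vNil_add)
  have E: "affine_map (F2 1) (F2 0) (\<lambda>v. vec_of_list [])"
    by (rule affine_map_F2I) (simp_all add: vNil_carrier vNil_add)
  have N: "affine_map (F2 1) (F2 1) (\<lambda>v. vec_of_list [v $ 0 + 1])"
    by (rule affine_map_F2I)
      (auto simp: One_nat_def vCons_add vNil_carrier vNil_add add_ac)
  have C: "affine_map (F2 2) (F2 2) (\<lambda>v. vec_of_list [v $ 0, v $ 0 + v $ 1])"
    by (rule affine_map_F2I)
      (auto simp: numeral_2_eq_2 One_nat_def vCons_add vNil_carrier vNil_add add_ac)
  note gr = is_span_graph[OF is_aff_space_F2 is_aff_space_F2]
  have "is_span (gen_span Z)"
    by (simp add: is_span_def affine_map_iff is_aff_space_empty)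
  then show ?thesis
    using gr[OF U] gr[OF E] gr[OF N] gr[OF C] is_span_dagger[OF gr[OF U]] is_span_dagger[OF gr[OF E]]
    by (cases g) (simp_all only: gen_span.simps)
qed

lemma src_gen: "src (gen_span g) = F2 (fst (gen_arity g))" "tgt (gen_span g) = F2 (snd (gen_arity g))"
  by (cases g; simp add: graph_span_def span_dagger_def)+

lemma cnt_gen: "cnt (gen_span g) x y = cmat (Gen g) x y"
proof (cases g)
  case Z
  then show ?thesis by (simp add: cnt_def)
qed (auto simp: cnt_graph cnt_dagger list_vec vec_of_list_index
    simp del: vec_of_list_Cons vec_of_list_Nil list_of_vec_vCons)

lemma list_of_vec_pr:
  assumes "length x = n + m"
  shows "list_of_vec (pr1 (F2 n) (F2 m) (vec_of_list x)) = take n x"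
    "list_of_vec (pr2 (F2 n) (F2 m) (vec_of_list x)) = drop n x"
  using assms by (auto intro!: nth_equalityI simp: pr1_def pr2_def vec_first_def vec_last_def vec_of_list_index)

lemma span_of_correct:
  "twf t \<Longrightarrow> is_span (span_of t) \<and> src (span_of t) = F2 (tdm t) \<and> tgt (span_of t) = F2 (tcd t) \<and>
    cnt (span_of t) = cmat t"
proof (induction t)
  case (Gen g)
  then show ?case using cnt_gen[of g] by (auto simp: is_span_gen src_gen)
next
  case (Idn n)
  have "is_span (span_of (Idn n))"
    by (auto intro!: is_span_graph simp: affine_map_iff)
  moreover have "cnt (span_of (Idn n)) = cmat (Idn n)"
    by (auto simp: cnt_graph list_vec fun_eq_iff)
  ultimately show ?case by (simp add: graph_span_def)
next
  case (Swap n m)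
  have "is_span (span_of (Swap n m))"
    by (auto intro!: is_span_graph is_aff_space_prod affine_map_pair affine_map_pr_prod)
  moreover have "cnt (span_of (Swap n m)) = cmat (Swap n m)"
    by (auto simp: F2_prod cnt_graph list_of_vec_pr fun_eq_iff)
  ultimately show ?case by (simp add: graph_span_def F2_prod)
next
  case (Seq s t)
  then have "is_span (span_of (s ;; t))" by (simp add: is_span_comp)
  moreover have "cnt (span_of (s ;; t)) = cmat (s ;; t)"
    using Seq by (intro ext) (simp add: cnt_comp[of _ _ "tcd s"])
  ultimately show ?case using Seq by (simp add: span_comp_def)
next
  case (Ten s t)
  then have "is_span (span_of (s \<oslash> t))" by (simp add: is_span_tens)
  moreover have "cnt (span_of (s \<oslash> t)) = cmat (s \<oslash> t)"
    using Ten by (intro ext) (simp add: cnt_tens[of _ _ "tdm s" "tcd s"])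
  ultimately show ?case using Ten by (simp add: span_tens_def F2_prod)
qed


subsection \<open>Every span is denoted by a term\<close>

lemma vec_of_list_add: "length x = length y \<Longrightarrow> vec_of_list (map2 (+) x y) = (vec_of_list x :: bit vec) + vec_of_list y"
  by (intro eq_vecI) (simp_all add: vec_of_list_index)

lemma map2_add_0: "length x = n \<Longrightarrow> map2 (+) (replicate n (0 :: bit)) x = x"
  by (induction x arbitrary: n) auto

lemma affine_fn_ev:
  fixes \<phi> :: "bit list \<Rightarrow> bit"
  assumes "\<And>x y z. length x = p \<Longrightarrow> length y = p \<Longrightarrow> length z = p \<Longrightarrow>
    \<phi> (map2 (+) x (map2 (+) y z)) = \<phi> x + (\<phi> y + \<phi> z)"
  shows "\<exists>c. length (snd c) = p \<and> (\<forall>x\<in>bl p. ev c x = \<phi> x)"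
  using assms
proof (induction p arbitrary: \<phi>)
  case 0
  show ?case by (rule exI[of _ "(\<phi> [], [])"]) (simp add: ev_def)
next
  case (Suc p)
  have "\<phi> (0 # map2 (+) x (map2 (+) y z)) = \<phi> (0 # x) + (\<phi> (0 # y) + \<phi> (0 # z))"
    if "length x = p" "length y = p" "length z = p" for x y z
    using Suc.prems[of "0 # x" "0 # y" "0 # z"] that by simp
  from Suc.IH[of "\<lambda>x. \<phi> (0 # x)", OF this] obtain c
    where "length (snd c) = p \<and> (\<forall>x\<in>bl p. ev c x = \<phi> (0 # x))" by blast
  then have c: "length (snd c) = p" "\<And>x. length x = p \<Longrightarrow> ev c x = \<phi> (0 # x)" by simp_all
  let ?o = "replicate p 0"
  \<comment> \<open>The slope along the new coordinate. The three-point law at (1, 0), (0, 0) and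
    (0, x) shows that it is the same at every \<open>x\<close>.\<close>
  define r where "r = \<phi> (1 # ?o) + \<phi> (0 # ?o)"
  have one: "\<phi> (1 # x) = r + \<phi> (0 # x)" if "length x = p" for x
    using Suc.prems[of "1 # ?o" "0 # ?o" "0 # x"] that by (simp add: r_def map2_add_0 add.assoc)
  have "ev (fst c, r # snd c) x = \<phi> x" if x: "length x = Suc p" for x
  proof -
    obtain b z where b: "x = b # z" "length z = p" using x by (cases x) auto
    have "ev (fst c, r # snd c) x = r * b + ev c z" by (simp add: b ev_def add_ac)
    then show ?thesis using c(2)[OF b(2)] one[OF b(2)] by (cases "b = 0") (simp_all add: b)
  qed
  then show ?case using c(1) by (intro exI[of _ "(fst c, r # snd c)"]) simp
qed

lemma affine_map_ev:
  assumes "affine_map (F2 p) (F2 N) q"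
  shows "\<exists>cs. length cs = N \<and> (\<forall>c\<in>set cs. length (snd c) = p) \<and>
    (\<forall>x\<in>bl p. list_of_vec (q (vec_of_list x)) = map (\<lambda>c. ev c x) cs)"
proof -
  have vc: "vec_of_list x \<in> carrier_vec p" if "length x = p" for x :: "bit list"
    using that by (intro carrier_vecI) simp
  have dim: "dim_vec (q (vec_of_list x)) = N" if "length x = p" for x
    using affine_map_pts[OF assms] vc[OF that] by (auto dest: carrier_vecD)
  have "\<exists>c. length (snd c) = p \<and> (\<forall>x\<in>bl p. ev c x = q (vec_of_list x) $ j)" if j: "j < N" for j
  proof (rule affine_fn_ev)
    fix x y z :: "bit list" assume l: "length x = p" "length y = p" "length z = p"
    then have "vec_of_list (map2 (+) x (map2 (+) y z)) = vec_of_list x + vec_of_list y + vec_of_list z"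
      using assoc_add_vec[OF vc[OF l(1)] vc[OF l(2)] vc[OF l(3)]]
      by (simp add: vec_of_list_add del: vec_of_list_map assoc_add_vec)
    then have "q (vec_of_list (map2 (+) x (map2 (+) y z))) = q (vec_of_list x) + q (vec_of_list y) + q (vec_of_list z)"
      using assms l vc by (simp add: affine_map_iff del: assoc_add_vec)
    then show "q (vec_of_list (map2 (+) x (map2 (+) y z))) $ j
        = q (vec_of_list x) $ j + (q (vec_of_list y) $ j + q (vec_of_list z) $ j)"
      using j dim l by (simp add: add.assoc)
  qed
  then obtain C where C: "\<And>j. j < N \<Longrightarrow> length (snd (C j)) = p"
    "\<And>j x. j < N \<Longrightarrow> length x = p \<Longrightarrow> ev (C j) x = q (vec_of_list x) $ j"
    by (metis bl_iff)
  have "list_of_vec (q (vec_of_list x)) = map (\<lambda>c. ev c x) (map C [0..<N])" if "length x = p" for x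
    using C(2) dim that by (intro nth_equalityI) auto
  then show ?thesis using C(1) by (intro exI[of _ "map C [0..<N]"]) auto
qed

text \<open>The graph of the affine map with coordinates \<open>cs\<close>, cut out by one equation per coordinate.\<close>

definition graph_eqs :: "affine_fn list \<Rightarrow> affine_fn list" where
  "graph_eqs cs = map (\<lambda>j. (fst (cs ! j), snd (cs ! j) @ map (\<lambda>i. of_bool (i = j)) [0..<length cs])) [0..<length cs]"

lemma valid_graph_eqs:
  "(\<And>c. c \<in> set cs \<Longrightarrow> length (snd c) = p) \<Longrightarrow> valid (p + length cs) (graph_eqs cs)"
  by (auto simp: valid_def graph_eqs_def)

lemma dot_unit:
  assumes "j < length w"
  shows "sum_list (map2 (*) (map (\<lambda>i. of_bool (i = j)) [0..<length w]) w) = (w ! j :: bit)"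
proof -
  have "sum_list (map2 (*) (map (\<lambda>i. of_bool (i = j)) [0..<length w]) w)
      = (\<Sum>i\<in>{0..<length w}. of_bool (i = j) * w ! i)"
    by (simp add: sum_list_sum_nth)
  also have "\<dots> = (\<Sum>i\<in>{0..<length w}. if i = j then w ! i else 0)"
    by (intro sum.cong) auto
  finally show ?thesis using assms by simp
qed

lemma sol_graph_eqs:
  assumes "\<And>c. c \<in> set cs \<Longrightarrow> length (snd c) = p" "length v = p" "length w = length cs"
  shows "v @ w \<in> sol (p + length cs) (graph_eqs cs) \<longleftrightarrow> w = map (\<lambda>c. ev c v) cs"
proof -
  have "ev (fst (cs ! j), snd (cs ! j) @ map (\<lambda>i. of_bool (i = j)) [0..<length cs]) (v @ w) = ev (cs ! j) v + w ! j"
    if "j < length cs" for j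
    using that assms dot_unit[of j w] by (simp add: ev_def add.assoc)
  then have "v @ w \<in> sol (p + length cs) (graph_eqs cs) \<longleftrightarrow> (\<forall>j<length cs. ev (cs ! j) v + w ! j = 0)"
    using assms(2,3) by (auto simp: sol_def graph_eqs_def)
  also have "\<dots> \<longleftrightarrow> (\<forall>j<length cs. w ! j = ev (cs ! j) v)"
  proof -
    have "(a :: bit) + b = 0 \<longleftrightarrow> b = a" for a b by (cases a; cases b) simp_all
    then show ?thesis by simp
  qed
  also have "\<dots> \<longleftrightarrow> w = map (\<lambda>c. ev c v) cs"
    using assms(3) by (auto simp: list_eq_iff_nth_eq)
  finally show ?thesis .
qed

lemma M_pw_de: "length y = n \<Longrightarrow> M (pw n de) y [] = 1"
proof (induction n arbitrary: y)
  case (Suc n)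
  then show ?case by (simp add: M_ten M_gn)
qed (simp add: M_idm)

text \<open>A nonempty apex is some \<open>F2 p\<close> up to isomorphism, and the span is the graph
  of its paired legs with the apex summed out: guess the apex point and the output, check the
  equations of the graph, discard the apex point and the input. Over an empty apex any term with a
  factor \<open>ez\<close> serves.\<close>

lemma span_realised:
  assumes s: "is_span s" and eq: "src s = F2 n" "tgt s = F2 m"
  shows "\<exists>f. wf f \<and> dom f = n \<and> cod f = m \<and> M f = cnt s"
proof -
  note S = s[unfolded is_span_def eq]
  have cnt0: "cnt s x y = 0" if "\<not> (length x = n \<and> length y = m)" for x y
  proof -
    have "dim_vec (lleg s a) = n \<and> dim_vec (rleg s a) = m" if "a \<in> pts (apex s)" for a
      using S that affine_map_pts[of "apex s" "F2 n" "lleg s" a] affine_map_pts[of "apex s" "F2 m" "rleg s" a]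
      by (auto dest: carrier_vecD)
    then have "{a \<in> pts (apex s). list_of_vec (lleg s a) = x \<and> list_of_vec (rleg s a) = y} = {}"
      using that by auto
    then show ?thesis unfolding cnt_def by (simp only: card.empty)
  qed
  show ?thesis
  proof (cases "pts (apex s) = {}")
    case True
    then have "cnt s x y = 0" for x y by (simp add: cnt_def)
    moreover have "M (ez *** (pw n de >>> pw m ce)) x y = 0" for x y
      by (simp add: M_ten M_gn)
    ultimately show ?thesis
      by (intro exI[of _ "ez *** (pw n de >>> pw m ce)"]) (simp add: fun_eq_iff)
  next
    case False
    then obtain p \<psi> where \<psi>: "affine_iso (F2 p) (apex s) \<psi>"
      using nonempty_aff_space_iso_F2 S by blast
    have \<psi>a: "affine_map (F2 p) (apex s) \<psi>" using \<psi> by (simp add: affine_iso_def)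
    have b: "bij_betw \<psi> (carrier_vec p) (pts (apex s))" using affine_iso_bij[OF \<psi>] by simp
    let ?l = "lleg s \<circ> \<psi>" and ?r = "rleg s \<circ> \<psi>"
    have lr: "affine_map (F2 p) (F2 n) ?l" "affine_map (F2 p) (F2 m) ?r"
      using S \<psi>a affine_map_comp is_aff_space_F2 by blast+
    then have "affine_map (F2 p) (F2 (n + m)) (\<lambda>v. ?l v @\<^sub>v ?r v)"
      using affine_map_pair[of "F2 p" "F2 n" "F2 m" ?l ?r] by (simp add: F2_prod)
    from affine_map_ev[OF this] obtain cs where cs0: "length cs = n + m" "\<forall>c\<in>set cs. length (snd c) = p"
      "\<forall>v\<in>bl p. list_of_vec (?l (vec_of_list v) @\<^sub>v ?r (vec_of_list v)) = map (\<lambda>c. ev c v) cs"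
      by blast
    have cs: "length cs = n + m" "\<And>c. c \<in> set cs \<Longrightarrow> length (snd c) = p"
      "\<And>v. length v = p \<Longrightarrow> list_of_vec (?l (vec_of_list v)) @ list_of_vec (?r (vec_of_list v)) = map (\<lambda>c. ev c v) cs"
      using cs0 by simp_all
    let ?L = "graph_eqs cs" and ?N = "p + (n + m)"
    have val: "valid ?N ?L" using valid_graph_eqs[of cs p] cs(1,2) by simp
    \<comment> \<open>The order is apex, input, output, as in the equations of the graph:
      \<open>p\<close> free wires stand before the \<open>n\<close> inputs and \<open>m\<close> free
      wires after them.\<close>
    define f1 where "f1 = pw p ce *** idm n *** pw m ce"
    define f2 where "f2 = pw p de *** pw n de *** idm m"
    have f1: "wf f1" "dom f1 = n" "cod f1 = ?N" and f2: "wf f2" "dom f2 = ?N" "cod f2 = m"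
      by (simp_all add: f1_def f2_def)
    define f where "f = f1 >>> chks ?N ?L >>> f2"
    have f: "wf f" "dom f = n" "cod f = m" using f1 f2 val by (simp_all add: f_def)
    have "M f x y = cnt s x y" for x y
    proof (cases "length x = n \<and> length y = m")
      case False
      then show ?thesis using cnt0 M_support[of x f y] f by auto
    next
      case True
      have chk: "M (chks ?N ?L >>> f2) z y = of_bool (z \<in> sol ?N ?L) * M f2 z y" if "length z = ?N" for z
      proof -
        have "M (chks ?N ?L >>> f2) z y = (\<Sum>w\<in>bl ?N. M (chks ?N ?L) z w * M f2 w y)"
          using val f2 by (simp add: M_seq)
        also have "\<dots> = (\<Sum>w\<in>bl ?N. of_bool (w = z) * (of_bool (z \<in> sol ?N ?L) * M f2 w y))"
          using val that by (intro sum.cong) (auto simp: M_chks)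
        also have "\<dots> = of_bool (length z = ?N) * (of_bool (z \<in> sol ?N ?L) * M f2 z y)"
          by (rule sum_bl_delta)
        finally show ?thesis using that by simp
      qed
      have pt: "M f1 x (v @ w) * M (chks ?N ?L >>> f2) (v @ w) y
          = of_bool (w = x @ y) * of_bool (w = map (\<lambda>c. ev c v) cs)"
        if "length v = p" "length w = n + m" for v w
      proof -
        have "M f1 x (v @ w) = of_bool (take n w = x)"
          using that True by (auto simp: f1_def M_ten M_pw_ce M_idm)
        moreover have "M f2 (v @ w) y = of_bool (drop n w = y)"
          using that True by (auto simp: f2_def M_ten M_pw_de M_idm)
        moreover have "w = x @ y \<longleftrightarrow> take n w = x \<and> drop n w = y"
          using eq_append_iff[of x n w y] True by simp
        ultimately show ?thesis
          using chk[of "v @ w"] that cs sol_graph_eqs[of cs p v w] by auto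
      qed
      have "M f x y = (\<Sum>z\<in>bl ?N. M f1 x z * M (chks ?N ?L >>> f2) z y)"
        using f f1 by (simp add: f_def M_seq)
      also have "\<dots> = (\<Sum>v\<in>bl p. \<Sum>w\<in>bl (n + m). of_bool (w = x @ y) * of_bool (w = map (\<lambda>c. ev c v) cs))"
        unfolding sum_bl_append[of _ p "n + m"] by (intro sum.cong refl pt) simp_all
      also have "\<dots> = (\<Sum>v\<in>bl p. of_bool (x @ y = map (\<lambda>c. ev c v) cs))"
        using True by (intro sum.cong refl) (subst sum_bl_delta, simp)
      also have "\<dots> = card {v \<in> bl p. x @ y = map (\<lambda>c. ev c v) cs}"
        by (simp add: Int_def)
      also have "\<dots> = card ((\<psi> \<circ> vec_of_list) ` {v \<in> bl p. x @ y = map (\<lambda>c. ev c v) cs})"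
      proof (rule card_image[symmetric])
        have "inj_on \<psi> (vec_of_list ` bl p)" using b by (simp add: bij_betw_def carrier_vec_bl)
        then have "inj_on (\<psi> \<circ> vec_of_list) (bl p)"
          by (intro comp_inj_on inj_on_subset[OF inj_vec_of_list]) simp_all
        then show "inj_on (\<psi> \<circ> vec_of_list) {v \<in> bl p. x @ y = map (\<lambda>c. ev c v) cs}"
          by (rule inj_on_subset) blast
      qed
      also have "(\<psi> \<circ> vec_of_list) ` {v \<in> bl p. x @ y = map (\<lambda>c. ev c v) cs}
          = {a \<in> pts (apex s). list_of_vec (lleg s a) = x \<and> list_of_vec (rleg s a) = y}"
      proof -
        have *: "x @ y = map (\<lambda>c. ev c v) cs \<longleftrightarrow>
            list_of_vec (lleg s (\<psi> (vec_of_list v))) = x \<and> list_of_vec (rleg s (\<psi> (vec_of_list v))) = y"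
          if v: "length v = p" for v
        proof -
          have "vec_of_list v \<in> carrier_vec p" using v by (intro carrier_vecI) simp
          then have "dim_vec (?l (vec_of_list v)) = n"
            using affine_map_pts[OF lr(1)] by (auto dest: carrier_vecD)
          then show ?thesis
            using cs(3)[OF v] True by (metis append_eq_append_conv comp_apply length_list_of_vec)
        qed
        have "pts (apex s) = (\<psi> \<circ> vec_of_list) ` bl p"
          using b by (simp add: bij_betw_def carrier_vec_bl image_comp)
        then show ?thesis using * by auto
      qed
      finally show ?thesis by (simp only: cnt_def)
    qed
    then show ?thesis using f by (intro exI[of _ f]) (simp add: fun_eq_iff)
  qed
qed


section \<open>Presented props and transport of structure\<close>

definition cls :: "('g \<Rightarrow> nat \<times> nat) \<Rightarrow> ('g pterm \<times> 'g pterm) set \<Rightarrow> 'g pterm \<Rightarrow> 'g pterm set" where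
  "cls arity R t = peq_rel arity R `` {t}"

lemma mem_cls: "t \<in> cls arity R s \<longleftrightarrow> (\<exists>n m. peq arity R n m s t)"
  by (simp add: cls_def peq_rel_def)

lemma typed_unique: "typed arity s n m \<Longrightarrow> typed arity s n' m' \<Longrightarrow> n' = n \<and> m' = m"
  by (simp add: typed_iff)

lemma mem_cls_typed: "typed arity s n m \<Longrightarrow> t \<in> cls arity R s \<longleftrightarrow> peq arity R n m s t"
  using mem_cls peq_typed typed_unique by metis

lemma cls_eq_iff: "typed arity s n m \<Longrightarrow> cls arity R s = cls arity R t \<longleftrightarrow> peq arity R n m s t"
proof
  assume s: "typed arity s n m" and eq: "cls arity R s = cls arity R t"
  have "s \<in> cls arity R t" using mem_cls_typed[OF s] peq_refl[OF s] eq by blast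
  then obtain n' m' where p: "peq arity R n' m' t s" by (auto simp: mem_cls)
  then have "n' = n \<and> m' = m" using peq_typed typed_unique s by metis
  then show "peq arity R n m s t" using p peq_sym by blast
next
  assume s: "typed arity s n m" and p: "peq arity R n m s t"
  then have t: "typed arity t n m" using peq_typed by blast
  have "r \<in> cls arity R s \<longleftrightarrow> r \<in> cls arity R t" for r
    unfolding mem_cls_typed[OF s] mem_cls_typed[OF t] using p peq_sym peq_trans by metis
  then show "cls arity R s = cls arity R t" by blast
qed

lemma presented_simps:
  "Hom (presented_prop arity R) n m = cls arity R ` {s. typed arity s n m}"
  "Ident (presented_prop arity R) n = cls arity R (Idn n)"
  "Symm (presented_prop arity R) n m = cls arity R (Swap n m)"
  by (auto simp: presented_prop_def cls_def quotient_def)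

text \<open>Composition and tensor of classes are unions over all representatives; independence of
  the representatives collapses such a union to a single class.\<close>

lemma UN_const: "A \<noteq> {} \<Longrightarrow> B \<noteq> {} \<Longrightarrow> (\<And>a b. a \<in> A \<Longrightarrow> b \<in> B \<Longrightarrow> f a b = C) \<Longrightarrow> (\<Union>a\<in>A. \<Union>b\<in>B. f a b) = C"
  by blast

lemma presented_Comp:
  assumes s: "typed arity s n m" and t: "typed arity t m k"
  shows "Comp (presented_prop arity R) (cls arity R s) (cls arity R t) = cls arity R (s ;; t)"
proof -
  have st: "typed arity (s ;; t) n k" using s t by (rule typed.intros)
  have "(\<Union>s'\<in>cls arity R s. \<Union>t'\<in>cls arity R t. cls arity R (s' ;; t')) = cls arity R (s ;; t)"
  proof (rule UN_const)
    show "cls arity R s \<noteq> {}" "cls arity R t \<noteq> {}"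
      using mem_cls_typed[OF s] mem_cls_typed[OF t] peq_refl s t by blast+
    fix s' t' assume "s' \<in> cls arity R s" "t' \<in> cls arity R t"
    then have "peq arity R n k (s ;; t) (s' ;; t')"
      unfolding mem_cls_typed[OF s] mem_cls_typed[OF t] by (rule peq_seq)
    then show "cls arity R (s' ;; t') = cls arity R (s ;; t)" using cls_eq_iff[OF st] by blast
  qed
  then show ?thesis by (simp add: presented_prop_def cls_def)
qed

lemma presented_Tens:
  assumes s: "typed arity s n m" and t: "typed arity t n' m'"
  shows "Tens (presented_prop arity R) (cls arity R s) (cls arity R t) = cls arity R (s \<oslash> t)"
proof -
  have st: "typed arity (s \<oslash> t) (n + n') (m + m')" using s t by (rule typed.intros)
  have "(\<Union>s'\<in>cls arity R s. \<Union>t'\<in>cls arity R t. cls arity R (s' \<oslash> t')) = cls arity R (s \<oslash> t)"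
  proof (rule UN_const)
    show "cls arity R s \<noteq> {}" "cls arity R t \<noteq> {}"
      using mem_cls_typed[OF s] mem_cls_typed[OF t] peq_refl s t by blast+
    fix s' t' assume "s' \<in> cls arity R s" "t' \<in> cls arity R t"
    then have "peq arity R (n + n') (m + m') (s \<oslash> t) (s' \<oslash> t')"
      unfolding mem_cls_typed[OF s] mem_cls_typed[OF t] by (rule peq_ten)
    then show "cls arity R (s' \<oslash> t') = cls arity R (s \<oslash> t)" using cls_eq_iff[OF st] by blast
  qed
  then show ?thesis by (simp add: presented_prop_def cls_def)
qed

lemma cls_eqI: "peq arity R n m s t \<Longrightarrow> cls arity R s = cls arity R t"
  using cls_eq_iff peq_typed by blast

lemma presented_homE:
  assumes "f \<in> Hom (presented_prop arity R) n m"
  obtains s where "typed arity s n m" "f = cls arity R s"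
  using assms by (auto simp: presented_simps)

lemma presented_category: "is_category (presented_prop arity R)"
  unfolding is_category_def
proof (intro conjI allI ballI)
  let ?P = "presented_prop arity R"
  note ty = typed.intros
  fix n show "Ident ?P n \<in> Hom ?P n n" by (auto simp: presented_simps intro: ty)
  fix m f assume "f \<in> Hom ?P n m"
  then obtain s where s: "typed arity s n m" "f = cls arity R s" by (rule presented_homE)
  show "Comp ?P (Ident ?P n) f = f"
    unfolding s(2) presented_simps presented_Comp[OF ty(2) s(1)] by (rule cls_eqI[OF seq_id_left[OF s(1)]])
  show "Comp ?P f (Ident ?P m) = f"
    unfolding s(2) presented_simps presented_Comp[OF s(1) ty(2)] by (rule cls_eqI[OF seq_id_right[OF s(1)]])
  fix k g assume "g \<in> Hom ?P m k"
  then obtain t where t: "typed arity t m k" "g = cls arity R t" by (rule presented_homE)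
  show "Comp ?P f g \<in> Hom ?P n k"
    unfolding s(2) t(2) presented_Comp[OF s(1) t(1)] presented_simps using ty(4)[OF s(1) t(1)] by blast
  fix l h assume "h \<in> Hom ?P k l"
  then obtain r where r: "typed arity r k l" "h = cls arity R r" by (rule presented_homE)
  show "Comp ?P (Comp ?P f g) h = Comp ?P f (Comp ?P g h)"
    unfolding s(2) t(2) r(2) presented_Comp[OF s(1) t(1)] presented_Comp[OF t(1) r(1)]
      presented_Comp[OF ty(4)[OF s(1) t(1)] r(1)] presented_Comp[OF s(1) ty(4)[OF t(1) r(1)]]
    by (rule cls_eqI[OF seq_assoc[OF s(1) t(1) r(1)]])
qed

lemma presented_monoidal: "is_strict_monoidal (presented_prop arity R)"
  unfolding is_strict_monoidal_def
proof (intro conjI allI ballI)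
  let ?P = "presented_prop arity R"
  note ty = typed.intros
  fix n m show "Tens ?P (Ident ?P n) (Ident ?P m) = Ident ?P (n + m)"
    unfolding presented_simps presented_Tens[OF ty(2) ty(2)] by (rule cls_eqI[OF ten_id])
  fix f assume "f \<in> Hom ?P n m"
  then obtain s where s: "typed arity s n m" "f = cls arity R s" by (rule presented_homE)
  show "Tens ?P (Ident ?P 0) f = f"
    unfolding s(2) presented_simps presented_Tens[OF ty(2) s(1)] by (rule cls_eqI[OF ten_unit_left[OF s(1)]])
  show "Tens ?P f (Ident ?P 0) = f"
    unfolding s(2) presented_simps presented_Tens[OF s(1) ty(2)] by (rule cls_eqI[OF ten_unit_right[OF s(1)]])
next
  let ?P = "presented_prop arity R"
  note ty = typed.intros
  fix n m n' m' f g assume "f \<in> Hom ?P n m" "g \<in> Hom ?P n' m'"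
  then obtain s t where s: "typed arity s n m" "f = cls arity R s" and t: "typed arity t n' m'" "g = cls arity R t"
    by (meson presented_homE)
  show "Tens ?P f g \<in> Hom ?P (n + n') (m + m')"
    unfolding s(2) t(2) presented_Tens[OF s(1) t(1)] presented_simps using ty(5)[OF s(1) t(1)] by blast
  fix n'' m'' h assume "h \<in> Hom ?P n'' m''"
  then obtain r where r: "typed arity r n'' m''" "h = cls arity R r" by (rule presented_homE)
  show "Tens ?P (Tens ?P f g) h = Tens ?P f (Tens ?P g h)"
    unfolding s(2) t(2) r(2) presented_Tens[OF s(1) t(1)] presented_Tens[OF t(1) r(1)]
      presented_Tens[OF ty(5)[OF s(1) t(1)] r(1)] presented_Tens[OF s(1) ty(5)[OF t(1) r(1)]]
    by (rule cls_eqI[OF ten_assoc[OF s(1) t(1) r(1)]])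
next
  let ?P = "presented_prop arity R"
  note ty = typed.intros
  fix n m k n' m' k' f g f' g'
  assume "f \<in> Hom ?P n m" "g \<in> Hom ?P m k" "f' \<in> Hom ?P n' m'" "g' \<in> Hom ?P m' k'"
  then obtain s t s' t' where s: "typed arity s n m" "f = cls arity R s" and t: "typed arity t m k" "g = cls arity R t"
    and s': "typed arity s' n' m'" "f' = cls arity R s'" and t': "typed arity t' m' k'" "g' = cls arity R t'"
    by (meson presented_homE)
  show "Tens ?P (Comp ?P f g) (Comp ?P f' g') = Comp ?P (Tens ?P f f') (Tens ?P g g')"
    unfolding s(2) t(2) s'(2) t'(2) presented_Comp[OF s(1) t(1)] presented_Comp[OF s'(1) t'(1)]
      presented_Tens[OF s(1) s'(1)] presented_Tens[OF t(1) t'(1)]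
      presented_Tens[OF ty(4)[OF s(1) t(1)] ty(4)[OF s'(1) t'(1)]]
      presented_Comp[OF ty(5)[OF s(1) s'(1)] ty(5)[OF t(1) t'(1)]]
    by (rule cls_eqI[OF ten_seq[OF s(1) t(1) s'(1) t'(1)]])
qed

lemma presented_symmetric: "is_symmetric (presented_prop arity R)"
  unfolding is_symmetric_def
proof (intro conjI allI ballI)
  let ?P = "presented_prop arity R"
  note ty = typed.intros
  fix n m show "Symm ?P n m \<in> Hom ?P (n + m) (m + n)"
    unfolding presented_simps using ty(3) by blast
  have mn: "typed arity (Swap m n) (m + n) (n + m)" by (rule ty(3))
  show "Comp ?P (Symm ?P n m) (Symm ?P m n) = Ident ?P (n + m)"
    unfolding presented_simps presented_Comp[OF ty(3) mn] by (rule cls_eqI[OF swap_swap])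
  fix k
  have 1: "typed arity (Swap n m \<oslash> Idn k) (n + m + k) (m + n + k)"
    and 2: "typed arity (Idn m \<oslash> Swap n k) (m + n + k) (m + (k + n))"
    by (simp_all add: typed_iff)
  show "Symm ?P n (m + k) = Comp ?P (Tens ?P (Symm ?P n m) (Ident ?P k)) (Tens ?P (Ident ?P m) (Symm ?P n k))"
    unfolding presented_simps presented_Tens[OF ty(3) ty(2)] presented_Tens[OF ty(2) ty(3)] presented_Comp[OF 1 2]
    by (rule cls_eqI[OF swap_hexagon])
next
  let ?P = "presented_prop arity R"
  note ty = typed.intros
  fix n m n' m' f g assume "f \<in> Hom ?P n m" "g \<in> Hom ?P n' m'"
  then obtain s t where s: "typed arity s n m" "f = cls arity R s" and t: "typed arity t n' m'" "g = cls arity R t"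
    by (meson presented_homE)
  show "Comp ?P (Tens ?P f g) (Symm ?P m m') = Comp ?P (Symm ?P n n') (Tens ?P g f)"
    unfolding s(2) t(2) presented_simps presented_Tens[OF s(1) t(1)] presented_Tens[OF t(1) s(1)]
      presented_Comp[OF ty(5)[OF s(1) t(1)] ty(3)] presented_Comp[OF ty(3) ty(5)[OF t(1) s(1)]]
    by (rule cls_eqI[OF swap_natural[OF s(1) t(1)]])
qed

theorem is_prop_presented: "is_prop (presented_prop arity R)"
  by (simp add: is_prop_def presented_category presented_monoidal presented_symmetric)

text \<open>Every morphism of \<open>Q\<close> is an image and the operations are preserved, so the
  equational axioms of a prop pass from \<open>P\<close> to \<open>Q\<close>. With \<open>P\<close>
  presented and \<open>Q\<close> made of spans, this replaces any coherence argument for iterated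
  pullbacks.\<close>

locale prop_image =
  fixes P :: "('m, 'e) prop_data_scheme" and Q :: "('l, 'd) prop_data_scheme" and F :: "'m \<Rightarrow> 'l"
  assumes is_prop_P: "is_prop P"
    and hom: "Hom Q n m = F ` Hom P n m"
    and ident: "Ident Q n = F (Ident P n)"
    and symm: "Symm Q n m = F (Symm P n m)"
    and comp: "f \<in> Hom P n m \<Longrightarrow> g \<in> Hom P m k \<Longrightarrow> Comp Q (F f) (F g) = F (Comp P f g)"
    and tens: "f \<in> Hom P n m \<Longrightarrow> g \<in> Hom P n' m' \<Longrightarrow> Tens Q (F f) (F g) = F (Tens P f g)"
begin

lemma axioms: "is_category P" "is_strict_monoidal P" "is_symmetric P"
  using is_prop_P by (simp_all add: is_prop_def)

lemma props:
  "Ident P n \<in> Hom P n n"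
  "Symm P n m \<in> Hom P (n + m) (m + n)"
  "f \<in> Hom P n m \<Longrightarrow> g \<in> Hom P m k \<Longrightarrow> Comp P f g \<in> Hom P n k"
  "f \<in> Hom P n m \<Longrightarrow> g' \<in> Hom P n' m' \<Longrightarrow> Tens P f g' \<in> Hom P (n + n') (m + m')"
proof -
  show "Ident P n \<in> Hom P n n"
    by (rule axioms(1)[unfolded is_category_def, THEN conjunct1, THEN spec])
  show "Symm P n m \<in> Hom P (n + m) (m + n)"
    by (rule axioms(3)[unfolded is_symmetric_def, THEN conjunct1, THEN spec, THEN spec])
  show "f \<in> Hom P n m \<Longrightarrow> g \<in> Hom P m k \<Longrightarrow> Comp P f g \<in> Hom P n k"
    by (rule axioms(1)[unfolded is_category_def, THEN conjunct2, THEN conjunct1, rule_format])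
  show "f \<in> Hom P n m \<Longrightarrow> g' \<in> Hom P n' m' \<Longrightarrow> Tens P f g' \<in> Hom P (n + n') (m + m')"
    by (rule axioms(2)[unfolded is_strict_monoidal_def, THEN conjunct1, rule_format])
qed

lemmas tens_comp = axioms(2)[unfolded is_strict_monoidal_def, THEN conjunct2, THEN conjunct2,
    THEN conjunct1, rule_format]

lemmas tens_assoc = axioms(2)[unfolded is_strict_monoidal_def, THEN conjunct2, THEN conjunct2,
    THEN conjunct2, THEN conjunct2, rule_format]

lemma image_category: "is_category Q"
  unfolding is_category_def hom ident ball_simps
proof (intro conjI allI ballI)
  fix n show "F (Ident P n) \<in> F ` Hom P n n" using props(1) by blast
  fix m f assume f: "f \<in> Hom P n m"
  show "Comp Q (F (Ident P n)) (F f) = F f" "Comp Q (F f) (F (Ident P m)) = F f"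
    unfolding comp[OF props(1) f] comp[OF f props(1)]
    using is_prop_P f unfolding is_prop_def is_category_def by simp_all
  fix k g assume g: "g \<in> Hom P m k"
  show "Comp Q (F f) (F g) \<in> F ` Hom P n k"
    unfolding comp[OF f g] using props(3)[OF f g] by blast
  fix l h assume h: "h \<in> Hom P k l"
  show "Comp Q (Comp Q (F f) (F g)) (F h) = Comp Q (F f) (Comp Q (F g) (F h))"
    unfolding comp[OF f g] comp[OF g h] comp[OF props(3)[OF f g] h] comp[OF f props(3)[OF g h]]
    using is_prop_P f g h unfolding is_prop_def is_category_def by metis
qed

lemma image_monoidal: "is_strict_monoidal Q"
  unfolding is_strict_monoidal_def hom ident ball_simps
proof (intro conjI allI ballI)
  fix n m show "Tens Q (F (Ident P n)) (F (Ident P m)) = F (Ident P (n + m))"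
    unfolding tens[OF props(1) props(1)]
    using is_prop_P unfolding is_prop_def is_strict_monoidal_def by simp
  fix f assume f: "f \<in> Hom P n m"
  show "Tens Q (F (Ident P 0)) (F f) = F f" "Tens Q (F f) (F (Ident P 0)) = F f"
    unfolding tens[OF props(1) f] tens[OF f props(1)]
    using is_prop_P f unfolding is_prop_def is_strict_monoidal_def by metis+
next
  fix n m n' m' f g assume f: "f \<in> Hom P n m" and g: "g \<in> Hom P n' m'"
  show "Tens Q (F f) (F g) \<in> F ` Hom P (n + n') (m + m')"
    unfolding tens[OF f g] using props(4)[OF f g] by blast
  fix n'' m'' h assume h: "h \<in> Hom P n'' m''"
  show "Tens Q (Tens Q (F f) (F g)) (F h) = Tens Q (F f) (Tens Q (F g) (F h))"
    unfolding tens[OF f g] tens[OF g h] tens[OF props(4)[OF f g] h] tens[OF f props(4)[OF g h]]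
      tens_assoc[OF f g h] ..
next
  fix n m k n' m' k' f g f' g'
  assume f: "f \<in> Hom P n m" and g: "g \<in> Hom P m k" and f': "f' \<in> Hom P n' m'" and g': "g' \<in> Hom P m' k'"
  show "Tens Q (Comp Q (F f) (F g)) (Comp Q (F f') (F g')) = Comp Q (Tens Q (F f) (F f')) (Tens Q (F g) (F g'))"
    unfolding comp[OF f g] comp[OF f' g'] tens[OF f f'] tens[OF g g']
      tens[OF props(3)[OF f g] props(3)[OF f' g']] comp[OF props(4)[OF f f'] props(4)[OF g g']]
      tens_comp[OF f g f' g'] ..
qed

lemma image_symmetric: "is_symmetric Q"
  unfolding is_symmetric_def hom ident symm ball_simps
proof (intro conjI allI ballI)
  fix n m show "F (Symm P n m) \<in> F ` Hom P (n + m) (m + n)" using props(2) by blast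
  show "Comp Q (F (Symm P n m)) (F (Symm P m n)) = F (Ident P (n + m))"
    unfolding comp[OF props(2) props(2)]
    using is_prop_P unfolding is_prop_def is_symmetric_def by simp
  fix k
  have 1: "Tens P (Symm P n m) (Ident P k) \<in> Hom P (n + m + k) (m + n + k)"
    by (rule props(4)[OF props(2,1)])
  have 2: "Tens P (Ident P m) (Symm P n k) \<in> Hom P (m + n + k) (m + (k + n))"
    using props(4)[OF props(1,2), of m n k] by (simp add: add.assoc)
  show "F (Symm P n (m + k)) =
      Comp Q (Tens Q (F (Symm P n m)) (F (Ident P k))) (Tens Q (F (Ident P m)) (F (Symm P n k)))"
    unfolding tens[OF props(2,1)] tens[OF props(1,2)] comp[OF 1 2]
    using is_prop_P unfolding is_prop_def is_symmetric_def by metis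
next
  fix n m n' m' f g assume f: "f \<in> Hom P n m" and g: "g \<in> Hom P n' m'"
  show "Comp Q (Tens Q (F f) (F g)) (F (Symm P m m')) = Comp Q (F (Symm P n n')) (Tens Q (F g) (F f))"
    unfolding tens[OF f g] tens[OF g f] comp[OF props(4)[OF f g] props(2)] comp[OF props(2) props(4)[OF g f]]
    using is_prop_P f g unfolding is_prop_def is_symmetric_def by metis
qed

theorem is_prop_image: "is_prop Q"
  by (simp add: is_prop_def image_category image_monoidal image_symmetric)

end


section \<open>The isomorphism\<close>

definition scls :: "span \<Rightarrow> span set" where
  "scls s = span_rel `` {s}"

lemma mem_scls: "t \<in> scls s \<longleftrightarrow> (s, t) \<in> span_rel"
  by (simp add: scls_def)

lemma self_mem_scls: "is_span s \<Longrightarrow> s \<in> scls s"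
  by (simp add: mem_scls span_rel_iff)

lemma scls_eq_iff:
  assumes "is_span s"
  shows "scls s = scls t \<longleftrightarrow> (s, t) \<in> span_rel"
proof
  assume "scls s = scls t"
  then have "(t, s) \<in> span_rel" using self_mem_scls[OF assms] by (simp add: mem_scls)
  then show "(s, t) \<in> span_rel" by (simp add: span_rel_iff)
next
  assume "(s, t) \<in> span_rel"
  then have "r \<in> scls s \<longleftrightarrow> r \<in> scls t" for r by (auto simp: mem_scls span_rel_iff)
  then show "scls s = scls t" by blast
qed

lemma SpanAff_simps:
  "Hom SpanAff n m = scls ` {s. is_span s \<and> src s = F2 n \<and> tgt s = F2 m}"
  "Comp SpanAff S T = (\<Union>s\<in>S. \<Union>t\<in>T. scls (span_comp s t))"
  "Tens SpanAff S T = (\<Union>s\<in>S. \<Union>t\<in>T. scls (span_tens s t))"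
  "Ident SpanAff n = scls (span_of (Idn n))"
  "Symm SpanAff n m = scls (span_of (Swap n m))"
  by (auto simp: SpanAff_def scls_def span_hom_def span_id_def span_symm_def quotient_def)

lemma SpanAff_Comp:
  assumes "is_span s" "is_span t" "tgt s = F2 m" "src t = F2 m"
  shows "Comp SpanAff (scls s) (scls t) = scls (span_comp s t)"
  unfolding SpanAff_simps
proof (rule UN_const)
  show "scls s \<noteq> {}" "scls t \<noteq> {}" using assms self_mem_scls by blast+
  fix s' t' assume "s' \<in> scls s" "t' \<in> scls t"
  then have st': "is_span s'" "is_span t'" "src s' = src s" "tgt s' = F2 m" "src t' = F2 m" "tgt t' = tgt t"
    "cnt s' = cnt s" "cnt t' = cnt t"
    using assms by (auto simp: mem_scls span_rel_iff)
  have sp: "is_span (span_comp s' t')" "is_span (span_comp s t)"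
    using assms st' by (simp_all add: is_span_comp)
  moreover have "cnt (span_comp s' t') = cnt (span_comp s t)"
    using assms st' by (intro ext) (simp add: cnt_comp)
  moreover have "src (span_comp s' t') = src (span_comp s t)" "tgt (span_comp s' t') = tgt (span_comp s t)"
    using st' by (simp_all add: span_comp_def)
  ultimately show "scls (span_comp s' t') = scls (span_comp s t)"
    by (simp add: scls_eq_iff span_rel_iff)
qed

lemma SpanAff_Tens:
  assumes "is_span s" "is_span t" "src s = F2 n" "tgt s = F2 m"
  shows "Tens SpanAff (scls s) (scls t) = scls (span_tens s t)"
  unfolding SpanAff_simps
proof (rule UN_const)
  show "scls s \<noteq> {}" "scls t \<noteq> {}" using assms self_mem_scls by blast+
  fix s' t' assume "s' \<in> scls s" "t' \<in> scls t"
  then have st': "is_span s'" "is_span t'" "src s' = F2 n" "tgt s' = F2 m" "src t' = src t" "tgt t' = tgt t"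
    "cnt s' = cnt s" "cnt t' = cnt t"
    using assms by (auto simp: mem_scls span_rel_iff)
  have sp: "is_span (span_tens s' t')" "is_span (span_tens s t)"
    using assms st' by (simp_all add: is_span_tens)
  moreover have "cnt (span_tens s' t') = cnt (span_tens s t)"
    using assms st' by (intro ext) (simp add: cnt_tens)
  moreover have "src (span_tens s' t') = src (span_tens s t)" "tgt (span_tens s' t') = tgt (span_tens s t)"
    using assms st' by (simp_all add: span_tens_def)
  ultimately show "scls (span_tens s' t') = scls (span_tens s t)"
    by (simp add: scls_eq_iff span_rel_iff)
qed

abbreviation tcls :: "gen pterm \<Rightarrow> gen pterm set" where
  "tcls \<equiv> cls gen_arity rels_spAffcb2"

definition sem :: "gen pterm set \<Rightarrow> span set" where
  "sem S = (\<Union>t\<in>S. scls (span_of t))"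

lemma typed_span_of:
  assumes "typed gen_arity t n m"
  shows "is_span (span_of t)" "src (span_of t) = F2 n" "tgt (span_of t) = F2 m" "cnt (span_of t) = cmat t"
  using assms span_of_correct[of t] by (auto simp: typed_iff)

lemma M_abs_mor: "typed gen_arity t n m \<Longrightarrow> M (abs_mor t) = cmat t"
  by (simp add: M.abs_eq typed_iff fun_eq_iff)

text \<open>From left to right this is completeness, through \<open>M_complete\<close>; from right
  to left it is soundness, which is contained in \<open>M\<close> being defined on equivalence
  classes.\<close>

lemma span_rel_iff_peq:
  assumes s: "typed gen_arity s n m" and t: "typed gen_arity t n m"
  shows "(span_of s, span_of t) \<in> span_rel \<longleftrightarrow> peq gen_arity rels_spAffcb2 n m s t"
proof -
  have "(span_of s, span_of t) \<in> span_rel \<longleftrightarrow> M (abs_mor s) = M (abs_mor t)"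
    using typed_span_of[OF s] typed_span_of[OF t] M_abs_mor[OF s] M_abs_mor[OF t] by (simp add: span_rel_iff)
  also have "\<dots> \<longleftrightarrow> abs_mor s = abs_mor t"
    using s t M_complete[of "abs_mor s" "abs_mor t"]
    by (auto simp: typed_iff wf.abs_eq dom.abs_eq cod.abs_eq)
  also have "\<dots> \<longleftrightarrow> peq gen_arity rels_spAffcb2 n m s t"
    using s t by (auto simp: mor.abs_eq_iff eqv_def typed_iff)
  finally show ?thesis .
qed

lemma sem_tcls:
  assumes t: "typed gen_arity t n m"
  shows "sem (tcls t) = scls (span_of t)"
proof -
  have "scls (span_of s) = scls (span_of t)" if "s \<in> tcls t" for s
  proof -
    have p: "peq gen_arity rels_spAffcb2 n m t s" using that mem_cls_typed[OF t] by blast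
    then have s: "typed gen_arity s n m" using peq_typed by blast
    show ?thesis
      using span_rel_iff_peq[OF t s] p scls_eq_iff[OF typed_span_of(1)[OF t]] by blast
  qed
  moreover have "t \<in> tcls t" using mem_cls_typed[OF t] peq_refl[OF t] by blast
  ultimately show ?thesis unfolding sem_def by blast
qed

lemma sem_image: "Hom SpanAff n m = sem ` Hom spAffcb2 n m"
proof -
  have "scls s \<in> sem ` Hom spAffcb2 n m" if s: "is_span s" "src s = F2 n" "tgt s = F2 m" for s
  proof -
    obtain f where f: "wf f" "dom f = n" "cod f = m" "M f = cnt s"
      using span_realised[OF s] by blast
    obtain t where t: "f = abs_mor t"
      using mor.abs_induct[of "\<lambda>f. \<exists>t. f = abs_mor t" f] by blast
    have ty: "typed gen_arity t n m"
      using f unfolding t by (simp add: typed_iff wf.abs_eq dom.abs_eq cod.abs_eq)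
    have "cnt (span_of t) = cnt s"
      using f(4) typed_span_of(4)[OF ty] M_abs_mor[OF ty] unfolding t by simp
    then have "scls (span_of t) = scls s"
      using typed_span_of[OF ty] s by (simp add: scls_eq_iff span_rel_iff)
    then show ?thesis
      using sem_tcls[OF ty] ty unfolding spAffcb2_def presented_simps by blast
  qed
  moreover have "sem (tcls t) \<in> Hom SpanAff n m" if "typed gen_arity t n m" for t
    unfolding SpanAff_simps sem_tcls[OF that] using typed_span_of[OF that] by blast
  ultimately show ?thesis
    unfolding spAffcb2_def presented_simps SpanAff_simps by blast
qed

lemma sem_functor: "prop_image spAffcb2 SpanAff sem"
proof
  note ty = typed.intros
  show "is_prop spAffcb2" unfolding spAffcb2_def by (rule is_prop_presented)
  fix n m show "Hom SpanAff n m = sem ` Hom spAffcb2 n m" by (rule sem_image)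
  show "Ident SpanAff n = sem (Ident spAffcb2 n)"
    unfolding spAffcb2_def presented_simps SpanAff_simps sem_tcls[OF ty(2)] ..
  show "Symm SpanAff n m = sem (Symm spAffcb2 n m)"
    unfolding spAffcb2_def presented_simps SpanAff_simps sem_tcls[OF ty(3)] ..
next
  fix f n m g k assume "f \<in> Hom spAffcb2 n m" "g \<in> Hom spAffcb2 m k"
  then obtain s t where s: "typed gen_arity s n m" "f = tcls s" and t: "typed gen_arity t m k" "g = tcls t"
    unfolding spAffcb2_def by (meson presented_homE)
  show "Comp SpanAff (sem f) (sem g) = sem (Comp spAffcb2 f g)"
    unfolding spAffcb2_def s(2) t(2) presented_Comp[OF s(1) t(1)] sem_tcls[OF s(1)] sem_tcls[OF t(1)]
      sem_tcls[OF typed.intros(4)[OF s(1) t(1)]]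
    using SpanAff_Comp[OF typed_span_of(1)[OF s(1)] typed_span_of(1)[OF t(1)] typed_span_of(3)[OF s(1)] typed_span_of(2)[OF t(1)]]
    by simp
next
  fix f n m g n' m' assume "f \<in> Hom spAffcb2 n m" "g \<in> Hom spAffcb2 n' m'"
  then obtain s t where s: "typed gen_arity s n m" "f = tcls s" and t: "typed gen_arity t n' m'" "g = tcls t"
    unfolding spAffcb2_def by (meson presented_homE)
  show "Tens SpanAff (sem f) (sem g) = sem (Tens spAffcb2 f g)"
    unfolding spAffcb2_def s(2) t(2) presented_Tens[OF s(1) t(1)] sem_tcls[OF s(1)] sem_tcls[OF t(1)]
      sem_tcls[OF typed.intros(5)[OF s(1) t(1)]]
    using SpanAff_Tens[OF typed_span_of(1)[OF s(1)] typed_span_of(1)[OF t(1)] typed_span_of(2)[OF s(1)] typed_span_of(3)[OF s(1)]]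
    by simp
qed

lemma sem_inj: "inj_on sem (Hom spAffcb2 n m)"
proof (rule inj_onI)
  fix f g assume "f \<in> Hom spAffcb2 n m" "g \<in> Hom spAffcb2 n m" and eq: "sem f = sem g"
  then obtain s t where s: "typed gen_arity s n m" "f = tcls s" and t: "typed gen_arity t n m" "g = tcls t"
    unfolding spAffcb2_def by (meson presented_homE)
  have "(span_of s, span_of t) \<in> span_rel"
    using eq unfolding s(2) t(2) sem_tcls[OF s(1)] sem_tcls[OF t(1)] scls_eq_iff[OF typed_span_of(1)[OF s(1)]] .
  then show "f = g"
    unfolding s(2) t(2) span_rel_iff_peq[OF s(1) t(1)] by (rule cls_eqI)
qed

theorem lemma2p16:
  shows "\<exists>F. prop_iso spAffcb2 SpanAff F \<and> (\<forall>g. F (spAffcb2_gen g) = interp g)"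
proof (intro exI[of _ sem] conjI allI)
  interpret prop_image spAffcb2 SpanAff sem by (rule sem_functor)
  show "prop_iso spAffcb2 SpanAff sem"
    unfolding prop_iso_def bij_betw_def
    using is_prop_P is_prop_image sem_inj by (simp add: hom ident symm comp tens)
  fix g
  have "typed gen_arity (Gen g) (fst (gen_arity g)) (snd (gen_arity g))"
    by (simp add: typed_iff)
  from sem_tcls[OF this] show "sem (spAffcb2_gen g) = interp g"
    by (simp add: spAffcb2_gen_def interp_def cls_def scls_def)
qed

end
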